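(* Let $k$ be an algebraically closed field of characteristic zero, $\mathfrak{g}$ a finite-dimensional simple Lie algebra over $k$, $S$ a unital, commutative, associative, reduced $k$-algebra of finite type, and $\Gamma$ a finite group acting on $\mathfrak{g}\otimes_k S$ by $k$-Lie algebra automorphisms. Let $\mathcal{L}=(\mathfrak{g}\otimes_k S)^\Gamma$, and let $\phi:\mathcal{L}\to\mathrm{End}_k(V)$ be an irreducible finite-dimensional representation of the $k$-Lie algebra $\mathcal{L}$. Then there exist maximal ideals $M_1,\ldots,M_r\in\mathrm{Max}\,S$ in distinct $\Gamma$-orbits, finite-dimensional simple $\mathfrak{g}^{M_i}$-modules $(V_i,\phi_i)$ (for $i=1,\ldots,r$), and a (possibly trivial) $1$-dimensional $\mathcal{L}$-module $W$, such that $V\cong W\otimes_k V_1\otimes_k\cdots\otimes_k V_r$ as $\mathcal{L}$-modules, with $\mathcal{L}$-action defined by $\phi_i\circ\mathrm{ev}_{M_i}$ on each $V_i$.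
   Context: The bracket on $\mathfrak{g}\otimes_k S$ is $[x\otimes r,y\otimes s]=[x,y]\otimes rs$, and $\mathcal{L}=\{z\in\mathfrak{g}\otimes_k S:{}^\gamma z=z\text{ for all }\gamma\in\Gamma\}$. $\mathrm{Max}\,S$ is the set of maximal ideals of $S$; for $s\in S$ and $M\in\mathrm{Max}\,S$, $s(M)\in k$ is the residue class of $s$ in $S/M\cong k$, and for $z=\sum x_i\otimes s_i\in\mathfrak{g}\otimes_k S$, $z(M)=\sum s_i(M)x_i\in\mathfrak{g}$. The action of $\Gamma$ on $\mathfrak{g}\otimes_k S$ induces an action on $\mathrm{Max}\,S$ determined by ${}^\gamma(\mathfrak{g}\otimes_k M)=\mathfrak{g}\otimes_k{}^\gamma M$. For $M\in\mathrm{Max}\,S$, $\Gamma^M=\{\gamma\in\Gamma:{}^\gamma M=M\}$; for $\gamma\in\Gamma$, $\gamma(M):\mathfrak{g}\to\mathfrak{g}$ is the map $\gamma(M)x=({}^\gamma(x\otimes 1))(M)$; and $\mathfrak{g}^M=\{x\in\mathfrak{g}:\gamma(M)x=x\text{ for all }\gamma\in\Gamma^M\}$. The evaluation map $\mathrm{ev}_M:\mathcal{L}\to\mathfrak{g}^M$ is the Lie algebra homomorphism $z\mapsto z(M)$. The case $r=0$ is allowed. *)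

theory Defs
  imports
    "HOL-Computational_Algebra.Polynomial"
    "HOL-Library.Poly_Mapping"
    "HOL-Algebra.Group_Action"
begin

text \<open>
  Vector spaces over the ground field \<open>'k\<close> are given by their scalar multiplication, as in
  \<^locale>\<open>vector_space\<close>.  Representation spaces are subspaces of an ambient vector space, because the
  modules in the conclusion are existentially quantified and HOL cannot quantify over types.
\<close>

definition fin_dim :: "('k::field \<Rightarrow> 'v::ab_group_add \<Rightarrow> 'v) \<Rightarrow> 'v set \<Rightarrow> bool" where
  "fin_dim s V \<longleftrightarrow> (\<exists>B. finite B \<and> module.span s B = V)"


section \<open>Lie algebras and their modules\<close>

locale lie_algebra = vector_space scale
  for scale :: "'k::field \<Rightarrow> 'g::ab_group_add \<Rightarrow> 'g" +
  fixes bracket :: "'g \<Rightarrow> 'g \<Rightarrow> 'g"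
  assumes bracket_linear_right: "Vector_Spaces.linear scale scale (\<lambda>y. bracket x y)"
    and bracket_linear_left: "Vector_Spaces.linear scale scale (\<lambda>x. bracket x y)"
    and bracket_self: "bracket x x = 0"
    and jacobi: "bracket x (bracket y z) + bracket y (bracket z x) + bracket z (bracket x y) = 0"

definition lie_ideal :: "('k::field \<Rightarrow> 'g::ab_group_add \<Rightarrow> 'g) \<Rightarrow> ('g \<Rightarrow> 'g \<Rightarrow> 'g) \<Rightarrow> 'g set \<Rightarrow> bool" where
  "lie_ideal s br I \<longleftrightarrow> module.subspace s I \<and> (\<forall>x. \<forall>y\<in>I. br x y \<in> I)"

definition simple_lie_algebra :: "('k::field \<Rightarrow> 'g::ab_group_add \<Rightarrow> 'g) \<Rightarrow> ('g \<Rightarrow> 'g \<Rightarrow> 'g) \<Rightarrow> bool" where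
  "simple_lie_algebra s br \<longleftrightarrow> lie_algebra s br \<and> (\<exists>x y. br x y \<noteq> 0) \<and>
     (\<forall>I. lie_ideal s br I \<longrightarrow> I = {0} \<or> I = UNIV)"

text \<open>
  \<open>lie_module sL br L s V \<rho>\<close>: the subspace \<open>V\<close> is a module, via \<open>\<rho>\<close>, over the Lie subalgebra \<open>L\<close> of
  the Lie algebra \<open>(sL, br)\<close>.  Values of \<open>\<rho>\<close> outside of \<open>L\<close> and \<open>V\<close> are irrelevant.
\<close>

definition lie_module ::
  "('k::field \<Rightarrow> 'l::ab_group_add \<Rightarrow> 'l) \<Rightarrow> ('l \<Rightarrow> 'l \<Rightarrow> 'l) \<Rightarrow> 'l set \<Rightarrow>
   ('k \<Rightarrow> 'v::ab_group_add \<Rightarrow> 'v) \<Rightarrow> 'v set \<Rightarrow> ('l \<Rightarrow> 'v \<Rightarrow> 'v) \<Rightarrow> bool" where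
  "lie_module sL br L s V \<rho> \<longleftrightarrow>
     vector_space s \<and> module.subspace s V \<and>
     (\<forall>x\<in>L. \<forall>v\<in>V. \<rho> x v \<in> V) \<and>
     (\<forall>x\<in>L. \<forall>v\<in>V. \<forall>w\<in>V. \<rho> x (v + w) = \<rho> x v + \<rho> x w) \<and>
     (\<forall>x\<in>L. \<forall>c. \<forall>v\<in>V. \<rho> x (s c v) = s c (\<rho> x v)) \<and>
     (\<forall>x\<in>L. \<forall>y\<in>L. \<forall>v\<in>V. \<rho> (x + y) v = \<rho> x v + \<rho> y v) \<and>
     (\<forall>c. \<forall>x\<in>L. \<forall>v\<in>V. \<rho> (sL c x) v = s c (\<rho> x v)) \<and>
     (\<forall>x\<in>L. \<forall>y\<in>L. \<forall>v\<in>V. \<rho> (br x y) v = \<rho> x (\<rho> y v) - \<rho> y (\<rho> x v))"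

definition simple_lie_module ::
  "('k::field \<Rightarrow> 'l::ab_group_add \<Rightarrow> 'l) \<Rightarrow> ('l \<Rightarrow> 'l \<Rightarrow> 'l) \<Rightarrow> 'l set \<Rightarrow>
   ('k \<Rightarrow> 'v::ab_group_add \<Rightarrow> 'v) \<Rightarrow> 'v set \<Rightarrow> ('l \<Rightarrow> 'v \<Rightarrow> 'v) \<Rightarrow> bool" where
  "simple_lie_module sL br L s V \<rho> \<longleftrightarrow>
     lie_module sL br L s V \<rho> \<and> V \<noteq> {0} \<and>
     (\<forall>U. module.subspace s U \<and> U \<subseteq> V \<and> (\<forall>x\<in>L. \<forall>u\<in>U. \<rho> x u \<in> U) \<longrightarrow> U = {0} \<or> U = V)"

definition lie_module_iso ::
  "'l set \<Rightarrow> ('k::field \<Rightarrow> 'v::ab_group_add \<Rightarrow> 'v) \<Rightarrow> 'v set \<Rightarrow> ('l \<Rightarrow> 'v \<Rightarrow> 'v) \<Rightarrow>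
   ('k \<Rightarrow> 'w::ab_group_add \<Rightarrow> 'w) \<Rightarrow> 'w set \<Rightarrow> ('l \<Rightarrow> 'w \<Rightarrow> 'w) \<Rightarrow> bool" where
  "lie_module_iso L s1 V1 \<rho>1 s2 V2 \<rho>2 \<longleftrightarrow>
     (\<exists>h. bij_betw h V1 V2 \<and>
        (\<forall>v\<in>V1. \<forall>w\<in>V1. h (v + w) = h v + h w) \<and>
        (\<forall>c. \<forall>v\<in>V1. h (s1 c v) = s2 c (h v)) \<and>
        (\<forall>x\<in>L. \<forall>v\<in>V1. h (\<rho>1 x v) = \<rho>2 x (h v)))"


section \<open>Tensor products\<close>

text \<open>
  Tensor products are the usual quotients of free vector spaces, taken up to isomorphism: the free
  vector space on \<open>X\<close> consists of the finitely supported functions \<open>p\<close> with \<open>keys p \<subseteq> X\<close>, and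
  \<open>presented_by s T X R \<tau>\<close> says that the linear extension of \<open>\<tau>\<close> to it is onto \<open>T\<close> with kernel the
  span of the relations \<open>R\<close>.
\<close>

definition free_scale :: "'k::field \<Rightarrow> ('x \<Rightarrow>\<^sub>0 'k) \<Rightarrow> ('x \<Rightarrow>\<^sub>0 'k)" where
  "free_scale c p = Poly_Mapping.map ((*) c) p"

lemma lookup_free_scale [simp]: "Poly_Mapping.lookup (free_scale c p) x = c * Poly_Mapping.lookup p x"
  unfolding free_scale_def by transfer (simp add: when_def)

lemma vector_space_free_scale: "vector_space free_scale"
  by unfold_locales (auto intro!: poly_mapping_eqI simp: lookup_add algebra_simps)

definition free_gen :: "'x \<Rightarrow> ('x \<Rightarrow>\<^sub>0 'k::field)" where
  "free_gen x = Poly_Mapping.single x 1"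

definition lin_ext :: "('k::field \<Rightarrow> 't::ab_group_add \<Rightarrow> 't) \<Rightarrow> ('x \<Rightarrow> 't) \<Rightarrow> ('x \<Rightarrow>\<^sub>0 'k) \<Rightarrow> 't" where
  "lin_ext s \<tau> p = (\<Sum>x\<in>Poly_Mapping.keys p. s (Poly_Mapping.lookup p x) (\<tau> x))"

definition presented_by ::
  "('k::field \<Rightarrow> 't::ab_group_add \<Rightarrow> 't) \<Rightarrow> 't set \<Rightarrow> 'x set \<Rightarrow> ('x \<Rightarrow>\<^sub>0 'k) set \<Rightarrow> ('x \<Rightarrow> 't) \<Rightarrow> bool" where
  "presented_by s T X R \<tau> \<longleftrightarrow>
     vector_space s \<and>
     lin_ext s \<tau> ` {p. Poly_Mapping.keys p \<subseteq> X} = T \<and>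
     (\<forall>p. Poly_Mapping.keys p \<subseteq> X \<longrightarrow> (lin_ext s \<tau> p = 0 \<longleftrightarrow> p \<in> module.span free_scale R))"

definition bilinear_relations ::
  "('k::field \<Rightarrow> 'a::ab_group_add \<Rightarrow> 'a) \<Rightarrow> ('k \<Rightarrow> 'b::ab_group_add \<Rightarrow> 'b) \<Rightarrow> ('a \<times> 'b \<Rightarrow>\<^sub>0 'k) set" where
  "bilinear_relations s1 s2 =
     {free_gen (x + x', y) - free_gen (x, y) - free_gen (x', y) | x x' y. True} \<union>
     {free_gen (x, y + y') - free_gen (x, y) - free_gen (x, y') | x y y'. True} \<union>
     {free_gen (s1 c x, y) - free_scale c (free_gen (x, y)) | c x y. True} \<union>
     {free_gen (x, s2 c y) - free_scale c (free_gen (x, y)) | c x y. True}"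

definition is_tensor_product ::
  "('k::field \<Rightarrow> 'a::ab_group_add \<Rightarrow> 'a) \<Rightarrow> ('k \<Rightarrow> 'b::ab_group_add \<Rightarrow> 'b) \<Rightarrow>
   ('k \<Rightarrow> 't::ab_group_add \<Rightarrow> 't) \<Rightarrow> ('a \<Rightarrow> 'b \<Rightarrow> 't) \<Rightarrow> bool" where
  "is_tensor_product s1 s2 sT tens \<longleftrightarrow>
     presented_by sT UNIV UNIV (bilinear_relations s1 s2) (\<lambda>(x, y). tens x y)"

text \<open>The family version: a tuple \<open>(v\<^sub>i)\<^sub>i\<^sub>\<in>\<^sub>I\<close> is an element of \<^term>\<open>Pi\<^sub>E I Vs\<close>.\<close>

definition multilinear_relations ::
  "'i set \<Rightarrow> ('k::field \<Rightarrow> 'v::ab_group_add \<Rightarrow> 'v) \<Rightarrow> ('i \<Rightarrow> 'v set) \<Rightarrow> (('i \<Rightarrow> 'v) \<Rightarrow>\<^sub>0 'k) set" where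
  "multilinear_relations I s Vs =
     {free_gen (v(i := a + b)) - free_gen (v(i := a)) - free_gen (v(i := b)) | v i a b.
        v \<in> Pi\<^sub>E I Vs \<and> i \<in> I \<and> a \<in> Vs i \<and> b \<in> Vs i} \<union>
     {free_gen (v(i := s c a)) - free_scale c (free_gen (v(i := a))) | v i c a.
        v \<in> Pi\<^sub>E I Vs \<and> i \<in> I \<and> a \<in> Vs i}"

text \<open>
  \<open>(T, \<theta>)\<close> is the tensor product over \<open>i \<in> I\<close> of the \<open>L\<close>-modules \<open>(Vs i, \<rho> i)\<close>, with
  \<open>\<tau> v\<close> the pure tensor of the tuple \<open>v\<close>.
\<close>

definition is_tensor_lie_module ::
  "('k::field \<Rightarrow> 'l::ab_group_add \<Rightarrow> 'l) \<Rightarrow> ('l \<Rightarrow> 'l \<Rightarrow> 'l) \<Rightarrow> 'l set \<Rightarrow>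
   'i set \<Rightarrow> ('k \<Rightarrow> 'v::ab_group_add \<Rightarrow> 'v) \<Rightarrow> ('i \<Rightarrow> 'v set) \<Rightarrow> ('i \<Rightarrow> 'l \<Rightarrow> 'v \<Rightarrow> 'v) \<Rightarrow>
   ('k \<Rightarrow> 't::ab_group_add \<Rightarrow> 't) \<Rightarrow> 't set \<Rightarrow> ('l \<Rightarrow> 't \<Rightarrow> 't) \<Rightarrow> (('i \<Rightarrow> 'v) \<Rightarrow> 't) \<Rightarrow> bool" where
  "is_tensor_lie_module sL br L I s Vs \<rho> sT T \<theta> \<tau> \<longleftrightarrow>
     (\<forall>i\<in>I. lie_module sL br L s (Vs i) (\<rho> i)) \<and>
     presented_by sT T (Pi\<^sub>E I Vs) (multilinear_relations I s Vs) \<tau> \<and>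
     lie_module sL br L sT T \<theta> \<and>
     (\<forall>z\<in>L. \<forall>v\<in>Pi\<^sub>E I Vs. \<theta> z (\<tau> v) = (\<Sum>i\<in>I. \<tau> (v(i := \<rho> i z (v i)))))"


section \<open>The algebra of coordinates\<close>

text \<open>
  The sort \<open>{comm_ring, comm_monoid_mult}\<close> is that of unital commutative rings; unlike
  \<^class>\<open>comm_ring_1\<close> it admits the zero ring.
\<close>

locale comm_algebra = vector_space scale
  for scale :: "'k::field \<Rightarrow> 's::{comm_ring, comm_monoid_mult} \<Rightarrow> 's" +
  assumes scale_mult: "scale c (a * b) = scale c a * b"

definition subalgebra :: "('k::field \<Rightarrow> 's::{comm_ring, comm_monoid_mult} \<Rightarrow> 's) \<Rightarrow> 's set \<Rightarrow> bool" where
  "subalgebra sS A \<longleftrightarrow> module.subspace sS A \<and> 1 \<in> A \<and> (\<forall>a\<in>A. \<forall>b\<in>A. a * b \<in> A)"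

definition finite_type :: "('k::field \<Rightarrow> 's::{comm_ring, comm_monoid_mult} \<Rightarrow> 's) \<Rightarrow> bool" where
  "finite_type sS \<longleftrightarrow> (\<exists>G. finite G \<and> subalgebra sS hull G = UNIV)"

definition ring_ideal :: "'s::{comm_ring, comm_monoid_mult} set \<Rightarrow> bool" where
  "ring_ideal I \<longleftrightarrow> 0 \<in> I \<and> (\<forall>a\<in>I. \<forall>b\<in>I. a + b \<in> I) \<and> (\<forall>r. \<forall>a\<in>I. r * a \<in> I)"

definition Max_spec :: "'s::{comm_ring, comm_monoid_mult} set set" where
  "Max_spec = {M. ring_ideal M \<and> M \<noteq> UNIV \<and> (\<forall>J. ring_ideal J \<and> M \<subseteq> J \<longrightarrow> J = M \<or> J = UNIV)}"

text \<open>
  \<open>residue sS s M\<close> is \<open>s(M) \<in> k\<close>: the isomorphism \<open>k \<cong> S/M\<close> is \<open>c \<mapsto> c1 + M\<close>, so \<open>s(M)\<close> is the scalar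
  congruent to \<open>s\<close> modulo \<open>M\<close>.
\<close>

definition residue :: "('k::field \<Rightarrow> 's::{comm_ring, comm_monoid_mult} \<Rightarrow> 's) \<Rightarrow> 's \<Rightarrow> 's set \<Rightarrow> 'k" where
  "residue sS s M = (THE c. s - sS c 1 \<in> M)"


section \<open>Evaluation and group action\<close>

text \<open>\<open>eval_at sg sS tens z M\<close> is \<open>z(M)\<close>; it does not depend on how \<open>z\<close> is written as a sum.\<close>

definition eval_at ::
  "('k::field \<Rightarrow> 'g::ab_group_add \<Rightarrow> 'g) \<Rightarrow> ('k \<Rightarrow> 's::{comm_ring, comm_monoid_mult} \<Rightarrow> 's) \<Rightarrow>
   ('g \<Rightarrow> 's \<Rightarrow> 't::ab_group_add) \<Rightarrow> 't \<Rightarrow> 's set \<Rightarrow> 'g" where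
  "eval_at sg sS tens z M =
     (THE y. \<exists>(n::nat) x s. z = (\<Sum>i<n. tens (x i) (s i)) \<and> y = (\<Sum>i<n. sg (residue sS (s i) M) (x i)))"

text \<open>\<open>\<gg> \<otimes> M\<close> as a subspace of \<open>\<gg> \<otimes> S\<close>\<close>

definition tensor_ideal ::
  "('k::field \<Rightarrow> 't::ab_group_add \<Rightarrow> 't) \<Rightarrow> ('g \<Rightarrow> 's \<Rightarrow> 't) \<Rightarrow> 's set \<Rightarrow> 't set" where
  "tensor_ideal sT tens M = module.span sT {tens x m | x m. m \<in> M}"

definition max_act ::
  "('k::field \<Rightarrow> 't::ab_group_add \<Rightarrow> 't) \<Rightarrow> ('g \<Rightarrow> 's::{comm_ring, comm_monoid_mult} \<Rightarrow> 't) \<Rightarrow>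
   ('c \<Rightarrow> 't \<Rightarrow> 't) \<Rightarrow> 'c \<Rightarrow> 's set \<Rightarrow> 's set" where
  "max_act sT tens act \<gamma> M =
     (THE N. N \<in> Max_spec \<and> act \<gamma> ` tensor_ideal sT tens M = tensor_ideal sT tens N)"

definition fixed_subalgebra :: "('c, 'd) monoid_scheme \<Rightarrow> ('c \<Rightarrow> 't \<Rightarrow> 't) \<Rightarrow> 't set" where
  "fixed_subalgebra \<Gamma> act = {z. \<forall>\<gamma>\<in>carrier \<Gamma>. act \<gamma> z = z}"

text \<open>\<open>\<gg>\<^sup>M\<close>; its elements are fixed by the maps \<open>\<gamma>(M)\<close>, where \<open>\<gamma>\<close> ranges over the stabilizer \<open>\<Gamma>\<^sup>M\<close>.\<close>

definition fixed_at ::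
  "('k::field \<Rightarrow> 'g::ab_group_add \<Rightarrow> 'g) \<Rightarrow> ('k \<Rightarrow> 's::{comm_ring, comm_monoid_mult} \<Rightarrow> 's) \<Rightarrow>
   ('k \<Rightarrow> 't::ab_group_add \<Rightarrow> 't) \<Rightarrow> ('g \<Rightarrow> 's \<Rightarrow> 't) \<Rightarrow>
   ('c, 'd) monoid_scheme \<Rightarrow> ('c \<Rightarrow> 't \<Rightarrow> 't) \<Rightarrow> 's set \<Rightarrow> 'g set" where
  "fixed_at sg sS sT tens \<Gamma> act M =
     {x. \<forall>\<gamma>\<in>stabilizer \<Gamma> (max_act sT tens act) M. eval_at sg sS tens (act \<gamma> (tens x 1)) M = x}"

end

theory Submission
  imports Defs
begin

text \<open>
  Multiplications by elements of \<open>S\<close> are exactly the linear maps on \<open>\<gg> \<otimes> S\<close> that commute with all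
  brackets (\<open>centroid\<close>); this is Schur's lemma for the adjoint module of \<open>\<gg>\<close>.  Conjugation by
  \<open>\<gamma> \<in> \<Gamma>\<close> therefore permutes them, so \<open>\<Gamma>\<close> acts on \<open>S\<close> and semilinearly on \<open>\<gg> \<otimes> S\<close>.  Let
  \<open>A = S\<^sup>\<Gamma>\<close>; then \<open>\<L>\<close> is an \<open>A\<close>-module, and \<open>S\<close> is integral over \<open>A\<close> by the relation
  \<open>\<Prod>\<^sub>\<gamma> (s - \<gamma> s) = 0\<close>.

  Dividing the trace of \<open>\<phi>\<close> by \<open>dim V\<close> gives a character of \<open>\<L>\<close>, which becomes the module \<open>W\<close>.  After
  subtracting it no element of \<open>\<L>\<close> acts as a nonzero scalar (\<open>traceless_twist\<close>).  The
  argument of Lie's theorem shows that an abelian ideal of \<open>\<phi>(\<L>)\<close> consists of scalars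
  (\<open>abelian_ideal_acts_by_scalars\<close>), so that it is zero now.  Let \<open>J\<close> be the largest \<open>\<Gamma>\<close>-stable ideal of
  \<open>S\<close> such that the invariants of \<open>\<gg> \<otimes> J\<close> act as zero.  A \<open>\<Gamma>\<close>-stable ideal whose square
  lies in \<open>J\<close> gives an abelian ideal of \<open>\<phi>(\<L>)\<close> and is therefore contained in \<open>J\<close>.  Hence \<open>J\<close> is a
  radical ideal (\<open>J0_semiprime\<close>).  Moreover \<open>A / (A \<inter> J)\<close> is finite-dimensional, because it acts
  faithfully on \<open>\<phi>(\<L>)\<close> (\<open>A_mod_J0_finite\<close>).

  A finite-dimensional reduced algebra over an algebraically closed field is a power of the field:
  there are orthogonal idempotents \<open>e\<^sub>1, \<dots>, e\<^sub>r\<close> of \<open>A\<close> modulo \<open>J\<close> with sum 1 on which \<open>A\<close> acts by scalars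
  (\<open>maximal_system_scalar\<close>).  Above each of these characters of \<open>A\<close> there is a maximal ideal \<open>M\<^sub>i\<close> of \<open>S\<close>,
  with residue field \<open>k\<close> by integrality (\<open>exists_point\<close>); different \<open>i\<close> give different orbits
  (\<open>orthogonal_points\<close>).  If \<open>z \<in> \<L>\<close> vanishes at \<open>M\<^sub>i\<close>, it vanishes on the orbit of \<open>M\<^sub>i\<close>, and then the
  coordinates of \<open>e\<^sub>i z\<close> are nilpotent modulo \<open>J\<close>, so that \<open>e\<^sub>i z\<close> acts as zero (\<open>null_at_point\<close>).
  Thus \<open>z \<mapsto> \<phi>(e\<^sub>i z)\<close> factors through the evaluation at \<open>M\<^sub>i\<close>, which maps onto \<open>\<gg>\<^sup>M\<close> for
  \<open>M = M\<^sub>i\<close> by the Chinese remainder theorem and averaging (\<open>ev_surjective\<close>).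

  Finally \<open>\<phi>\<close> is the sum of the character and of the representations \<open>z \<mapsto> \<phi>(e\<^sub>i z)\<close>, and these
  commute with each other.  An irreducible module for commuting actions over an algebraically closed
  field is the tensor product of irreducible modules for the single actions
  (\<open>irreducible_many_factors\<close>).
\<close>

section \<open>Linear algebra on finite-dimensional subspaces\<close>

locale lin_space = vector_space scale
  for scale :: "'a::field \<Rightarrow> 'b::ab_group_add \<Rightarrow> 'b"
begin

text \<open>
  Modules and their submodules are subspaces of one ambient space, and operators are functions
  whose values outside of the subspace are irrelevant.
\<close>

definition endo_on :: "'b set \<Rightarrow> ('b \<Rightarrow> 'b) \<Rightarrow> bool" where
  "endo_on X f \<longleftrightarrow> (\<forall>v\<in>X. f v \<in> X) \<and> (\<forall>v\<in>X. \<forall>w\<in>X. f (v + w) = f v + f w) \<and>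
     (\<forall>c. \<forall>v\<in>X. f (scale c v) = scale c (f v))"

text \<open>
  The elements of \<open>P\<close> act irreducibly.  They need not form a Lie algebra: the same notion serves
  for several commuting actions taken together.
\<close>

definition irreducible_on :: "'b set \<Rightarrow> ('b \<Rightarrow> 'b) set \<Rightarrow> bool" where
  "irreducible_on X P \<longleftrightarrow> subspace X \<and> X \<noteq> {0} \<and>
     (\<forall>U. subspace U \<and> U \<subseteq> X \<and> (\<forall>f\<in>P. \<forall>u\<in>U. f u \<in> U) \<longrightarrow> U = {0} \<or> U = X)"

lemma irreducible_onD:
  assumes "irreducible_on X P" "subspace U" "U \<subseteq> X" "\<And>f u. f \<in> P \<Longrightarrow> u \<in> U \<Longrightarrow> f u \<in> U"
    and "w \<in> U" "w \<noteq> 0"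
  shows "U = X"
  using assms unfolding irreducible_on_def by blast

lemma irreducible_on_nonzero:
  assumes "irreducible_on X P"
  obtains v where "v \<in> X" "v \<noteq> 0"
  using assms unfolding irreducible_on_def by (metis subspace_0 singletonI subsetI subset_singletonD
      empty_iff)

lemma endo_on_in: "endo_on X f \<Longrightarrow> v \<in> X \<Longrightarrow> f v \<in> X"
  and endo_on_add: "endo_on X f \<Longrightarrow> v \<in> X \<Longrightarrow> w \<in> X \<Longrightarrow> f (v + w) = f v + f w"
  and endo_on_scale: "endo_on X f \<Longrightarrow> v \<in> X \<Longrightarrow> f (scale c v) = scale c (f v)"
  unfolding endo_on_def by auto

lemma endo_on_zero: "endo_on X f \<Longrightarrow> subspace X \<Longrightarrow> f 0 = 0"
  using endo_on_scale[of X f 0 0] subspace_0 by auto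

lemma endo_on_diff:
  assumes "endo_on X f" "subspace X" "v \<in> X" "w \<in> X"
  shows "f (v - w) = f v - f w"
  using endo_on_add[OF assms(1), of "v - w" w] assms subspace_diff[of X v w] by (simp add: algebra_simps)

lemma endo_on_sum:
  assumes "endo_on X f" "subspace X" "\<And>i. i \<in> I \<Longrightarrow> v i \<in> X"
  shows "f (\<Sum>i\<in>I. v i) = (\<Sum>i\<in>I. f (v i))"
  using assms(3)
proof (induction I rule: infinite_finite_induct)
  case (insert i I)
  have "(\<Sum>i\<in>I. v i) \<in> X" by (rule subspace_sum[OF assms(2)]) (use insert in auto)
  then show ?case using insert endo_on_add[OF assms(1)] by auto
qed (auto simp: endo_on_zero[OF assms(1,2)])

lemma endo_on_lincomb:
  assumes "endo_on X f" "subspace X" "\<And>i. i \<in> I \<Longrightarrow> v i \<in> X"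
  shows "f (\<Sum>i\<in>I. scale (c i) (v i)) = (\<Sum>i\<in>I. scale (c i) (f (v i)))"
  by (subst endo_on_sum[OF assms(1,2)]) (auto intro!: sum.cong simp: assms subspace_scale endo_on_scale[OF assms(1)])

lemma endo_on_compose: "endo_on X f \<Longrightarrow> endo_on X g \<Longrightarrow> endo_on X (\<lambda>v. f (g v))"
  unfolding endo_on_def by auto

lemma endo_on_subset: "endo_on X f \<Longrightarrow> U \<subseteq> X \<Longrightarrow> (\<And>u. u \<in> U \<Longrightarrow> f u \<in> U) \<Longrightarrow> endo_on U f"
  unfolding endo_on_def by (auto simp: subset_iff)

lemma endo_on_span:
  assumes f: "endo_on X f" "subspace X" and G: "G \<subseteq> X" "\<And>g. g \<in> G \<Longrightarrow> f g \<in> span H" and u: "u \<in> span G"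
  shows "f u \<in> span H"
proof -
  have "u \<in> {u \<in> X. f u \<in> span H}"
  proof (rule subsetD[OF span_minimal u])
    show "subspace {u \<in> X. f u \<in> span H}"
      unfolding subspace_def using f endo_on_zero[OF f]
      by (auto simp: subspace_0 span_zero subspace_add subspace_scale endo_on_add endo_on_scale span_add span_scale)
  qed (use G in auto)
  then show ?thesis by simp
qed

lemma fin_dim_basis:
  assumes "fin_dim scale X"
  obtains B where "finite B" "independent B" "span B = X"
proof -
  obtain F where F: "finite F" "span F = X" using assms unfolding fin_dim_def by auto
  obtain B where B: "B \<subseteq> X" "independent B" "X \<subseteq> span B" "card B = dim X" by (rule basis_exists)
  have "finite B" using independent_span_bound[OF F(1) B(2)] F(2) B(1) by auto
  moreover have "span B = X" using B F span_minimal[OF B(1)] subspace_span[of F] by auto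
  ultimately show ?thesis using that B by blast
qed

lemma fin_dim_imp_subspace: "fin_dim scale X \<Longrightarrow> subspace X"
  unfolding fin_dim_def using subspace_span by blast

lemma fin_dim_subspace:
  assumes "fin_dim scale X" "subspace U" "U \<subseteq> X"
  shows "fin_dim scale U"
proof -
  obtain F where F: "finite F" "span F = X" using assms unfolding fin_dim_def by auto
  obtain B where B: "B \<subseteq> U" "independent B" "U \<subseteq> span B" "card B = dim U" by (rule basis_exists)
  have "finite B" using independent_span_bound[OF F(1) B(2)] F(2) B(1) assms by auto
  moreover have "span B = U" using B span_minimal[OF B(1) assms(2)] by auto
  ultimately show ?thesis unfolding fin_dim_def by auto
qed

lemma fin_dim_dim_equal:
  assumes "fin_dim scale X" "subspace U" "U \<subseteq> X" "dim X \<le> dim U"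
  shows "U = X"
proof (rule ccontr)
  assume ne: "U \<noteq> X"
  obtain F where F: "finite F" "independent F" "span F = X" using fin_dim_basis[OF assms(1)] by blast
  obtain B where B: "finite B" "independent B" "span B = U"
    using fin_dim_basis[OF fin_dim_subspace[OF assms(1-3)]] by blast
  obtain x where x: "x \<in> X" "x \<notin> span B" using ne assms(3) B by auto
  have ind: "independent (insert x B)" using x B(2) independent_insertI by blast
  have "insert x B \<subseteq> span F" using x F B assms(3) span_superset[of B] by auto
  then have "card (insert x B) \<le> card F" using independent_span_bound[OF F(1) ind] by auto
  moreover have "x \<notin> B" using x span_base by blast
  ultimately have "card B < card F" using B(1) by auto
  moreover have "dim X = card F" "dim U = card B" using F B dim_span_eq_card_independent by auto
  ultimately show False using assms(4) by auto
qed

text \<open>A nonzero invariant subspace of least dimension is irreducible.\<close>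

lemma exists_irreducible_subspace:
  assumes "fin_dim scale X" "X \<noteq> {0}" "\<And>f v. f \<in> P \<Longrightarrow> v \<in> X \<Longrightarrow> f v \<in> X"
  obtains U where "U \<subseteq> X" "irreducible_on U P" "\<And>f v. f \<in> P \<Longrightarrow> v \<in> U \<Longrightarrow> f v \<in> U"
proof -
  define Q where "Q U \<longleftrightarrow> subspace U \<and> U \<subseteq> X \<and> U \<noteq> {0} \<and> (\<forall>f\<in>P. \<forall>u\<in>U. f u \<in> U)" for U
  have "Q X" unfolding Q_def using assms fin_dim_imp_subspace by auto
  then obtain U where U: "Q U" "\<And>U'. Q U' \<Longrightarrow> dim U \<le> dim U'"
    using ex_has_least_nat[of Q X dim] by blast
  have "irreducible_on U P"
    unfolding irreducible_on_def
  proof (intro conjI allI impI)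
    fix W assume W: "subspace W \<and> W \<subseteq> U \<and> (\<forall>f\<in>P. \<forall>u\<in>W. f u \<in> W)"
    show "W = {0} \<or> W = U"
    proof (cases "W = {0}")
      case False
      then have "Q W" using W U(1) unfolding Q_def by auto
      then have "dim U \<le> dim W" by (rule U(2))
      then show ?thesis using fin_dim_dim_equal[of U W] fin_dim_subspace[OF assms(1), of U] W U(1)
        unfolding Q_def by auto
    qed auto
  qed (use U(1) Q_def in auto)
  then show ?thesis using that U(1) unfolding Q_def by blast
qed

lemma nontrivial_relation:
  fixes f :: "nat \<Rightarrow> 'b"
  assumes F: "finite F" and f: "\<And>i. i \<le> card F \<Longrightarrow> f i \<in> span F"
  obtains c where "\<exists>i\<le>card F. c i \<noteq> 0" "(\<Sum>i\<le>card F. scale (c i) (f i)) = 0"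
proof (cases "inj_on f {..card F}")
  case True
  have "dependent (f ` {..card F})"
  proof (rule ccontr)
    assume "\<not> dependent (f ` {..card F})"
    then have "card (f ` {..card F}) \<le> card F"
      using independent_span_bound[OF F] f by auto
    then show False using card_image[OF True] by auto
  qed
  then obtain u where u: "\<exists>v\<in>f ` {..card F}. u v \<noteq> 0" "(\<Sum>v\<in>f ` {..card F}. scale (u v) v) = 0"
    using dependent_finite[of "f ` {..card F}"] by auto
  show ?thesis
  proof (rule that[of "\<lambda>i. u (f i)"])
    show "(\<Sum>i\<le>card F. scale (u (f i)) (f i)) = 0"
      using u(2) by (subst (asm) sum.reindex[OF True]) simp
  qed (use u in auto)
next
  case False
  then obtain i j where ij: "i \<le> card F" "j \<le> card F" "i \<noteq> j" "f i = f j"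
    unfolding inj_on_def by auto
  let ?c = "\<lambda>k. if k = i then (1::'a) else if k = j then -1 else 0"
  have "(\<Sum>k\<le>card F. scale (?c k) (f k)) = (\<Sum>k\<in>{i,j}. scale (?c k) (f k))"
    by (rule sum.mono_neutral_right) (use ij in auto)
  moreover have "\<exists>k\<le>card F. ?c k \<noteq> 0" using ij by (intro exI[of _ i]) auto
  ultimately show ?thesis using that[of ?c] ij by auto
qed

subsection \<open>Polynomials in an operator\<close>

definition poly_op :: "('b \<Rightarrow> 'b) \<Rightarrow> 'a poly \<Rightarrow> 'b \<Rightarrow> 'b" where
  "poly_op f p v = (\<Sum>i\<le>degree p. scale (coeff p i) ((f ^^ i) v))"

lemma poly_op_bound:
  assumes "degree p \<le> N"
  shows "poly_op f p v = (\<Sum>i\<le>N. scale (coeff p i) ((f ^^ i) v))"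
  unfolding poly_op_def by (rule sum.mono_neutral_left) (use assms in \<open>auto simp: coeff_eq_0\<close>)

lemma funpow_in: "(\<And>v. v \<in> X \<Longrightarrow> f v \<in> X) \<Longrightarrow> v \<in> X \<Longrightarrow> (f ^^ i) v \<in> X"
  by (induction i) auto

lemma poly_op_in:
  assumes "endo_on X f" "subspace X" "v \<in> X"
  shows "poly_op f p v \<in> X"
  unfolding poly_op_def
  by (intro subspace_sum subspace_scale assms funpow_in) (use assms endo_on_in in auto)

lemma poly_op_linear_factor:
  assumes "endo_on X f" "subspace X" "v \<in> X"
  shows "poly_op f ([:- a, 1:] * q) v = f (poly_op f q v) - scale a (poly_op f q v)"
proof -
  let ?N = "degree q"
  have fp: "(f ^^ i) v \<in> X" for i by (rule funpow_in) (use assms endo_on_in in auto)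
  have "degree ([:- a, 1:] * q) \<le> Suc ?N"
    using degree_mult_le[of "[:- a, 1:]" q] by simp
  then have "poly_op f ([:- a, 1:] * q) v =
      (\<Sum>i\<le>Suc ?N. scale (coeff (pCons 0 q) i - a * coeff q i) ((f ^^ i) v))"
    by (subst poly_op_bound) (auto intro!: sum.cong simp: algebra_simps)
  also have "\<dots> = (\<Sum>i\<le>Suc ?N. scale (coeff (pCons 0 q) i) ((f ^^ i) v)) -
      (\<Sum>i\<le>Suc ?N. scale (a * coeff q i) ((f ^^ i) v))"
    by (simp only: scale_left_diff_distrib sum_subtractf)
  also have "(\<Sum>i\<le>Suc ?N. scale (coeff (pCons 0 q) i) ((f ^^ i) v)) =
      (\<Sum>i\<le>?N. scale (coeff q i) (f ((f ^^ i) v)))"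
    by (simp only: sum.atMost_Suc_shift) simp
  also have "\<dots> = f (poly_op f q v)"
    unfolding poly_op_def by (rule endo_on_lincomb[symmetric, OF assms(1,2)]) (use fp in auto)
  also have "(\<Sum>i\<le>Suc ?N. scale (a * coeff q i) ((f ^^ i) v)) = scale a (poly_op f q v)"
    by (simp add: poly_op_bound[of q "Suc ?N"] scale_sum_right coeff_eq_0)
  finally show ?thesis .
qed

lemma poly_op_relation:
  assumes "degree p \<le> n" "\<And>i. i \<le> n \<Longrightarrow> coeff p i = c i"
  shows "poly_op f p v = (\<Sum>i\<le>n. scale (c i) ((f ^^ i) v))"
  using assms by (subst poly_op_bound[of _ n]) auto

end

lemma exists_poly_coeffs:
  fixes c :: "nat \<Rightarrow> 'a::field"
  assumes "\<exists>i\<le>n. c i \<noteq> 0"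
  obtains p where "p \<noteq> 0" "degree p \<le> n" "\<And>i. i \<le> n \<Longrightarrow> coeff p i = c i"
proof
  let ?p = "\<Sum>i\<le>n. monom (c i) i"
  show co: "coeff ?p i = c i" if "i \<le> n" for i
    using that by (simp add: coeff_sum if_distrib cong: if_cong)
  show "?p \<noteq> 0" using assms co by (metis coeff_0)
  show "degree ?p \<le> n" by (rule degree_sum_le) (auto intro: order.trans[OF degree_monom_le])
qed

text \<open>
  A nonzero polynomial \<open>p\<close> of least degree with \<open>p(f) v \<in> K\<close> has a root \<open>a\<close>, and then \<open>q(f) v\<close> for
  \<open>q = p / (X - a)\<close> is an eigenvector of \<open>f\<close> modulo \<open>K\<close>.  The form of the eigenvector is recorded
  because idempotents are built from it.
\<close>

lemma eigenvector_mod: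
  fixes scale :: "'k::alg_closed_field \<Rightarrow> 'v::ab_group_add \<Rightarrow> 'v"
  assumes vs: "lin_space scale"
    and f: "lin_space.endo_on scale X f" and X: "module.subspace scale X"
    and v: "v \<in> X" "v \<notin> K" and K: "module.subspace scale K"
    and rel: "\<exists>i\<le>n. c i \<noteq> 0" "(\<Sum>i\<le>n. scale (c i) ((f ^^ i) v)) \<in> K"
  obtains a q where "lin_space.poly_op scale f q v \<notin> K"
    "f (lin_space.poly_op scale f q v) - scale a (lin_space.poly_op scale f q v) \<in> K"
proof -
  interpret lin_space scale by (rule vs)
  obtain p0 where p0: "p0 \<noteq> 0" "degree p0 \<le> n" "\<And>i. i \<le> n \<Longrightarrow> coeff p0 i = c i"
    using exists_poly_coeffs[OF rel(1)] by blast
  define Q where "Q p \<longleftrightarrow> p \<noteq> 0 \<and> poly_op f p v \<in> K" for p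
  have "Q p0" unfolding Q_def using p0 rel(2) poly_op_relation[OF p0(2,3)] by auto
  then obtain p where p: "Q p" "\<And>p'. Q p' \<Longrightarrow> degree p \<le> degree p'"
    using ex_has_least_nat[of Q p0 degree] by blast
  have "degree p > 0"
  proof (rule ccontr)
    assume "\<not> degree p > 0"
    then obtain d where d: "p = [:d:]" using degree_eq_zeroE by auto
    then have "d \<noteq> 0" "scale d v \<in> K" using p(1) unfolding Q_def poly_op_def by auto
    then show False using subspace_scale[OF K, of "scale d v" "inverse d"] v by auto
  qed
  then obtain a where "poly p a = 0" using alg_closed_imp_poly_has_root by blast
  then obtain q where q: "p = [:-a, 1:] * q" by (auto simp only: poly_eq_0_iff_dvd elim: dvdE)
  have q0: "q \<noteq> 0" using p(1) q unfolding Q_def by auto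
  have "degree p = Suc (degree q)" unfolding q using q0 by (subst degree_mult_eq) auto
  then have "\<not> Q q" using p(2)[of q] by auto
  then have "poly_op f q v \<notin> K" using q0 unfolding Q_def by auto
  moreover have "f (poly_op f q v) - scale a (poly_op f q v) \<in> K"
    using p(1) poly_op_linear_factor[OF f X v(1), of a q] unfolding Q_def q by auto
  ultimately show ?thesis using that by blast
qed

locale ac_lin_space = lin_space scale
  for scale :: "'k::{alg_closed_field, field_char_0} \<Rightarrow> 'v::ab_group_add \<Rightarrow> 'v"
begin

lemma exists_eigenvector:
  assumes "fin_dim scale X" "X \<noteq> {0}" "endo_on X f"
  obtains v a where "v \<in> X" "v \<noteq> 0" "f v = scale a v"
proof -
  have X: "subspace X" by (rule fin_dim_imp_subspace[OF assms(1)])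
  then obtain v where v: "v \<in> X" "v \<noteq> 0" using assms(2) subspace_0 by blast
  obtain F where F: "finite F" "span F = X" using assms(1) unfolding fin_dim_def by auto
  have fp: "(f ^^ i) v \<in> X" for i by (rule funpow_in) (use assms endo_on_in v in auto)
  obtain c where c: "\<exists>i\<le>card F. c i \<noteq> 0" "(\<Sum>i\<le>card F. scale (c i) ((f ^^ i) v)) = 0"
    using nontrivial_relation[OF F(1), of "\<lambda>i. (f ^^ i) v"] fp F by blast
  have v0: "v \<notin> {0}" using v by simp
  have rel: "(\<Sum>i\<le>card F. scale (c i) ((f ^^ i) v)) \<in> {0}" using c(2) by simp
  obtain a q where "poly_op f q v \<notin> {0}" "f (poly_op f q v) - scale a (poly_op f q v) \<in> {0}"
    by (rule eigenvector_mod[OF lin_space_axioms assms(3) X v(1) v0 subspace_single_0 c(1) rel])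
  then show ?thesis using that poly_op_in[OF assms(3) X v(1)] by auto
qed

text \<open>Schur's lemma: the eigenspace of \<open>f\<close> for an eigenvalue is invariant, hence everything.\<close>

lemma schur:
  assumes "irreducible_on X P" "fin_dim scale X" "\<And>p. p \<in> P \<Longrightarrow> endo_on X p" "endo_on X f"
    and comm: "\<And>p v. p \<in> P \<Longrightarrow> v \<in> X \<Longrightarrow> f (p v) = p (f v)"
  obtains c where "\<And>v. v \<in> X \<Longrightarrow> f v = scale c v"
proof -
  have X: "subspace X" "X \<noteq> {0}" using assms(1) unfolding irreducible_on_def by auto
  obtain v c where v: "v \<in> X" "v \<noteq> 0" "f v = scale c v"
    using exists_eigenvector[OF assms(2) X(2) assms(4)] by blast
  let ?U = "{v \<in> X. f v = scale c v}"
  have "?U = X"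
  proof (rule irreducible_onD[OF assms(1) _ _ _ _ v(2)])
    show "subspace ?U"
      unfolding subspace_def using X endo_on_zero[OF assms(4) X(1)] assms(4)
      by (auto simp: subspace_0 subspace_add subspace_scale endo_on_add endo_on_scale
          scale_right_distrib scale_left_commute)
    show "p u \<in> ?U" if "p \<in> P" "u \<in> ?U" for p u
      using that comm endo_on_in[OF assms(3)] endo_on_scale[OF assms(3)] by auto
  qed (use v in auto)
  then show ?thesis using that by blast
qed

end

context lin_space
begin

definition trace :: "'b set \<Rightarrow> ('b \<Rightarrow> 'b) \<Rightarrow> 'a" where
  "trace B f = (\<Sum>b\<in>B. representation B (f b) b)"

lemma representation_lincomb:
  assumes "finite B" "independent B" "\<And>i. i \<in> I \<Longrightarrow> v i \<in> span B"
  shows "representation B (\<Sum>i\<in>I. scale (c i) (v i)) b = (\<Sum>i\<in>I. c i * representation B (v i) b)"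
  by (subst representation_sum) (use assms in \<open>auto simp: span_scale representation_scale intro!: sum.cong\<close>)

lemma lincomb_representation:
  assumes "finite B" "independent B" "v \<in> span B"
  shows "(\<Sum>b\<in>B. scale (representation B v b) b) = v"
  using sum_representation_eq[OF assms(2,3) assms(1)] by simp

lemma trace_commute:
  assumes B: "finite B" "independent B" and f: "endo_on (span B) f" and g: "endo_on (span B) g"
  shows "trace B (\<lambda>v. f (g v)) = trace B (\<lambda>v. g (f v))"
proof -
  have *: "representation B (f (g b)) b = (\<Sum>c\<in>B. representation B (g b) c * representation B (f c) b)"
    if "b \<in> B" and f: "endo_on (span B) f" and g: "endo_on (span B) g" for b f g
  proof -
    have gb: "g b \<in> span B" using endo_on_in[OF g] span_base[OF that(1)] by auto
    have "f (g b) = f (\<Sum>c\<in>B. scale (representation B (g b) c) c)"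
      using lincomb_representation[OF B gb] by simp
    also have "\<dots> = (\<Sum>c\<in>B. scale (representation B (g b) c) (f c))"
      by (rule endo_on_lincomb[OF f]) (auto intro: span_base)
    finally show ?thesis
      using representation_lincomb[OF B, of B f] endo_on_in[OF f] span_base by auto
  qed
  have "trace B (\<lambda>v. f (g v)) = (\<Sum>b\<in>B. \<Sum>c\<in>B. representation B (g b) c * representation B (f c) b)"
    unfolding trace_def by (rule sum.cong[OF refl *[OF _ f g]])
  also have "\<dots> = (\<Sum>c\<in>B. \<Sum>b\<in>B. representation B (g b) c * representation B (f c) b)"
    by (rule sum.swap)
  also have "\<dots> = (\<Sum>c\<in>B. \<Sum>b\<in>B. representation B (f c) b * representation B (g b) c)"
    by (simp only: mult.commute)
  also have "\<dots> = trace B (\<lambda>v. g (f v))"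
    unfolding trace_def by (rule sum.cong[OF refl *[OF _ g f, symmetric]])
  finally show ?thesis .
qed

lemma trace_add:
  assumes B: "finite B" "independent B" and f: "endo_on (span B) f" and g: "endo_on (span B) g"
  shows "trace B (\<lambda>v. f v + g v) = trace B f + trace B g"
  unfolding trace_def sum.distrib[symmetric]
  by (intro sum.cong) (auto simp: representation_add[OF B(2)] endo_on_in[OF f] endo_on_in[OF g] span_base)

lemma trace_scale:
  assumes B: "finite B" "independent B" and f: "endo_on (span B) f"
  shows "trace B (\<lambda>v. scale c (f v)) = c * trace B f"
  unfolding trace_def sum_distrib_left
  by (intro sum.cong) (auto simp: representation_scale[OF B(2)] endo_on_in[OF f] span_base)

lemma trace_cong: "(\<And>b. b \<in> B \<Longrightarrow> f b = g b) \<Longrightarrow> trace B f = trace B g"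
  unfolding trace_def by (auto intro: sum.cong)

lemma trace_commutator:
  assumes B: "finite B" "independent B" and f: "endo_on (span B) f" and g: "endo_on (span B) g"
  shows "trace B (\<lambda>v. f (g v) - g (f v)) = 0"
proof -
  have fg: "endo_on (span B) (\<lambda>v. f (g v))" "endo_on (span B) (\<lambda>v. g (f v))"
    using endo_on_compose f g by auto
  have "trace B (\<lambda>v. f (g v) - g (f v)) = trace B (\<lambda>v. f (g v)) - trace B (\<lambda>v. g (f v))"
    unfolding trace_def sum_subtractf[symmetric]
    by (intro sum.cong) (auto simp: representation_diff[OF B(2)] endo_on_in[OF fg(1)] endo_on_in[OF fg(2)] span_base)
  then show ?thesis using trace_commute[OF assms] by simp
qed

text \<open>
  Triangularity with constant diagonal \<open>c\<close> is all that is known of the operators in Lie's theorem,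
  so their trace is computed in that form.
\<close>

lemma trace_triangular:
  fixes b :: "nat \<Rightarrow> 'b"
  assumes inj: "inj_on b {..<n}" and ind: "independent (b ` {..<n})"
    and tri: "\<And>i. i < n \<Longrightarrow> f (b i) - scale c (b i) \<in> span (b ` {..<i})"
  shows "trace (b ` {..<n}) f = of_nat n * c"
proof -
  let ?B = "b ` {..<n}"
  have "representation ?B (f (b i)) (b i) = c" if i: "i < n" for i
  proof -
    let ?u = "f (b i) - scale c (b i)"
    have sub: "b ` {..<i} \<subseteq> ?B" using i by auto
    have "b i \<notin> b ` {..<i}" using inj i unfolding inj_on_def by force
    then have "representation (b ` {..<i}) ?u (b i) = 0" using representation_ne_zero by blast
    moreover have "representation ?B ?u = representation (b ` {..<i}) ?u"
      by (rule representation_extend[OF ind tri[OF i] sub])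
    moreover have "?u \<in> span ?B" using tri[OF i] span_mono[OF sub] by blast
    moreover have "scale c (b i) \<in> span ?B" using i by (auto intro: span_scale span_base)
    ultimately have "representation ?B (?u + scale c (b i)) (b i) = representation ?B (scale c (b i)) (b i)"
      by (subst representation_add[OF ind]) auto
    also have "\<dots> = c"
      using i by (subst representation_scale[OF ind]) (auto intro: span_base simp: representation_basis[OF ind])
    finally show ?thesis by simp
  qed
  then show ?thesis unfolding trace_def by (subst sum.reindex[OF inj]) simp
qed

text \<open>
  For \<open>b i = y\<^sup>i v\<close> this is a basis of the smallest \<open>y\<close>-stable subspace containing \<open>v\<close>:
  \<open>n\<close> is the first index where the sequence becomes dependent.
\<close>

lemma krylov_basis:
  fixes b :: "nat \<Rightarrow> 'b"
  assumes X: "fin_dim scale X" "\<And>i. b i \<in> X"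
  obtains n where "inj_on b {..<n}" "independent (b ` {..<n})" "b n \<in> span (b ` {..<n})"
proof -
  have ex: "\<exists>n. b n \<in> span (b ` {..<n})"
  proof (rule ccontr)
    assume H: "\<not> ?thesis"
    have *: "independent (b ` {..<n}) \<and> card (b ` {..<n}) = n" for n
    proof (induction n)
      case 0 then show ?case by (auto simp: independent_empty)
    next
      case (Suc n)
      have "b n \<notin> span (b ` {..<n})" using H by blast
      moreover have "b n \<notin> b ` {..<n}" using H span_base[of "b n" "b ` {..<n}"] by auto
      ultimately have "independent (insert (b n) (b ` {..<n}))" "card (insert (b n) (b ` {..<n})) = Suc n"
        using Suc by (simp_all add: independent_insertI)
      then show ?case unfolding lessThan_Suc image_insert by blast
    qed
    obtain F where F: "finite F" "span F = X" using X(1) unfolding fin_dim_def by auto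
    have sub: "b ` {..<Suc (card F)} \<subseteq> span F" using X F by auto
    show False
      using independent_span_bound[OF F(1) conjunct1[OF *] sub] conjunct2[OF *, of "Suc (card F)"] by linarith
  qed
  define n where "n = (LEAST n. b n \<in> span (b ` {..<n}))"
  have n: "b n \<in> span (b ` {..<n})" unfolding n_def using ex by (rule LeastI_ex)
  have l: "b m \<notin> span (b ` {..<m})" if "m < n" for m using that not_less_Least unfolding n_def by blast
  have "independent (b ` {..<m}) \<and> inj_on b {..<m}" if "m \<le> n" for m
    using that
  proof (induction m)
    case 0 then show ?case by (auto simp: independent_empty)
  next
    case (Suc m)
    then have m: "b m \<notin> span (b ` {..<m})" using l[of m] by simp
    moreover have "b m \<notin> b ` {..<m}" using m span_base[of "b m" "b ` {..<m}"] by auto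
    moreover have "independent (b ` {..<m})" "inj_on b {..<m}" using Suc.IH Suc.prems by simp_all
    ultimately have "independent (insert (b m) (b ` {..<m}))" "inj_on b (insert m {..<m})"
      by (simp_all add: independent_insertI)
    then show ?case unfolding lessThan_Suc image_insert by blast
  qed
  then show ?thesis using that n by blast
qed

end

context ac_lin_space
begin

text \<open>
  The lemma behind Lie's theorem.  Let \<open>v\<close> be a common eigenvector for a set \<open>Q\<close> of operators that is
  stable under bracketing with \<open>y\<close>.  On the span of \<open>v, y v, y\<^sup>2 v, \<dots>\<close> every \<open>a \<in> Q\<close> is triangular with
  constant diagonal \<open>l a\<close>; the commutator \<open>[a, y]\<close> has trace zero there, so its eigenvalue
  vanishes in characteristic zero.
\<close>

lemma weight_of_commutator_zero:
  assumes X: "fin_dim scale X" and y: "endo_on X y" and Q: "\<And>a. a \<in> Q \<Longrightarrow> endo_on X a"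
    and br: "\<And>a. a \<in> Q \<Longrightarrow> \<exists>a'\<in>Q. \<forall>v\<in>X. a (y v) = y (a v) + a' v"
    and v: "v \<in> X" "v \<noteq> 0" "\<And>a. a \<in> Q \<Longrightarrow> a v = scale (l a) v"
    and a: "a \<in> Q" and a': "a' \<in> Q" "\<And>v. v \<in> X \<Longrightarrow> a (y v) = y (a v) + a' v"
  shows "l a' = 0"
proof -
  have sX: "subspace X" by (rule fin_dim_imp_subspace[OF X])
  define b where "b i = (y ^^ i) v" for i
  \<comment> \<open>the triangular form is proved by induction on \<open>i\<close>, from \<open>a (b (i + 1)) = y (a (b i)) + [a, y] (b i)\<close>\<close>
  have bX: "b i \<in> X" for i unfolding b_def by (rule funpow_in) (use y endo_on_in v in auto)
  have b0: "b 0 = v" and bS: "b (Suc i) = y (b i)" for i by (auto simp: b_def)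
  obtain n where n: "inj_on b {..<n}" "independent (b ` {..<n})" "b n \<in> span (b ` {..<n})"
    using krylov_basis[of X b, OF X bX] by blast
  have n0: "n \<noteq> 0" using n(3) b0 v by (auto intro!: Nat.gr0I)
  have spanX: "span (b ` J) \<subseteq> X" for J using bX by (intro span_minimal sX) auto
  have bXJ: "b ` J \<subseteq> X" for J using bX by auto
  have yb: "y (b j) \<in> span (b ` {..<Suc i})" if "j < i" for i j
    unfolding bS[symmetric] using that by (intro span_base) auto
  have yspan: "y u \<in> span (b ` {..<Suc i})" if "u \<in> span (b ` {..<i})" for u i
    by (rule endo_on_span[OF y sX bXJ _ that]) (use yb in auto)
  have tri: "a (b i) - scale (l a) (b i) \<in> span (b ` {..<i})" if "a \<in> Q" for a i
    using that
  proof (induction i arbitrary: a)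
    case 0
    then show ?case using v(3) b0 by (simp add: span_zero)
  next
    case (Suc i)
    obtain a' where a': "a' \<in> Q" "\<forall>v\<in>X. a (y v) = y (a v) + a' v" using br[OF Suc(2)] by blast
    let ?u = "a (b i) - scale (l a) (b i)"
    have u: "?u \<in> span (b ` {..<i})" by (rule Suc.IH[OF Suc(2)])
    have uX: "?u \<in> X" using u spanX by blast
    have "a' (b i) - scale (l a') (b i) \<in> span (b ` {..<Suc i})"
      by (rule subsetD[OF span_mono Suc.IH[OF a'(1)]]) auto
    moreover have "scale (l a') (b i) \<in> span (b ` {..<Suc i})"
      by (intro span_scale span_base) auto
    ultimately have 1: "a' (b i) \<in> span (b ` {..<Suc i})" using span_add by fastforce
    have "y (a (b i)) = y (?u + scale (l a) (b i))" by simp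
    also have "\<dots> = y ?u + scale (l a) (y (b i))"
      using endo_on_add[OF y uX subspace_scale[OF sX bX]] endo_on_scale[OF y bX] by metis
    finally have "a (b (Suc i)) - scale (l a) (b (Suc i)) = y ?u + a' (b i)"
      using a'(2) bX bS by simp
    then show ?case using 1 yspan[OF u] span_add by simp
  qed
  let ?W = "span (b ` {..<n})"
  have stab: "f u \<in> ?W" if f: "endo_on X f" "\<And>i. i < n \<Longrightarrow> f (b i) \<in> ?W" and u: "u \<in> ?W" for f u
    by (rule endo_on_span[OF f(1) sX bXJ _ u]) (use f(2) in auto)
  have ey: "endo_on ?W y"
  proof (rule endo_on_subset[OF y spanX stab[OF y]])
    fix i assume "i < n"
    then show "y (b i) \<in> ?W" unfolding bS[symmetric]
    proof (cases "Suc i < n")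
      case False
      then have "Suc i = n" using \<open>i < n\<close> by simp
      then show "b (Suc i) \<in> ?W" using n(3) by simp
    qed (auto intro: span_base)
  qed
  have eQ: "endo_on ?W a" if "a \<in> Q" for a
  proof (rule endo_on_subset[OF Q[OF that] spanX stab[OF Q[OF that]]])
    fix i assume i: "i < n"
    have "a (b i) - scale (l a) (b i) \<in> ?W"
      by (rule subsetD[OF span_mono tri[OF that]]) (use i in auto)
    moreover have "scale (l a) (b i) \<in> ?W" using i by (intro span_scale span_base) auto
    ultimately show "a (b i) \<in> ?W" using span_add by fastforce
  qed
  have "trace (b ` {..<n}) a' = trace (b ` {..<n}) (\<lambda>v. a (y v) - y (a v))"
    by (rule trace_cong) (use a'(2) bX in auto)
  also have "\<dots> = 0" by (rule trace_commutator[OF _ n(2) eQ[OF a] ey]) auto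
  finally have "of_nat n * l a' = 0"
    using trace_triangular[OF n(1,2), of a' "l a'"] tri[OF a'(1)] by simp
  then show ?thesis using n0 by simp
qed

text \<open>
  Commuting operators have a common eigenvector, by Schur's lemma on an irreducible subspace.  By
  the previous lemma its weight space is stable under \<open>P\<close>, so it is the whole module.
\<close>

lemma abelian_ideal_acts_by_scalars:
  assumes X: "fin_dim scale X" and irr: "irreducible_on X P" and P: "\<And>y. y \<in> P \<Longrightarrow> endo_on X y"
    and Q: "\<And>a. a \<in> Q \<Longrightarrow> endo_on X a"
    and comm: "\<And>a b v. a \<in> Q \<Longrightarrow> b \<in> Q \<Longrightarrow> v \<in> X \<Longrightarrow> a (b v) = b (a v)"
    and br: "\<And>a y. a \<in> Q \<Longrightarrow> y \<in> P \<Longrightarrow> \<exists>a'\<in>Q. \<forall>v\<in>X. a (y v) = y (a v) + a' v"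
    and a: "a \<in> Q"
  obtains c where "\<And>v. v \<in> X \<Longrightarrow> a v = scale c v"
proof -
  have sX: "subspace X" "X \<noteq> {0}" using irr unfolding irreducible_on_def by auto
  obtain U where U: "U \<subseteq> X" "irreducible_on U Q" "\<And>f v. f \<in> Q \<Longrightarrow> v \<in> U \<Longrightarrow> f v \<in> U"
    using exists_irreducible_subspace[OF X sX(2), of Q] Q endo_on_in by blast
  have sU: "subspace U" using U(2) unfolding irreducible_on_def by auto
  have eU: "endo_on U f" if "f \<in> Q" for f
    by (rule endo_on_subset[OF Q[OF that] U(1)]) (use U(3) that in auto)
  have "\<exists>c. \<forall>v\<in>U. f v = scale c v" if f: "f \<in> Q" for f
    using schur[OF U(2) fin_dim_subspace[OF X sU U(1)] eU eU[OF f]] comm[OF f] U(1) by (metis subsetD)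
  then obtain l where l: "\<And>f v. f \<in> Q \<Longrightarrow> v \<in> U \<Longrightarrow> f v = scale (l f) v" by metis
  obtain v where v: "v \<in> U" "v \<noteq> 0" using irreducible_on_nonzero[OF U(2)] by blast
  let ?W = "{v \<in> X. \<forall>f\<in>Q. f v = scale (l f) v}"
  have "?W = X"
  proof (rule irreducible_onD[OF irr _ _ _ _ v(2)])
    show "subspace ?W"
      unfolding subspace_def using sX
      by (auto simp: subspace_0 subspace_add subspace_scale endo_on_add[OF Q] endo_on_scale[OF Q]
          endo_on_zero[OF Q sX(1)] scale_right_distrib mult.commute)
    fix y w assume y: "y \<in> P" and w: "w \<in> ?W"
    show "y w \<in> ?W"
    proof (cases "w = 0")
      case True
      then show ?thesis using endo_on_zero[OF P[OF y] sX(1)] endo_on_zero[OF Q sX(1)] sX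
        by (auto simp: subspace_0)
    next
      case False
      have "f (y w) = scale (l f) (y w)" if f: "f \<in> Q" for f
      proof -
        obtain f' where f': "f' \<in> Q" "\<forall>v\<in>X. f (y v) = y (f v) + f' v" using br[OF f y] by blast
        have "l f' = 0"
          by (rule weight_of_commutator_zero[where l=l, OF X P[OF y] Q br[OF _ y] _ False _ f f'(1)]) (use w f' in auto)
        then have "f' w = 0" "f w = scale (l f) w" using w f f'(1) by auto
        then show ?thesis using f'(2) w endo_on_scale[OF P[OF y]] by auto
      qed
      then show ?thesis using w P[OF y] endo_on_in by auto
    qed
  qed (use v U l in auto)
  then show ?thesis using a that by blast
qed

end

locale lin_space_pair = vs1: lin_space s1 + vs2: lin_space s2
  for s1 :: "'a::field \<Rightarrow> 'b::ab_group_add \<Rightarrow> 'b" and s2 :: "'a \<Rightarrow> 'c::ab_group_add \<Rightarrow> 'c"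

text \<open>
  Finite codimension is expressed without quotient spaces: modulo the common kernel every element
  of \<open>A\<close> is congruent to one in the span of a fixed finite set.
\<close>

lemma (in lin_space_pair) common_kernel_finite_codim:
  assumes A: "vs1.subspace A" and Y: "fin_dim s2 Y" and J: "finite J"
    and f: "\<And>j x. j \<in> J \<Longrightarrow> x \<in> A \<Longrightarrow> f j x \<in> Y"
      "\<And>j x y. j \<in> J \<Longrightarrow> x \<in> A \<Longrightarrow> y \<in> A \<Longrightarrow> f j (x + y) = f j x + f j y"
      "\<And>j c x. j \<in> J \<Longrightarrow> x \<in> A \<Longrightarrow> f j (s1 c x) = s2 c (f j x)"
  obtains F where "finite F" "F \<subseteq> A" "\<And>x. x \<in> A \<Longrightarrow> \<exists>u\<in>vs1.span F. \<forall>j\<in>J. f j (x - u) = 0"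
proof -
  have "\<exists>F. finite F \<and> F \<subseteq> A \<and> (\<forall>x\<in>A. \<exists>u\<in>vs1.span F. \<forall>j\<in>J. f j (x - u) = 0)"
    using J f
  proof (induction J rule: finite_induct)
    case empty
    show ?case by (rule exI[of _ "{}"]) (auto intro: vs1.span_zero)
  next
    case (insert i J)
    obtain F where F: "finite F" "F \<subseteq> A" "\<forall>x\<in>A. \<exists>u\<in>vs1.span F. \<forall>j\<in>J. f j (x - u) = 0"
      using insert.IH insert.prems by auto
    note f = insert.prems
    have f0: "f j 0 = 0" if "j \<in> insert i J" for j
      using f(3)[OF that, of 0 0] vs1.subspace_0[OF A] by auto
    have fd: "f j (x - y) = f j x - f j y" if "j \<in> insert i J" "x \<in> A" "y \<in> A" for j x y
      using f(2)[OF that(1), of "x - y" y] that vs1.subspace_diff[OF A] by (auto simp: algebra_simps)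
    have fl: "f j (\<Sum>c\<in>C. s1 (r c) (g c)) = (\<Sum>c\<in>C. s2 (r c) (f j (g c)))"
      if "j \<in> insert i J" "finite C" "\<And>c. c \<in> C \<Longrightarrow> g c \<in> A" for j C and r g
      using that(2,3)
    proof (induction C rule: finite_induct)
      case (insert x C)
      have "f j (s1 (r x) (g x) + (\<Sum>c\<in>C. s1 (r c) (g c))) = f j (s1 (r x) (g x)) + f j (\<Sum>c\<in>C. s1 (r c) (g c))"
        by (rule f(2)[OF that(1)]) (use insert A in \<open>auto intro!: vs1.subspace_sum vs1.subspace_scale\<close>)
      then show ?case using insert f(3)[OF that(1)] by auto
    qed (auto simp: f0[OF that(1)])
    let ?A = "{x \<in> A. \<forall>j\<in>J. f j x = 0}"
    have sA: "vs1.subspace ?A" unfolding vs1.subspace_def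
      using A f f0 by (auto simp: vs1.subspace_0 vs1.subspace_add vs1.subspace_scale)
    \<comment> \<open>preimages of a basis of the image of the next map, restricted to the kernel so far, are added to \<open>F\<close>\<close>
    have sf: "vs2.subspace (f i ` ?A)"
      unfolding vs2.subspace_def
    proof (intro conjI ballI allI)
      show "0 \<in> f i ` ?A" using f0 vs1.subspace_0[OF sA] by (metis (no_types, lifting) image_eqI insertI1)
    next
      fix x y assume "x \<in> f i ` ?A" "y \<in> f i ` ?A"
      then obtain x' y' where "x' \<in> ?A" "y' \<in> ?A" "x = f i x'" "y = f i y'" by blast
      then have "x + y = f i (x' + y')" "x' + y' \<in> ?A"
        using f(2)[of i x' y'] vs1.subspace_add[OF sA] by auto
      then show "x + y \<in> f i ` ?A" by blast
    next
      fix c x assume "x \<in> f i ` ?A"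
      then obtain x' where "x' \<in> ?A" "x = f i x'" by blast
      then have "s2 c x = f i (s1 c x')" "s1 c x' \<in> ?A"
        using f(3)[of i x'] vs1.subspace_scale[OF sA] by auto
      then show "s2 c x \<in> f i ` ?A" by blast
    qed
    have fY: "f i ` ?A \<subseteq> Y" using f(1) by auto
    obtain C where C: "finite C" "vs2.independent C" "vs2.span C = f i ` ?A"
      by (rule vs2.fin_dim_basis[OF vs2.fin_dim_subspace[OF Y sf fY]])
    have Cf: "c \<in> f i ` ?A" if "c \<in> C" for c unfolding C(3)[symmetric] using that by (rule vs2.span_base)
    define g where "g = inv_into ?A (f i)"
    have g: "g c \<in> ?A \<and> f i (g c) = c" if "c \<in> C" for c
      unfolding g_def using inv_into_into[OF Cf[OF that]] f_inv_into_f[OF Cf[OF that]] by blast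
    show ?case
    proof (intro exI[of _ "F \<union> g ` C"] conjI ballI)
      show "finite (F \<union> g ` C)" "F \<union> g ` C \<subseteq> A" using F(1,2) C(1) g by blast+
      fix x assume x: "x \<in> A"
      obtain u where u: "u \<in> vs1.span F" "\<forall>j\<in>J. f j (x - u) = 0" using F x by blast
      have uA: "u \<in> A" using u F(2) vs1.span_minimal[OF F(2) A] by blast
      have xu: "x - u \<in> ?A" using u uA x vs1.subspace_diff[OF A] by auto
      define r where "r = vs2.representation C (f i (x - u))"
      have fr: "f i (x - u) = (\<Sum>c\<in>C. s2 (r c) c)"
        unfolding r_def using vs2.lincomb_representation[OF C(1,2)] C(3) xu by auto
      define w where "w = (\<Sum>c\<in>C. s1 (r c) (g c))"
      have wA: "w \<in> ?A" unfolding w_def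
        by (rule vs1.subspace_sum[OF sA]) (use g vs1.subspace_scale[OF sA] in auto)
      have fw: "f i w = f i (x - u)"
        unfolding w_def fr using g C by (subst fl) auto
      have "u + w \<in> vs1.span (F \<union> g ` C)"
      proof (rule vs1.span_add)
        show "u \<in> vs1.span (F \<union> g ` C)" using u vs1.span_mono[of F "F \<union> g ` C"] by auto
        show "w \<in> vs1.span (F \<union> g ` C)" unfolding w_def
          by (intro vs1.span_sum vs1.span_scale vs1.span_base) auto
      qed
      moreover have "f j (x - (u + w)) = 0" if "j \<in> insert i J" for j
      proof -
        have "f j (x - (u + w)) = f j (x - u) - f j w"
          using fd[OF that, of "x - u" w] xu wA by (simp add: algebra_simps)
        then show ?thesis using that fw u wA by auto
      qed
      ultimately show "\<exists>u\<in>vs1.span (F \<union> g ` C). \<forall>j\<in>insert i J. f j (x - u) = 0" by blast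
    qed
  qed
  then show ?thesis using that by blast
qed

section \<open>Commuting actions and tensor products\<close>

context lin_space
begin

text \<open>
  Independence of a family instead of a set, because the pure tensors of basis vectors are indexed
  by tuples.
\<close>

definition indep_family :: "'x set \<Rightarrow> ('x \<Rightarrow> 'b) \<Rightarrow> bool" where
  "indep_family S t \<longleftrightarrow> (\<forall>c. (\<Sum>x\<in>S. scale (c x) (t x)) = 0 \<longrightarrow> (\<forall>x\<in>S. c x = 0))"

lemma indep_familyD: "indep_family S t \<Longrightarrow> (\<Sum>x\<in>S. scale (c x) (t x)) = 0 \<Longrightarrow> x \<in> S \<Longrightarrow> c x = 0"
  unfolding indep_family_def by blast

lemma indep_family_subset:
  assumes "indep_family S t" "finite S" "S' \<subseteq> S"
  shows "indep_family S' t"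
  unfolding indep_family_def
proof (intro allI impI ballI)
  fix c x assume c: "(\<Sum>x\<in>S'. scale (c x) (t x)) = 0" and x: "x \<in> S'"
  have "(\<Sum>x\<in>S. scale (if x \<in> S' then c x else 0) (t x)) = (\<Sum>x\<in>S'. scale (c x) (t x))"
    by (rule sum.mono_neutral_cong_right) (use assms in auto)
  then show "c x = 0" using indep_familyD[OF assms(1), of "\<lambda>x. if x \<in> S' then c x else 0" x] c x assms(3) by auto
qed

lemma independent_indep_family:
  assumes "independent B" "finite B"
  shows "indep_family B (\<lambda>b. b)"
  unfolding indep_family_def using independentD[OF assms(1,2)] by auto

text \<open>
  A map \<open>V \<otimes> U \<rightarrow> X\<close> of \<open>P\<close>-modules, where \<open>U\<close> is a multiplicity space on which \<open>P\<close> does not act.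
  The vector \<open>e\<close> identifies \<open>u \<in> U\<close> with \<open>e \<otimes> u\<close>, so that \<open>U\<close> is realized inside \<open>X\<close>.
\<close>

definition equivariant_pairing ::
  "('b \<Rightarrow> 'b) set \<Rightarrow> 'b set \<Rightarrow> 'b set \<Rightarrow> 'b set \<Rightarrow> ('b \<Rightarrow> 'b \<Rightarrow> 'b) \<Rightarrow> 'b \<Rightarrow> bool" where
  "equivariant_pairing P X V U \<beta> e \<longleftrightarrow>
     (\<forall>v\<in>V. \<forall>u\<in>U. \<beta> v u \<in> X) \<and>
     (\<forall>v\<in>V. \<forall>w\<in>V. \<forall>u\<in>U. \<beta> (v + w) u = \<beta> v u + \<beta> w u) \<and>
     (\<forall>c. \<forall>v\<in>V. \<forall>u\<in>U. \<beta> (scale c v) u = scale c (\<beta> v u)) \<and>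
     (\<forall>v\<in>V. \<forall>u\<in>U. \<forall>w\<in>U. \<beta> v (u + w) = \<beta> v u + \<beta> v w) \<and>
     (\<forall>c. \<forall>v\<in>V. \<forall>u\<in>U. \<beta> v (scale c u) = scale c (\<beta> v u)) \<and>
     (\<forall>p\<in>P. \<forall>v\<in>V. \<forall>u\<in>U. \<beta> (p v) u = p (\<beta> v u)) \<and>
     e \<in> V \<and> (\<forall>u\<in>U. \<beta> e u = u)"

lemma equivariant_pairing_restrict:
  "equivariant_pairing P X V U \<beta> e \<Longrightarrow> U' \<subseteq> U \<Longrightarrow> equivariant_pairing P X V U' \<beta> e"
  unfolding equivariant_pairing_def by (simp add: subset_iff)

context
  fixes P X V U \<beta> e assumes pair: "equivariant_pairing P X V U \<beta> e"
    and V: "subspace V" and U: "subspace U"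
begin

lemma pairing_in: "v \<in> V \<Longrightarrow> u \<in> U \<Longrightarrow> \<beta> v u \<in> X"
  and pairing_add_left: "v \<in> V \<Longrightarrow> w \<in> V \<Longrightarrow> u \<in> U \<Longrightarrow> \<beta> (v + w) u = \<beta> v u + \<beta> w u"
  and pairing_scale_left: "v \<in> V \<Longrightarrow> u \<in> U \<Longrightarrow> \<beta> (scale c v) u = scale c (\<beta> v u)"
  and pairing_add_right: "v \<in> V \<Longrightarrow> u \<in> U \<Longrightarrow> w \<in> U \<Longrightarrow> \<beta> v (u + w) = \<beta> v u + \<beta> v w"
  and pairing_scale_right: "v \<in> V \<Longrightarrow> u \<in> U \<Longrightarrow> \<beta> v (scale c u) = scale c (\<beta> v u)"
  and pairing_equivariant: "v \<in> V \<Longrightarrow> u \<in> U \<Longrightarrow> p \<in> P \<Longrightarrow> \<beta> (p v) u = p (\<beta> v u)"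
  and pairing_base: "e \<in> V" "u \<in> U \<Longrightarrow> \<beta> e u = u"
  using pair unfolding equivariant_pairing_def by blast+

lemma pairing_zero_left: "u \<in> U \<Longrightarrow> \<beta> 0 u = 0"
  using pairing_scale_left[OF subspace_0[OF V], of u 0] by simp

lemma pairing_zero_right: "v \<in> V \<Longrightarrow> \<beta> v 0 = 0"
  using pairing_scale_right[OF _ subspace_0[OF U], of v 0] by simp

lemma pairing_lincomb_left:
  assumes "u \<in> U" "\<And>c. c \<in> C \<Longrightarrow> v c \<in> V"
  shows "\<beta> (\<Sum>c\<in>C. scale (r c) (v c)) u = (\<Sum>c\<in>C. scale (r c) (\<beta> (v c) u))"
  using assms(2)
proof (induction C rule: infinite_finite_induct)
  case (insert c C)
  have "(\<Sum>c\<in>C. scale (r c) (v c)) \<in> V" using insert V by (auto intro!: subspace_sum subspace_scale)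
  then show ?case using insert V assms(1)
    by (simp add: pairing_add_left pairing_scale_left subspace_scale)
qed (simp_all add: pairing_zero_left assms(1))

lemma pairing_span:
  assumes C: "span C = V" and D: "span D = U" and v: "v \<in> V" and u: "u \<in> U"
  shows "\<beta> v u \<in> span ((\<lambda>(c, d). \<beta> c d) ` (C \<times> D))"
proof -
  let ?S = "span ((\<lambda>(c, d). \<beta> c d) ` (C \<times> D))"
  have CV: "C \<subseteq> V" and DU: "D \<subseteq> U" using C D span_superset by blast+
  have 1: "\<beta> v d \<in> ?S" if d: "d \<in> D" for d
  proof -
    have "v \<in> {v \<in> V. \<beta> v d \<in> ?S}"
    proof (rule subsetD[OF span_minimal])
      show "v \<in> span C" using v C by simp
      show "C \<subseteq> {v \<in> V. \<beta> v d \<in> ?S}" using CV d by (auto intro!: span_base)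
      show "subspace {v \<in> V. \<beta> v d \<in> ?S}"
        unfolding subspace_def using V subsetD[OF DU d]
        by (auto simp: subspace_0 subspace_add subspace_scale pairing_add_left pairing_scale_left
            pairing_zero_left span_zero span_add span_scale)
    qed
    then show ?thesis by simp
  qed
  have "u \<in> {u \<in> U. \<beta> v u \<in> ?S}"
  proof (rule subsetD[OF span_minimal])
    show "u \<in> span D" using u D by simp
    show "D \<subseteq> {u \<in> U. \<beta> v u \<in> ?S}" using DU 1 by auto
    show "subspace {u \<in> U. \<beta> v u \<in> ?S}"
      unfolding subspace_def using U v
      by (auto simp: subspace_0 subspace_add subspace_scale pairing_add_right pairing_scale_right
          pairing_zero_right span_zero span_add span_scale)
  qed
  then show ?thesis by simp
qed

end

lemma span_image_lincomb:
  assumes "finite S" "u \<in> span (f ` S)"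
  obtains r where "u = (\<Sum>x\<in>S. scale (r x) (f x))"
proof -
  have "u \<in> range (\<lambda>r. \<Sum>x\<in>S. scale (r x) (f x))"
  proof (rule subsetD[OF span_minimal assms(2)])
    show "f ` S \<subseteq> range (\<lambda>r. \<Sum>x\<in>S. scale (r x) (f x))"
    proof clarify
      fix x assume x: "x \<in> S"
      have "(\<Sum>y\<in>S. scale (if y = x then 1 else 0) (f y)) = (\<Sum>y\<in>{x}. scale (if y = x then 1 else 0) (f y))"
        by (rule sum.mono_neutral_right) (use assms(1) x in auto)
      then show "f x \<in> range (\<lambda>r. \<Sum>x\<in>S. scale (r x) (f x))"
        by (intro image_eqI[of _ _ "\<lambda>y. if y = x then 1 else 0"]) auto
    qed
    have "(\<Sum>x\<in>S. scale (r x) (f x)) + (\<Sum>x\<in>S. scale (q x) (f x)) = (\<Sum>x\<in>S. scale (r x + q x) (f x))"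
      "scale c (\<Sum>x\<in>S. scale (r x) (f x)) = (\<Sum>x\<in>S. scale (c * r x) (f x))" for r q c
      by (simp_all add: scale_left_distrib sum.distrib scale_sum_right)
    moreover have "0 \<in> range (\<lambda>r. \<Sum>x\<in>S. scale (r x) (f x))"
      by (rule image_eqI[of _ _ "\<lambda>_. 0"]) auto
    ultimately show "subspace (range (\<lambda>r. \<Sum>x\<in>S. scale (r x) (f x)))"
      unfolding subspace_def by auto
  qed
  then show ?thesis using that by blast
qed

end

context ac_lin_space
begin

text \<open>
  In a shortest nontrivial relation \<open>\<Sum> \<beta> (v\<^sub>x) (t\<^sub>x) = 0\<close> one entry runs over all of \<open>V\<close> and
  determines the other ones, equivariantly and hence, by Schur's lemma, as scalar multiples.  If
  that entry is \<open>e\<close>, this becomes a linear relation between the \<open>t\<^sub>x\<close>.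
\<close>

lemma pairing_nondegenerate:
  assumes X: "subspace X" "\<And>p. p \<in> P \<Longrightarrow> endo_on X p"
    and V: "irreducible_on V P" "fin_dim scale V" "\<And>p. p \<in> P \<Longrightarrow> endo_on V p"
    and \<beta>: "equivariant_pairing P X V U \<beta> e"
    and U: "subspace U"
    and S: "finite S" and t: "indep_family S t" "\<And>x. x \<in> S \<Longrightarrow> t x \<in> U"
    and v: "\<And>x. x \<in> S \<Longrightarrow> v x \<in> V" "(\<Sum>x\<in>S. \<beta> (v x) (t x)) = 0"
  shows "\<forall>x\<in>S. v x = 0"
  using S t v
proof (induction S arbitrary: v rule: finite_induct)
  case (insert x0 S)
  have sV: "subspace V" using V(1) unfolding irreducible_on_def by auto
  note bX = pairing_in[OF \<beta> sV U] and badd = pairing_add_left[OF \<beta> sV U]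
    and bscale = pairing_scale_left[OF \<beta> sV U] and bp = pairing_equivariant[OF \<beta> sV U]
    and e = pairing_base[OF \<beta> sV U] and b0 = pairing_zero_left[OF \<beta> sV U]
  have bdiff: "\<beta> (v - w) u = \<beta> v u - \<beta> w u" if "v \<in> V" "w \<in> V" "u \<in> U" for v w u
    using badd[of "v - w" w u] that subspace_diff[OF sV] by (auto simp: algebra_simps)
  have tS: "indep_family S t" by (rule indep_family_subset[OF insert.prems(1)]) (use insert in auto)
  \<comment> \<open>\<open>R w v'\<close>: the entry \<open>w\<close> at \<open>x0\<close> is completed by \<open>v'\<close> to a relation; \<open>v'\<close> is unique by induction\<close>
  define R where "R w v' \<longleftrightarrow> w \<in> V \<and> (\<forall>x\<in>S. v' x \<in> V) \<and> \<beta> w (t x0) + (\<Sum>x\<in>S. \<beta> (v' x) (t x)) = 0" for w v'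
  have R_unique: "v' x = v'' x" if "R w v'" "R w v''" "x \<in> S" for w v' v'' x
  proof -
    have "(\<Sum>x\<in>S. \<beta> (v' x - v'' x) (t x)) = (\<Sum>x\<in>S. \<beta> (v' x) (t x) - \<beta> (v'' x) (t x))"
      by (rule sum.cong) (use that insert.prems(2) in \<open>auto simp: R_def bdiff\<close>)
    also have "\<dots> = 0" using that unfolding R_def
      by (simp add: sum_subtractf) (metis add_left_imp_eq)
    finally have sum0: "(\<Sum>x\<in>S. \<beta> (v' x - v'' x) (t x)) = 0" .
    have "\<forall>x\<in>S. v' x - v'' x = 0"
      by (rule insert.IH[OF tS insert.prems(2) _ sum0]) (use that(1,2) subspace_diff[OF sV] in \<open>auto simp: R_def\<close>)
    then show ?thesis using that(3) by simp
  qed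
  have R_add: "R (w + w') (\<lambda>x. v' x + v'' x)" if "R w v'" "R w' v''" for w w' v' v''
  proof -
    have "(\<Sum>x\<in>S. \<beta> (v' x + v'' x) (t x)) = (\<Sum>x\<in>S. \<beta> (v' x) (t x) + \<beta> (v'' x) (t x))"
      by (rule sum.cong) (use that insert.prems(2) in \<open>auto simp: R_def badd\<close>)
    then have "\<beta> (w + w') (t x0) + (\<Sum>x\<in>S. \<beta> (v' x + v'' x) (t x)) =
      (\<beta> w (t x0) + (\<Sum>x\<in>S. \<beta> (v' x) (t x))) + (\<beta> w' (t x0) + (\<Sum>x\<in>S. \<beta> (v'' x) (t x)))"
      using that insert.prems(2) unfolding R_def by (simp add: badd sum.distrib algebra_simps)
    then show ?thesis using that subspace_add[OF sV] unfolding R_def by auto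
  qed
  have R_scale: "R (scale c w) (\<lambda>x. scale c (v' x))" if "R w v'" for w v' c
  proof -
    have "(\<Sum>x\<in>S. \<beta> (scale c (v' x)) (t x)) = (\<Sum>x\<in>S. scale c (\<beta> (v' x) (t x)))"
      by (rule sum.cong) (use that insert.prems(2) in \<open>auto simp: R_def bscale\<close>)
    moreover have "\<beta> (scale c w) (t x0) = scale c (\<beta> w (t x0))"
      using bscale[of w "t x0" c] that insert.prems(2) unfolding R_def by auto
    ultimately have "\<beta> (scale c w) (t x0) + (\<Sum>x\<in>S. \<beta> (scale c (v' x)) (t x)) =
      scale c (\<beta> w (t x0) + (\<Sum>x\<in>S. \<beta> (v' x) (t x)))"
      by (simp only: scale_sum_right scale_right_distrib)
    then show ?thesis using that subspace_scale[OF sV] unfolding R_def by auto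
  qed
  have R_p: "R (p w) (\<lambda>x. p (v' x))" if R: "R w v'" and p: "p \<in> P" for w v' p
  proof -
    have "(\<Sum>x\<in>S. \<beta> (p (v' x)) (t x)) = (\<Sum>x\<in>S. p (\<beta> (v' x) (t x)))"
      by (rule sum.cong) (use R p insert.prems(2) in \<open>auto simp: R_def bp\<close>)
    also have "\<dots> = p (\<Sum>x\<in>S. \<beta> (v' x) (t x))"
      by (rule endo_on_sum[symmetric, OF X(2)[OF p] X(1)]) (use R insert.prems(2) in \<open>auto simp: R_def bX\<close>)
    finally have *: "(\<Sum>x\<in>S. \<beta> (p (v' x)) (t x)) = p (\<Sum>x\<in>S. \<beta> (v' x) (t x))" .
    have sX: "(\<Sum>x\<in>S. \<beta> (v' x) (t x)) \<in> X"
      by (rule subspace_sum[OF X(1)]) (use R insert.prems(2) in \<open>auto simp: R_def bX\<close>)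
    have w: "w \<in> V" using R unfolding R_def by simp
    have "\<beta> (p w) (t x0) + (\<Sum>x\<in>S. \<beta> (p (v' x)) (t x)) =
      p (\<beta> w (t x0) + (\<Sum>x\<in>S. \<beta> (v' x) (t x)))"
      unfolding * using endo_on_add[OF X(2)[OF p] bX[OF w insert.prems(2)] sX, of x0] bp[OF w insert.prems(2) p, of x0]
      by auto
    then show ?thesis using R endo_on_in[OF V(3)[OF p]] endo_on_zero[OF X(2)[OF p] X(1)] unfolding R_def by auto
  qed
  have x00: "v x0 = 0"
  proof (rule ccontr)
    assume nz: "v x0 \<noteq> 0"
    let ?D = "{w. \<exists>v'. R w v'}"
    have "?D = V"
    proof (rule irreducible_onD[OF V(1) _ _ _ _ nz])
      have "R 0 (\<lambda>_. 0)" unfolding R_def using insert.prems(2) by (auto simp: b0 subspace_0[OF sV])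
      then show "subspace ?D" unfolding subspace_def using R_add R_scale by blast
      show "?D \<subseteq> V" unfolding R_def by auto
      show "p u \<in> ?D" if "p \<in> P" "u \<in> ?D" for p u using R_p that by blast
      have "R (v x0) v" unfolding R_def using insert.prems(3,4) insert.hyps by auto
      then show "v x0 \<in> ?D" by blast
    qed
    then have "\<forall>w\<in>V. \<exists>v'. R w v'" by blast
    then obtain \<theta> where \<theta>: "\<And>w. w \<in> V \<Longrightarrow> R w (\<theta> w)" by metis
    have "\<exists>c. \<forall>w\<in>V. \<theta> w x = scale c w" if x: "x \<in> S" for x
    proof -
      have "endo_on V (\<lambda>w. \<theta> w x)"
        unfolding endo_on_def
      proof (intro conjI ballI allI)
        fix w w' c assume w: "w \<in> V" "w' \<in> V"
        show "\<theta> w x \<in> V" using \<theta>[OF w(1)] x unfolding R_def by auto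
        show "\<theta> (w + w') x = \<theta> w x + \<theta> w' x"
          by (rule R_unique[OF \<theta>[OF subspace_add[OF sV w]] R_add[OF \<theta>[OF w(1)] \<theta>[OF w(2)]] x])
        show "\<theta> (scale c w) x = scale c (\<theta> w x)"
          by (rule R_unique[OF \<theta>[OF subspace_scale[OF sV w(1)]] R_scale[OF \<theta>[OF w(1)]] x])
      qed
      moreover have "\<theta> (p w) x = p (\<theta> w x)" if "p \<in> P" "w \<in> V" for p w
        by (rule R_unique[OF \<theta>[OF endo_on_in[OF V(3)[OF that(1)] that(2)]] R_p[OF \<theta>[OF that(2)] that(1)] x])
      ultimately show ?thesis using schur[OF V(1,2,3), of "\<lambda>w. \<theta> w x"] by metis
    qed
    then obtain c where c: "\<And>x w. x \<in> S \<Longrightarrow> w \<in> V \<Longrightarrow> \<theta> w x = scale (c x) w" by metis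
    have "\<beta> e (t x0) + (\<Sum>x\<in>S. \<beta> (\<theta> e x) (t x)) = 0" using \<theta>[OF e(1)] unfolding R_def by auto
    moreover have "(\<Sum>x\<in>S. \<beta> (\<theta> e x) (t x)) = (\<Sum>x\<in>S. scale (c x) (t x))"
      by (rule sum.cong) (use c e insert.prems(2) bscale in auto)
    ultimately have "t x0 + (\<Sum>x\<in>S. scale (c x) (t x)) = 0" using e insert.prems(2) by auto
    moreover have "(\<Sum>x\<in>S. scale (c x) (t x)) = (\<Sum>x\<in>S. scale ((c(x0 := 1)) x) (t x))"
      by (rule sum.cong) (use insert.hyps in auto)
    ultimately have "(\<Sum>x\<in>insert x0 S. scale ((c(x0 := 1)) x) (t x)) = 0"
      using insert.hyps by simp
    then have "(c(x0 := 1)) x0 = 0" by (rule indep_familyD[OF insert.prems(1)]) simp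
    then show False by simp
  qed
  have "(\<Sum>x\<in>S. \<beta> (v x) (t x)) = 0"
    using insert.prems(4) insert.hyps x00 b0[OF insert.prems(2)] by simp
  then have "\<forall>x\<in>S. v x = 0" by (intro insert.IH[OF tS]) (use insert.prems(2,3) in auto)
  then show ?case using x00 by simp
qed auto

text \<open>
  The factors are an irreducible \<open>P\<close>-submodule \<open>V\<close> and its multiplicity space \<open>Hom\<^sub>P(V, X)\<close>, embedded
  into \<open>X\<close> by evaluation at a vector \<open>e \<noteq> 0\<close> of \<open>V\<close>.  A proper nonzero \<open>Q\<close>-submodule \<open>U'\<close> of the
  latter would give the proper submodule \<open>V \<otimes> U'\<close> of \<open>X\<close>, by the previous lemma.
\<close>

lemma irreducible_two_factors:
  assumes X: "fin_dim scale X" and irr: "irreducible_on X (P \<union> Q)"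
    and P: "\<And>p. p \<in> P \<Longrightarrow> endo_on X p" and Q: "\<And>q. q \<in> Q \<Longrightarrow> endo_on X q"
    and comm: "\<And>p q v. p \<in> P \<Longrightarrow> q \<in> Q \<Longrightarrow> v \<in> X \<Longrightarrow> p (q v) = q (p v)"
  obtains V U \<beta> e where
    "V \<subseteq> X" "irreducible_on V P" "\<And>p. p \<in> P \<Longrightarrow> endo_on V p"
    "U \<subseteq> X" "irreducible_on U Q" "\<And>q. q \<in> Q \<Longrightarrow> endo_on U q"
    "equivariant_pairing P X V U \<beta> e"
    "\<And>v u q. v \<in> V \<Longrightarrow> u \<in> U \<Longrightarrow> q \<in> Q \<Longrightarrow> \<beta> v (q u) = q (\<beta> v u)"
    "span {\<beta> v u | v u. v \<in> V \<and> u \<in> U} = X"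
proof -
  have sX: "subspace X" "X \<noteq> {0}" using irr unfolding irreducible_on_def by auto
  obtain V where V: "V \<subseteq> X" "irreducible_on V P" "\<And>p v. p \<in> P \<Longrightarrow> v \<in> V \<Longrightarrow> p v \<in> V"
    using exists_irreducible_subspace[OF X sX(2), of P] P endo_on_in by blast
  have sV: "subspace V" using V(2) unfolding irreducible_on_def by auto
  have eV: "endo_on V p" if "p \<in> P" for p
    by (rule endo_on_subset[OF P[OF that] V(1)]) (use V(3) that in auto)
  have fV: "fin_dim scale V" by (rule fin_dim_subspace[OF X sV V(1)])
  obtain e where e: "e \<in> V" "e \<noteq> 0" by (rule irreducible_on_nonzero[OF V(2)])
  \<comment> \<open>the homomorphisms from \<open>V\<close> to \<open>X\<close>; by irreducibility they are determined by their value at \<open>e\<close>\<close>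
  define H where "H = {f. (\<forall>v\<in>V. f v \<in> X) \<and> (\<forall>v\<in>V. \<forall>w\<in>V. f (v + w) = f v + f w) \<and>
    (\<forall>c. \<forall>v\<in>V. f (scale c v) = scale c (f v)) \<and> (\<forall>p\<in>P. \<forall>v\<in>V. f (p v) = p (f v))}"
  have H0: "(\<lambda>_. 0) \<in> H" unfolding H_def using sX by (auto simp: subspace_0 endo_on_zero[OF P])
  have Hid: "(\<lambda>v. v) \<in> H" unfolding H_def using V(1) by auto
  have Hadd: "(\<lambda>v. f v + g v) \<in> H" if "f \<in> H" "g \<in> H" for f g
    using that unfolding H_def
    by (auto simp: subspace_add[OF sX(1)] endo_on_add[OF P] scale_right_distrib algebra_simps)
  have Hscale: "(\<lambda>v. scale c (f v)) \<in> H" if "f \<in> H" for f c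
    using that unfolding H_def
    by (auto simp: subspace_scale[OF sX(1)] endo_on_scale[OF P] scale_right_distrib mult.commute)
  have Hq: "(\<lambda>v. q (f v)) \<in> H" if "f \<in> H" "q \<in> Q" for f q
    using that(1) endo_on_in[OF Q[OF that(2)]] endo_on_add[OF Q[OF that(2)]] endo_on_scale[OF Q[OF that(2)]]
      comm[OF _ that(2)] unfolding H_def by auto
  have Huniq: "f v = g v" if fg: "f \<in> H" "g \<in> H" "f e = g e" and v: "v \<in> V" for f g v
  proof -
    have "{v \<in> V. f v = g v} = V"
    proof (rule irreducible_onD[OF V(2) _ _ _ _ e(2)])
      have "f 0 = scale 0 (f 0)" "g 0 = scale 0 (g 0)"
        using fg(1,2) subspace_0[OF sV] unfolding H_def by (metis (mono_tags, lifting) mem_Collect_eq scale_zero_left)+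
      then have "f 0 = 0" "g 0 = 0" by auto
      then show "subspace {v \<in> V. f v = g v}"
        unfolding subspace_def using fg(1,2) sV unfolding H_def
        by (auto simp: subspace_0 subspace_add subspace_scale)
      show "p u \<in> {v \<in> V. f v = g v}" if "p \<in> P" "u \<in> {v \<in> V. f v = g v}" for p u
        using that fg(1,2) V(3) unfolding H_def by auto
    qed (use e fg in auto)
    then show ?thesis using v by auto
  qed
  define U where "U = (\<lambda>f. f e) ` H"
  have "\<forall>u\<in>U. \<exists>f. f \<in> H \<and> f e = u" unfolding U_def by auto
  then obtain F where F: "\<And>u. u \<in> U \<Longrightarrow> F u \<in> H" "\<And>u. u \<in> U \<Longrightarrow> F u e = u" by metis
  define \<beta> where "\<beta> v u = F u v" for v u
  have UI: "f e \<in> U" if "f \<in> H" for f using that unfolding U_def by auto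
  have Fu: "F (f e) v = f v" if "f \<in> H" "v \<in> V" for f v
    by (rule Huniq[OF F(1)[OF UI[OF that(1)]] that(1) F(2)[OF UI[OF that(1)]] that(2)])
  have UX: "U \<subseteq> X" unfolding U_def H_def using e by auto
  have sU: "subspace U" unfolding subspace_def
  proof (intro conjI ballI allI)
    show "0 \<in> U" using UI[OF H0] by simp
    show "x + y \<in> U" if "x \<in> U" "y \<in> U" for x y
      using UI[OF Hadd[OF F(1)[OF that(1)] F(1)[OF that(2)]]] F(2) that by simp
    show "scale c x \<in> U" if "x \<in> U" for c x using UI[OF Hscale[OF F(1)[OF that]]] F(2) that by simp
  qed
  have qU: "q u \<in> U" if "q \<in> Q" "u \<in> U" for q u using UI[OF Hq[OF F(1)[OF that(2)] that(1)]] F(2) that by simp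
  have badd: "\<beta> v (u + u') = \<beta> v u + \<beta> v u'" if "v \<in> V" "u \<in> U" "u' \<in> U" for v u u'
    using Fu[OF Hadd[OF F(1)[OF that(2)] F(1)[OF that(3)]] that(1)] F(2) that unfolding \<beta>_def by simp
  have bscale: "\<beta> v (scale c u) = scale c (\<beta> v u)" if "v \<in> V" "u \<in> U" for v u c
    using Fu[OF Hscale[OF F(1)[OF that(2)]] that(1)] F(2) that unfolding \<beta>_def by simp
  have pair: "equivariant_pairing P X V U \<beta> e"
    unfolding equivariant_pairing_def
  proof (intro conjI)
    show "\<forall>v\<in>V. \<forall>u\<in>U. \<forall>w\<in>U. \<beta> v (u + w) = \<beta> v u + \<beta> v w" using badd by blast
    show "\<forall>c. \<forall>v\<in>V. \<forall>u\<in>U. \<beta> v (scale c u) = scale c (\<beta> v u)" using bscale by blast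
  qed (use F e in \<open>auto simp: \<beta>_def H_def\<close>)
  have bq: "\<beta> v (q u) = q (\<beta> v u)" if "v \<in> V" "u \<in> U" "q \<in> Q" for v u q
    using Fu[OF Hq[OF F(1)[OF that(2)] that(3)] that(1)] F(2) that unfolding \<beta>_def by simp
  note bp = pairing_equivariant[OF pair sV sU] and bX = pairing_in[OF pair sV sU]
  have span_all: "span {\<beta> v u | v u. v \<in> V \<and> u \<in> U'} = X"
    if U': "U' \<subseteq> U" "\<And>q u. q \<in> Q \<Longrightarrow> u \<in> U' \<Longrightarrow> q u \<in> U'" and w: "w \<in> U'" "w \<noteq> 0" for U' w
  proof (rule irreducible_onD[OF irr _ _ _ _ w(2)])
    let ?G = "{\<beta> v u | v u. v \<in> V \<and> u \<in> U'}"
    have GX: "?G \<subseteq> X" using bX U' by auto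
    then show "span ?G \<subseteq> X" by (rule span_minimal[OF _ sX(1)])
    show "f u \<in> span ?G" if f: "f \<in> P \<union> Q" and u: "u \<in> span ?G" for f u
    proof (rule endo_on_span[OF _ sX(1) GX _ u])
      show "endo_on X f" using f P Q by auto
      fix g assume "g \<in> ?G"
      then obtain v u where g: "g = \<beta> v u" "v \<in> V" "u \<in> U'" by blast
      have "f g \<in> ?G"
      proof (cases "f \<in> P")
        case True
        then have "f g = \<beta> (f v) u" "f v \<in> V" using g bp V(3) U' by auto
        then show ?thesis using g by blast
      next
        case False
        then have "f g = \<beta> v (f u)" "f u \<in> U'" using f g bq U' by auto
        then show ?thesis using g by blast
      qed
      then show "f g \<in> span ?G" by (rule span_base)
    qed
    have "w = \<beta> e w" using F(2) w U' unfolding \<beta>_def by auto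
    then show "w \<in> span ?G" using e w by (intro span_base) blast
  qed auto
  have eU: "e \<in> U" using UI[OF Hid] by simp
  have irrU: "irreducible_on U Q"
    unfolding irreducible_on_def
  proof (intro conjI allI impI)
    show "U \<noteq> {0}" using eU e by auto
    fix U' assume U': "subspace U' \<and> U' \<subseteq> U \<and> (\<forall>f\<in>Q. \<forall>u\<in>U'. f u \<in> U')"
    show "U' = {0} \<or> U' = U"
    proof (rule disjCI)
      assume "U' \<noteq> U"
      then obtain u where u: "u \<in> U" "u \<notin> U'" using U' by blast
      show "U' = {0}"
      proof (rule ccontr)
        assume "U' \<noteq> {0}"
        then obtain w where w: "w \<in> U'" "w \<noteq> 0" using U' subspace_0 by blast
        \<comment> \<open>\<open>V \<otimes> U'\<close> is already all of \<open>X\<close>, so \<open>e \<otimes> u\<close> lies in it: a relation contradicting nondegeneracy\<close>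
        have all: "span {\<beta> v u | v u. v \<in> V \<and> u \<in> U'} = X"
          by (rule span_all[OF _ _ w]) (use U' in auto)
        obtain B where B: "finite B" "independent B" "span B = U'"
          by (rule fin_dim_basis[OF fin_dim_subspace[OF X, of U']]) (use U' UX in auto)
        have BU: "B \<subseteq> U'" using span_superset[of B] B by simp
        obtain C where C: "finite C" "independent C" "span C = V" by (rule fin_dim_basis[OF fV])
        have CV: "C \<subseteq> V" using span_superset[of C] C by simp
        have pair': "equivariant_pairing P X V U' \<beta> e"
          by (rule equivariant_pairing_restrict[OF pair]) (use U' in blast)
        have "{\<beta> v u | v u. v \<in> V \<and> u \<in> U'} \<subseteq> span ((\<lambda>(c, d). \<beta> c d) ` (C \<times> B))"
          using pairing_span[OF pair' sV _ C(3) B(3)] U' by auto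
        then have "X \<subseteq> span ((\<lambda>(c, d). \<beta> c d) ` (C \<times> B))"
          unfolding all[symmetric] by (rule span_minimal[OF _ subspace_span])
        then have uspan: "u \<in> span ((\<lambda>(c, d). \<beta> c d) ` (C \<times> B))" using u UX by blast
        have "finite (C \<times> B)" using C B by simp
        from span_image_lincomb[OF this uspan]
        obtain r where r: "u = (\<Sum>x\<in>C \<times> B. scale (r x) (case x of (c, d) \<Rightarrow> \<beta> c d))" by blast
        define v where "v b = (\<Sum>c\<in>C. scale (r (c, b)) c)" for b
        have vV: "v b \<in> V" for b
          unfolding v_def using CV by (intro subspace_sum[OF sV] subspace_scale[OF sV]) auto
        have "u = (\<Sum>c\<in>C. \<Sum>b\<in>B. scale (r (c, b)) (\<beta> c b))"
          unfolding r sum.cartesian_product by (simp add: case_prod_unfold)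
        also have "\<dots> = (\<Sum>b\<in>B. \<Sum>c\<in>C. scale (r (c, b)) (\<beta> c b))" by (rule sum.swap)
        also have "\<dots> = (\<Sum>b\<in>B. \<beta> (v b) b)"
          unfolding v_def using BU CV U' by (intro sum.cong refl pairing_lincomb_left[OF pair sV sU, symmetric]) auto
        finally have v: "u = (\<Sum>b\<in>B. \<beta> (v b) b)" .
        have uB: "u \<notin> B" using BU u by auto
        have ind: "independent (insert u B)" by (rule independent_insertI) (use u(2) B(2,3) in auto)
        have fin: "finite (insert u B)" using B by simp
        let ?v = "v(u := - e)"
        have "\<beta> (- e) u = - u"
          using pairing_scale_left[OF pair sV sU e(1) u(1), of "-1"] pairing_base(2)[OF pair sV sU u(1)] by simp
        moreover have "(\<Sum>b\<in>B. \<beta> (?v b) b) = (\<Sum>b\<in>B. \<beta> (v b) b)" using uB by (intro sum.cong) auto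
        ultimately have "(\<Sum>b\<in>insert u B. \<beta> (?v b) b) = 0"
          using uB B(1) v by simp
        moreover have "?v x \<in> V" "x \<in> U" if "x \<in> insert u B" for x
          using that vV u e BU U' subspace_neg[OF sV] by auto
        ultimately have "?v u = 0"
          using pairing_nondegenerate[OF sX(1) P V(2) fV eV pair sU fin independent_indep_family[OF ind fin], of ?v]
          by blast
        then show False using e by simp
      qed
    qed
  qed (rule sU)
  have "equivariant_pairing P X V U \<beta> e" by (rule pair)
  moreover have "span {\<beta> v u | v u. v \<in> V \<and> u \<in> U} = X"
    by (rule span_all[OF _ _ eU e(2)]) (use qU in auto)
  moreover have "endo_on U q" if "q \<in> Q" for q
    by (rule endo_on_subset[OF Q[OF that] UX]) (use qU that in auto)
  ultimately show ?thesis using that[OF V(1,2) eV UX irrU _ pair] bq by blast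
qed

end


subsection \<open>Tensor products of families\<close>

context lin_space
begin

definition multilinear_on :: "'i set \<Rightarrow> ('i \<Rightarrow> 'b set) \<Rightarrow> 'b set \<Rightarrow> (('i \<Rightarrow> 'b) \<Rightarrow> 'b) \<Rightarrow> bool" where
  "multilinear_on I Vs X \<tau> \<longleftrightarrow> (\<forall>v\<in>Pi\<^sub>E I Vs. \<tau> v \<in> X) \<and>
     (\<forall>v\<in>Pi\<^sub>E I Vs. \<forall>i\<in>I. \<forall>a\<in>Vs i. \<forall>b\<in>Vs i. \<tau> (v(i := a + b)) = \<tau> (v(i := a)) + \<tau> (v(i := b))) \<and>
     (\<forall>v\<in>Pi\<^sub>E I Vs. \<forall>i\<in>I. \<forall>a\<in>Vs i. \<forall>c. \<tau> (v(i := scale c a)) = scale c (\<tau> (v(i := a))))"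

end

context ac_lin_space
begin

text \<open>
  Splitting off one factor after the other.  The multiplicity space of the first action is
  irreducible under the remaining ones, and it lies in \<open>X\<close>, so that all factors are subspaces of
  the same ambient space.  The bases \<open>B i\<close> record that \<open>\<tau>\<close> is a tensor product: the pure tensors of
  basis vectors form a basis of \<open>X\<close>.
\<close>

lemma irreducible_many_factors:
  assumes "finite I" and "fin_dim scale X" and "irreducible_on X (\<Union>i\<in>I. P i)"
    and "\<And>i p. i \<in> I \<Longrightarrow> p \<in> P i \<Longrightarrow> endo_on X p"
    and "\<And>i j p q v. i \<in> I \<Longrightarrow> j \<in> I \<Longrightarrow> i \<noteq> j \<Longrightarrow> p \<in> P i \<Longrightarrow> q \<in> P j \<Longrightarrow> v \<in> X \<Longrightarrow> p (q v) = q (p v)"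
  shows "\<exists>Vs \<tau> B. (\<forall>i\<in>I. Vs i \<subseteq> X \<and> irreducible_on (Vs i) (P i) \<and> (\<forall>p\<in>P i. endo_on (Vs i) p) \<and>
       finite (B i) \<and> independent (B i) \<and> span (B i) = Vs i) \<and>
     multilinear_on I Vs X \<tau> \<and>
     (\<forall>i\<in>I. \<forall>p\<in>P i. \<forall>v\<in>Pi\<^sub>E I Vs. p (\<tau> v) = \<tau> (v(i := p (v i)))) \<and>
     indep_family (Pi\<^sub>E I B) \<tau> \<and> span (\<tau> ` Pi\<^sub>E I B) = X"
  using assms
proof (induction I arbitrary: X rule: finite_induct)
  case empty
  have sX: "subspace X" using empty(2) unfolding irreducible_on_def by auto
  obtain x where x: "x \<in> X" "x \<noteq> 0" by (rule irreducible_on_nonzero[OF empty(2)])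
  have "span {x} = X"
    by (rule irreducible_onD[OF empty(2) _ _ _ _ x(2)]) (use x span_minimal[OF _ sX, of "{x}"] in \<open>auto intro: span_base\<close>)
  moreover have "indep_family {\<lambda>_. undefined} (\<lambda>_. x)"
    unfolding indep_family_def using x by auto
  ultimately show ?case
    by (intro exI[of _ "\<lambda>_. {}"] exI[of _ "\<lambda>_. x"]) (use x in \<open>auto simp: multilinear_on_def\<close>)
next
  case (insert i I)
  let ?Q = "\<Union>j\<in>I. P j"
  have sX: "subspace X" using insert.prems(2) unfolding irreducible_on_def by auto
  have irr: "irreducible_on X (P i \<union> ?Q)" using insert.prems(2) by simp
  have eP: "endo_on X p" if "p \<in> P i" for p using insert.prems(3) that by blast
  have eQ: "endo_on X q" if "q \<in> ?Q" for q using insert.prems(3) that by blast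
  have cPQ: "p (q v) = q (p v)" if "p \<in> P i" "q \<in> ?Q" "v \<in> X" for p q v
    using insert.prems(4)[of i _ p q v] insert.hyps(2) that by blast
  obtain V U \<beta> e where
    V: "V \<subseteq> X" "irreducible_on V (P i)" "\<And>p. p \<in> P i \<Longrightarrow> endo_on V p" and
    U: "U \<subseteq> X" "irreducible_on U ?Q" "\<And>q. q \<in> ?Q \<Longrightarrow> endo_on U q" and
    pair: "equivariant_pairing (P i) X V U \<beta> e" and
    bq: "\<And>v u q. v \<in> V \<Longrightarrow> u \<in> U \<Longrightarrow> q \<in> ?Q \<Longrightarrow> \<beta> v (q u) = q (\<beta> v u)" and
    bspan: "span {\<beta> v u | v u. v \<in> V \<and> u \<in> U} = X"
  proof (rule irreducible_two_factors[OF insert.prems(1) irr eP eQ])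
    show "p (q v) = q (p v)" if "p \<in> P i" "q \<in> ?Q" "v \<in> X" for p q v by (rule cPQ[OF that])
  qed (assumption, assumption, rule that, assumption+)
  have sV: "subspace V" and sU: "subspace U" using V(2) U(2) unfolding irreducible_on_def by auto
  have fV: "fin_dim scale V" by (rule fin_dim_subspace[OF insert.prems(1) sV V(1)])
  have fU: "fin_dim scale U" by (rule fin_dim_subspace[OF insert.prems(1) sU U(1)])
  note bX = pairing_in[OF pair sV sU] and baddl = pairing_add_left[OF pair sV sU]
    and bscalel = pairing_scale_left[OF pair sV sU] and badd = pairing_add_right[OF pair sV sU]
    and bscale = pairing_scale_right[OF pair sV sU] and bp = pairing_equivariant[OF pair sV sU]
  have commU: "p (q v) = q (p v)" if "j \<in> I" "k \<in> I" "j \<noteq> k" "p \<in> P j" "q \<in> P k" "v \<in> U" for j k p q v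
    using insert.prems(4)[of j k p q v] that U(1) by auto
  have eU: "endo_on U p" if "j \<in> I" "p \<in> P j" for j p using U(3) that by blast
  have "\<exists>Vs \<tau> B. (\<forall>i\<in>I. Vs i \<subseteq> U \<and> irreducible_on (Vs i) (P i) \<and> (\<forall>p\<in>P i. endo_on (Vs i) p) \<and>
       finite (B i) \<and> independent (B i) \<and> span (B i) = Vs i) \<and>
     multilinear_on I Vs U \<tau> \<and>
     (\<forall>i\<in>I. \<forall>p\<in>P i. \<forall>v\<in>Pi\<^sub>E I Vs. p (\<tau> v) = \<tau> (v(i := p (v i)))) \<and>
     indep_family (Pi\<^sub>E I B) \<tau> \<and> span (\<tau> ` Pi\<^sub>E I B) = U"
  proof (rule insert.IH[OF fU U(2)])
    show "p (q v) = q (p v)" if "j \<in> I" "k \<in> I" "j \<noteq> k" "p \<in> P j" "q \<in> P k" "v \<in> U" for j k p q v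
      by (rule commU[OF that])
  qed (rule eU)
  then obtain Vs \<tau> B where H: "\<forall>i\<in>I. Vs i \<subseteq> U \<and> irreducible_on (Vs i) (P i) \<and> (\<forall>p\<in>P i. endo_on (Vs i) p) \<and>
       finite (B i) \<and> independent (B i) \<and> span (B i) = Vs i"
     and ml: "multilinear_on I Vs U \<tau>"
     and H': "\<forall>i\<in>I. \<forall>p\<in>P i. \<forall>v\<in>Pi\<^sub>E I Vs. p (\<tau> v) = \<tau> (v(i := p (v i)))"
     and ind: "indep_family (Pi\<^sub>E I B) \<tau>" and sp: "span (\<tau> ` Pi\<^sub>E I B) = U"
    by blast
  have Vs: "Vs j \<subseteq> U" "irreducible_on (Vs j) (P j)" "\<And>p. p \<in> P j \<Longrightarrow> endo_on (Vs j) p"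
    and B: "finite (B j)" "independent (B j)" "span (B j) = Vs j" if "j \<in> I" for j
    using H that by blast+
  have eq: "p (\<tau> v) = \<tau> (v(j := p (v j)))" if "j \<in> I" "p \<in> P j" "v \<in> Pi\<^sub>E I Vs" for j p v
    using H' that by blast
  obtain C where C: "finite C" "independent C" "span C = V" by (rule fin_dim_basis[OF fV])
  have CV: "C \<subseteq> V" using C(3) span_superset[of C] by simp
  have BV: "B j \<subseteq> Vs j" if "j \<in> I" for j using B(3)[OF that] span_superset[of "B j"] by simp
  have PiB: "Pi\<^sub>E I B \<subseteq> Pi\<^sub>E I Vs" by (rule PiE_mono) (use BV in auto)
  have finB: "finite (Pi\<^sub>E I B)" by (rule finite_PiE) (use insert.hyps B in auto)
  have tU: "\<tau> v \<in> U" if "v \<in> Pi\<^sub>E I Vs" for v using ml that unfolding multilinear_on_def by auto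
  define Vs' where "Vs' = Vs(i := V)"
  define B' where "B' = B(i := C)"
  define \<tau>' where "\<tau>' v = \<beta> (v i) (\<tau> (restrict v I))" for v
  have ii: "i \<notin> I" using insert.hyps by simp
  have Vs'I: "Vs' j = Vs j" "B' j = B j" if "j \<in> I" for j using that ii by (auto simp: Vs'_def B'_def)
  have Vs'i: "Vs' i = V" "B' i = C" by (auto simp: Vs'_def B'_def)
  have res: "restrict v I \<in> Pi\<^sub>E I Vs" "v i \<in> V" if "v \<in> Pi\<^sub>E (insert i I) Vs'" for v
    using that Vs'I Vs'i by (auto simp: PiE_iff)
  have res_i: "restrict (v(i := a)) I = restrict v I" for v and a :: 'v
    using ii by (auto simp: fun_eq_iff)
  have res_j: "restrict (v(j := a)) I = (restrict v I)(j := a)" if "j \<in> I" for v j and a :: 'v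
    using that by (auto simp: fun_eq_iff)
  have up: "(restrict v I)(j := a) \<in> Pi\<^sub>E I Vs" if "v \<in> Pi\<^sub>E (insert i I) Vs'" "j \<in> I" "a \<in> Vs j" for v j a
    using res(1)[OF that(1)] that by (auto simp: PiE_iff extensional_def)
  have c1: "multilinear_on (insert i I) Vs' X \<tau>'"
    unfolding multilinear_on_def
  proof (intro conjI ballI allI)
    fix v assume v: "v \<in> Pi\<^sub>E (insert i I) Vs'"
    show "\<tau>' v \<in> X" unfolding \<tau>'_def using bX tU res[OF v] by auto
    fix j a assume j: "j \<in> insert i I" and a: "a \<in> Vs' j"
    show "\<tau>' (v(j := scale c a)) = scale c (\<tau>' (v(j := a)))" for c
    proof (cases "j = i")
      case True
      then show ?thesis using a Vs'i tU[OF res(1)[OF v]] bscalel by (simp add: \<tau>'_def res_i)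
    next
      case False
      then have jI: "j \<in> I" and aj: "a \<in> Vs j" using j a Vs'I by auto
      have "\<tau> ((restrict v I)(j := scale c a)) = scale c (\<tau> ((restrict v I)(j := a)))"
        using ml res(1)[OF v] jI aj unfolding multilinear_on_def by blast
      then show ?thesis
        using bscale[OF res(2)[OF v] tU[OF up[OF v jI aj]]] False by (simp add: \<tau>'_def res_j[OF jI])
    qed
    fix b assume b: "b \<in> Vs' j"
    show "\<tau>' (v(j := a + b)) = \<tau>' (v(j := a)) + \<tau>' (v(j := b))"
    proof (cases "j = i")
      case True
      then show ?thesis using a b Vs'i tU[OF res(1)[OF v]] baddl by (simp add: \<tau>'_def res_i)
    next
      case False
      then have jI: "j \<in> I" and aj: "a \<in> Vs j" "b \<in> Vs j" using j a b Vs'I by auto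
      have "\<tau> ((restrict v I)(j := a + b)) = \<tau> ((restrict v I)(j := a)) + \<tau> ((restrict v I)(j := b))"
        using ml res(1)[OF v] jI aj unfolding multilinear_on_def by blast
      then show ?thesis
        using badd[OF res(2)[OF v] tU[OF up[OF v jI aj(1)]] tU[OF up[OF v jI aj(2)]]] False
        by (simp add: \<tau>'_def res_j[OF jI])
    qed
  qed
  have c2: "p (\<tau>' v) = \<tau>' (v(j := p (v j)))"
    if j: "j \<in> insert i I" and p: "p \<in> P j" and v: "v \<in> Pi\<^sub>E (insert i I) Vs'" for j p v
  proof (cases "j = i")
    case True
    then show ?thesis using bp[OF res(2)[OF v] tU[OF res(1)[OF v]], of p] p by (simp add: \<tau>'_def res_i)
  next
    case False
    then have jI: "j \<in> I" using j by simp
    have "p (\<tau> (restrict v I)) = \<tau> ((restrict v I)(j := p (v j)))"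
      using eq[OF jI p res(1)[OF v]] jI by simp
    moreover have "p \<in> ?Q" using jI p by blast
    ultimately show ?thesis
      using bq[OF res(2)[OF v] tU[OF res(1)[OF v]], of p] False by (simp add: \<tau>'_def res_j[OF jI])
  qed
  have c3: "indep_family (Pi\<^sub>E (insert i I) B') \<tau>'"
    unfolding indep_family_def
  proof (intro allI impI)
    fix c assume c0: "(\<Sum>v\<in>Pi\<^sub>E (insert i I) B'. scale (c v) (\<tau>' v)) = 0"
    have PB: "Pi\<^sub>E I B' = Pi\<^sub>E I B" by (rule PiE_cong) (rule Vs'I(2))
    have PiB': "Pi\<^sub>E (insert i I) B' = (\<lambda>(y, g). g(i := y)) ` (C \<times> Pi\<^sub>E I B)"
      unfolding PiE_insert_eq Vs'i PB ..
    have t': "\<tau>' (g(i := y)) = \<beta> y (\<tau> g)" if "g \<in> Pi\<^sub>E I B" for g y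
      using that by (simp add: \<tau>'_def res_i PiE_restrict)
    have inj: "inj_on (\<lambda>(y, g). g(i := y)) (C \<times> Pi\<^sub>E I B)"
      using inj_combinator[OF ii, of B'] unfolding Vs'i PB .
    have "0 = (\<Sum>(y, g)\<in>C \<times> Pi\<^sub>E I B. scale (c (g(i := y))) (\<beta> y (\<tau> g)))"
      unfolding c0[symmetric] PiB' by (subst sum.reindex[OF inj]) (auto intro!: sum.cong simp: t')
    also have "\<dots> = (\<Sum>g\<in>Pi\<^sub>E I B. \<Sum>y\<in>C. scale (c (g(i := y))) (\<beta> y (\<tau> g)))"
      by (simp add: sum.cartesian_product[symmetric]) (rule sum.swap)
    also have "\<dots> = (\<Sum>g\<in>Pi\<^sub>E I B. \<beta> (\<Sum>y\<in>C. scale (c (g(i := y))) y) (\<tau> g))"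
      by (intro sum.cong refl pairing_lincomb_left[OF pair sV sU, symmetric]) (use tU PiB CV in auto)
    finally have s0: "(\<Sum>g\<in>Pi\<^sub>E I B. \<beta> (\<Sum>y\<in>C. scale (c (g(i := y))) y) (\<tau> g)) = 0" by simp
    have "\<forall>g\<in>Pi\<^sub>E I B. (\<Sum>y\<in>C. scale (c (g(i := y))) y) = 0"
      by (rule pairing_nondegenerate[OF sX eP V(2) fV V(3) pair sU finB ind _ _ s0])
        (use tU PiB CV in \<open>auto intro!: subspace_sum[OF sV] subspace_scale[OF sV]\<close>)
    then have "c (g(i := y)) = 0" if "g \<in> Pi\<^sub>E I B" "y \<in> C" for g y
      using indep_familyD[OF independent_indep_family[OF C(2,1)], of "\<lambda>y. c (g(i := y))" y] that by blast
    then show "\<forall>v\<in>Pi\<^sub>E (insert i I) B'. c v = 0" unfolding PiB' by auto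
  qed
  have c4: "span (\<tau>' ` Pi\<^sub>E (insert i I) B') = X"
  proof
    have "\<tau>' ` Pi\<^sub>E (insert i I) B' \<subseteq> X"
    proof clarify
      fix v assume v: "v \<in> Pi\<^sub>E (insert i I) B'"
      then have "v \<in> Pi\<^sub>E (insert i I) Vs'"
        using BV CV Vs'I Vs'i by (force simp: PiE_iff)
      then show "\<tau>' v \<in> X" unfolding \<tau>'_def using bX tU res by auto
    qed
    then show "span (\<tau>' ` Pi\<^sub>E (insert i I) B') \<subseteq> X" by (rule span_minimal[OF _ sX])
    let ?S = "span (\<tau>' ` Pi\<^sub>E (insert i I) B')"
    have "(\<lambda>(c, d). \<beta> c d) ` (C \<times> \<tau> ` Pi\<^sub>E I B) \<subseteq> \<tau>' ` Pi\<^sub>E (insert i I) B'"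
    proof clarify
      fix y g assume yg: "y \<in> C" "g \<in> Pi\<^sub>E I B"
      then have "g(i := y) \<in> Pi\<^sub>E (insert i I) B'" using Vs'I Vs'i by (auto simp: PiE_iff extensional_def)
      moreover have "\<tau>' (g(i := y)) = \<beta> y (\<tau> g)" using yg by (simp add: \<tau>'_def res_i PiE_restrict)
      ultimately show "\<beta> y (\<tau> g) \<in> \<tau>' ` Pi\<^sub>E (insert i I) B'" by (metis imageI)
    qed
    from span_mono[OF this] have "\<beta> v u \<in> ?S" if "v \<in> V" "u \<in> U" for v u
      using pairing_span[OF pair sV sU C(3) sp that] by blast
    then have "{\<beta> v u | v u. v \<in> V \<and> u \<in> U} \<subseteq> ?S" by blast
    then show "X \<subseteq> ?S" unfolding bspan[symmetric] by (rule span_minimal[OF _ subspace_span])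
  qed
  have c5: "Vs' j \<subseteq> X \<and> irreducible_on (Vs' j) (P j) \<and> (\<forall>p\<in>P j. endo_on (Vs' j) p) \<and>
       finite (B' j) \<and> independent (B' j) \<and> span (B' j) = Vs' j" if "j \<in> insert i I" for j
  proof (cases "j = i")
    case True
    then show ?thesis using V C Vs'i by simp
  next
    case False
    then have jI: "j \<in> I" using that by simp
    have "Vs j \<subseteq> X" using Vs(1)[OF jI] U(1) by (rule subset_trans)
    then show ?thesis using Vs(2,3)[OF jI] B[OF jI] Vs'I[OF jI] by simp
  qed
  show ?case by (intro exI[of _ Vs'] exI[of _ \<tau>'] exI[of _ B'] conjI ballI c1 c2 c3 c4 c5)
qed

end

section \<open>Presentations by generators and relations\<close>

global_interpretation free: lin_space "free_scale :: 'k::field \<Rightarrow> ('x \<Rightarrow>\<^sub>0 'k) \<Rightarrow> ('x \<Rightarrow>\<^sub>0 'k)"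
  unfolding lin_space_def by (rule vector_space_free_scale)

lemma free_gen_expansion:
  "p = (\<Sum>x\<in>Poly_Mapping.keys p. free_scale (Poly_Mapping.lookup p x) (free_gen x))"
proof (rule poly_mapping_eqI)
  fix y
  show "Poly_Mapping.lookup p y =
    Poly_Mapping.lookup (\<Sum>x\<in>Poly_Mapping.keys p. free_scale (Poly_Mapping.lookup p x) (free_gen x)) y"
    by (simp add: lookup_sum free_gen_def lookup_single when_def if_distrib in_keys_iff cong: if_cong)
qed

lemma subspace_keys_subset: "free.subspace {p :: 'x \<Rightarrow>\<^sub>0 'k::field. Poly_Mapping.keys p \<subseteq> A}"
  unfolding free.subspace_def mem_Collect_eq
proof (intro conjI ballI allI)
  show "Poly_Mapping.keys (0 :: 'x \<Rightarrow>\<^sub>0 'k) \<subseteq> A" by simp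
next
  fix p q :: "'x \<Rightarrow>\<^sub>0 'k" assume "p \<in> {p. Poly_Mapping.keys p \<subseteq> A}" "q \<in> {p. Poly_Mapping.keys p \<subseteq> A}"
  then show "Poly_Mapping.keys (p + q) \<subseteq> A" using keys_add[of p q] by blast
next
  fix c and p :: "'x \<Rightarrow>\<^sub>0 'k" assume "p \<in> {p. Poly_Mapping.keys p \<subseteq> A}"
  moreover have "Poly_Mapping.keys (free_scale c p) \<subseteq> Poly_Mapping.keys p" by (auto simp: in_keys_iff)
  ultimately show "Poly_Mapping.keys (free_scale c p) \<subseteq> A" by blast
qed

context lin_space
begin

lemma lin_ext_superset:
  assumes "finite A" "Poly_Mapping.keys p \<subseteq> A"
  shows "lin_ext scale \<tau> p = (\<Sum>x\<in>A. scale (Poly_Mapping.lookup p x) (\<tau> x))"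
  unfolding lin_ext_def by (rule sum.mono_neutral_left) (use assms in \<open>auto simp: in_keys_iff\<close>)

lemma lin_ext_zero [simp]: "lin_ext scale \<tau> 0 = 0"
  unfolding lin_ext_def by simp

lemma lin_ext_add: "lin_ext scale \<tau> (p + q) = lin_ext scale \<tau> p + lin_ext scale \<tau> q"
proof -
  let ?A = "Poly_Mapping.keys p \<union> Poly_Mapping.keys q"
  have "lin_ext scale \<tau> (p + q) = (\<Sum>x\<in>?A. scale (Poly_Mapping.lookup (p + q) x) (\<tau> x))"
    by (rule lin_ext_superset) (auto simp: keys_add)
  also have "\<dots> = (\<Sum>x\<in>?A. scale (Poly_Mapping.lookup p x) (\<tau> x)) + (\<Sum>x\<in>?A. scale (Poly_Mapping.lookup q x) (\<tau> x))"
    by (simp add: lookup_add scale_left_distrib sum.distrib)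
  also have "\<dots> = lin_ext scale \<tau> p + lin_ext scale \<tau> q"
    by (subst (1 2) lin_ext_superset[of ?A]) auto
  finally show ?thesis .
qed

lemma lin_ext_scale: "lin_ext scale \<tau> (free_scale c p) = scale c (lin_ext scale \<tau> p)"
proof -
  have "Poly_Mapping.keys (free_scale c p) \<subseteq> Poly_Mapping.keys p" by (auto simp: in_keys_iff)
  then have "lin_ext scale \<tau> (free_scale c p) = (\<Sum>x\<in>Poly_Mapping.keys p. scale (c * Poly_Mapping.lookup p x) (\<tau> x))"
    by (subst lin_ext_superset) auto
  then show ?thesis unfolding lin_ext_def by (simp add: scale_sum_right)
qed

lemma lin_ext_diff: "lin_ext scale \<tau> (p - q) = lin_ext scale \<tau> p - lin_ext scale \<tau> q"
  using lin_ext_add[of \<tau> "p - q" q] by (simp add: algebra_simps)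

lemma lin_ext_free_gen [simp]: "lin_ext scale \<tau> (free_gen x) = \<tau> x"
  unfolding lin_ext_def free_gen_def by simp

lemma lin_ext_image_subspace:
  assumes "free.subspace K"
  shows "subspace (lin_ext scale \<tau> ` K)"
  unfolding subspace_def
proof (intro conjI ballI allI)
  show "0 \<in> lin_ext scale \<tau> ` K"
    using free.subspace_0[OF assms] by (intro image_eqI[of _ _ 0]) auto
  show "x + y \<in> lin_ext scale \<tau> ` K" if "x \<in> lin_ext scale \<tau> ` K" "y \<in> lin_ext scale \<tau> ` K" for x y
    using that free.subspace_add[OF assms] by (auto simp flip: lin_ext_add)
  show "scale c x \<in> lin_ext scale \<tau> ` K" if "x \<in> lin_ext scale \<tau> ` K" for c x
    using that free.subspace_scale[OF assms] by (auto simp flip: lin_ext_scale)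
qed

lemma lin_ext_vanishes_on_span:
  assumes "p \<in> free.span R" "\<And>r. r \<in> R \<Longrightarrow> lin_ext scale \<tau> r = 0"
  shows "lin_ext scale \<tau> p = 0"
proof -
  have "p \<in> {p. lin_ext scale \<tau> p = 0}"
    by (rule subsetD[OF free.span_minimal assms(1)])
      (use assms(2) in \<open>auto simp: free.subspace_def lin_ext_add lin_ext_scale\<close>)
  then show ?thesis by simp
qed

text \<open>
  Modulo the multilinear relations every pure tensor is a combination of tensors of basis vectors,
  by expanding one coordinate after the other.  If the latter are independent in \<open>X\<close>, there are
  no further relations.
\<close>

lemma presented_by_multilinear:
  assumes I: "finite I" and B: "\<And>i. i \<in> I \<Longrightarrow> finite (B i)" "\<And>i. i \<in> I \<Longrightarrow> span (B i) = Vs i"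
    and ml: "multilinear_on I Vs X \<tau>" and X: "subspace X"
    and ind: "indep_family (Pi\<^sub>E I B) \<tau>" and sp: "span (\<tau> ` Pi\<^sub>E I B) = X"
  shows "presented_by scale X (Pi\<^sub>E I Vs) (multilinear_relations I scale Vs) \<tau>"
proof -
  let ?R = "multilinear_relations I scale Vs"
  let ?S = "free.span (free_gen ` Pi\<^sub>E I B \<union> ?R)"
  have sV: "subspace (Vs i)" if "i \<in> I" for i using B(2)[OF that] subspace_span by metis
  have BV: "B i \<subseteq> Vs i" if "i \<in> I" for i using B(2)[OF that] span_superset[of "B i"] by simp
  have finB: "finite (Pi\<^sub>E I B)" by (rule finite_PiE) (use I B in auto)
  have RS: "?R \<subseteq> ?S" using free.span_superset[of "free_gen ` Pi\<^sub>E I B \<union> ?R"] by blast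
  have gen: "\<forall>v\<in>Pi\<^sub>E I Vs. (\<forall>i\<in>I - J. v i \<in> B i) \<longrightarrow> free_gen v \<in> ?S" if "J \<subseteq> I" for J
    using finite_subset[OF that I] that
  proof (induction J rule: finite_induct)
    case empty
    show ?case
    proof (intro ballI impI)
      fix v assume "v \<in> Pi\<^sub>E I Vs" "\<forall>i\<in>I - {}. v i \<in> B i"
      then have "v \<in> Pi\<^sub>E I B" by (auto simp: PiE_iff)
      then show "free_gen v \<in> ?S" by (intro free.span_base) blast
    qed
  next
    case (insert j J)
    then have jI: "j \<in> I" by simp
    show ?case
    proof (intro ballI impI)
      fix v assume v: "v \<in> Pi\<^sub>E I Vs" and vB: "\<forall>i\<in>I - insert j J. v i \<in> B i"
      have "v j \<in> {a \<in> Vs j. free_gen (v(j := a)) \<in> ?S}"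
      proof (rule subsetD[OF span_minimal])
        show "v j \<in> span (B j)" using v jI B(2) by auto
        show "B j \<subseteq> {a \<in> Vs j. free_gen (v(j := a)) \<in> ?S}"
        proof
          fix a assume a: "a \<in> B j"
          then have "v(j := a) \<in> Pi\<^sub>E I Vs" "\<forall>i\<in>I - J. (v(j := a)) i \<in> B i"
            using v vB jI BV by (auto simp: PiE_iff extensional_def)
          then have "free_gen (v(j := a)) \<in> ?S" using insert.IH insert.prems by blast
          then show "a \<in> {a \<in> Vs j. free_gen (v(j := a)) \<in> ?S}" using a BV jI by auto
        qed
        show "subspace {a \<in> Vs j. free_gen (v(j := a)) \<in> ?S}"
          unfolding subspace_def
        proof (intro conjI ballI allI)
          have sc: "free_gen (v(j := scale c a)) \<in> ?S" if "a \<in> Vs j" "free_gen (v(j := a)) \<in> ?S" for c a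
          proof -
            have "free_gen (v(j := scale c a)) - free_scale c (free_gen (v(j := a))) \<in> ?R"
              unfolding multilinear_relations_def using v jI that by blast
            then have "free_gen (v(j := scale c a)) - free_scale c (free_gen (v(j := a))) \<in> ?S" using RS by blast
            from free.span_add[OF this free.span_scale[OF that(2), of c]] show ?thesis by simp
          qed
          fix a c assume a: "a \<in> {a \<in> Vs j. free_gen (v(j := a)) \<in> ?S}"
          then show "scale c a \<in> {a \<in> Vs j. free_gen (v(j := a)) \<in> ?S}"
            using sc sV[OF jI] subspace_scale by auto
          fix b assume b: "b \<in> {a \<in> Vs j. free_gen (v(j := a)) \<in> ?S}"
          have "free_gen (v(j := a + b)) - free_gen (v(j := a)) - free_gen (v(j := b)) \<in> ?R"
            unfolding multilinear_relations_def using v jI a b by blast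
          then have "free_gen (v(j := a + b)) - free_gen (v(j := a)) - free_gen (v(j := b)) \<in> ?S" using RS by blast
          then have "free_gen (v(j := a + b)) - free_gen (v(j := a)) - free_gen (v(j := b))
             + free_gen (v(j := a)) + free_gen (v(j := b)) \<in> ?S"
            using a b by (intro free.span_add) auto
          then show "a + b \<in> {a \<in> Vs j. free_gen (v(j := a)) \<in> ?S}"
            using a b subspace_add[OF sV[OF jI]] by (simp add: algebra_simps)
        next
          have "free_gen (v(j := scale 0 (v j))) - free_scale 0 (free_gen (v(j := v j))) \<in> ?R"
            unfolding multilinear_relations_def using v jI by blast
          then have "free_gen (v(j := 0)) - free_scale 0 (free_gen (v(j := v j))) \<in> ?S" using RS by auto
          then show "0 \<in> {a \<in> Vs j. free_gen (v(j := a)) \<in> ?S}" using subspace_0[OF sV[OF jI]] by simp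
        qed
      qed
      then show "free_gen v \<in> ?S" by simp
    qed
  qed
  have genI: "free_gen v \<in> ?S" if "v \<in> Pi\<^sub>E I Vs" for v using gen[of I] that by auto
  have pS: "p \<in> ?S" if "Poly_Mapping.keys p \<subseteq> Pi\<^sub>E I Vs" for p
  proof -
    have "(\<Sum>x\<in>Poly_Mapping.keys p. free_scale (Poly_Mapping.lookup p x) (free_gen x)) \<in> ?S"
      by (intro free.span_sum free.span_scale genI) (use that in auto)
    then show ?thesis using free_gen_expansion[of p] by simp
  qed
  have kill: "lin_ext scale \<tau> r = 0" if "r \<in> ?R" for r
    using that ml unfolding multilinear_relations_def multilinear_on_def
    by (auto simp: lin_ext_diff lin_ext_scale)
  show ?thesis
    unfolding presented_by_def
  proof (intro conjI allI impI)
    show "vector_space scale" by (rule vector_space_axioms)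
    show "lin_ext scale \<tau> ` {p. Poly_Mapping.keys p \<subseteq> Pi\<^sub>E I Vs} = X"
    proof
      show "lin_ext scale \<tau> ` {p. Poly_Mapping.keys p \<subseteq> Pi\<^sub>E I Vs} \<subseteq> X"
        using ml unfolding lin_ext_def multilinear_on_def
        by (auto intro!: subspace_sum[OF X] subspace_scale[OF X])
      have BVs: "Pi\<^sub>E I B \<subseteq> Pi\<^sub>E I Vs" by (rule PiE_mono) (use BV in auto)
      have "span (\<tau> ` Pi\<^sub>E I B) \<subseteq> lin_ext scale \<tau> ` {p. Poly_Mapping.keys p \<subseteq> Pi\<^sub>E I Vs}"
      proof (rule span_minimal)
        show "\<tau> ` Pi\<^sub>E I B \<subseteq> lin_ext scale \<tau> ` {p. Poly_Mapping.keys p \<subseteq> Pi\<^sub>E I Vs}"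
        proof clarify
          fix v assume "v \<in> Pi\<^sub>E I B"
          then have "Poly_Mapping.keys (free_gen v :: _ \<Rightarrow>\<^sub>0 'a) \<subseteq> Pi\<^sub>E I Vs" using BVs by (auto simp: free_gen_def)
          then show "\<tau> v \<in> lin_ext scale \<tau> ` {p. Poly_Mapping.keys p \<subseteq> Pi\<^sub>E I Vs}"
            by (intro image_eqI[of _ _ "free_gen v"]) auto
        qed
        show "subspace (lin_ext scale \<tau> ` {p. Poly_Mapping.keys p \<subseteq> Pi\<^sub>E I Vs})"
          by (rule lin_ext_image_subspace[OF subspace_keys_subset])
      qed
      then show "X \<subseteq> lin_ext scale \<tau> ` {p. Poly_Mapping.keys p \<subseteq> Pi\<^sub>E I Vs}" using sp by simp
    qed
    fix p :: "('c \<Rightarrow> 'b) \<Rightarrow>\<^sub>0 'a" assume p: "Poly_Mapping.keys p \<subseteq> Pi\<^sub>E I Vs"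
    show "(lin_ext scale \<tau> p = 0) = (p \<in> free.span ?R)"
    proof
      assume p0: "lin_ext scale \<tau> p = 0"
      obtain g r where gr: "p = g + r" "g \<in> free.span (free_gen ` Pi\<^sub>E I B)" "r \<in> free.span ?R"
        using pS[OF p] unfolding free.span_Un by blast
      have "lin_ext scale \<tau> r = 0" by (rule lin_ext_vanishes_on_span[OF gr(3) kill])
      then have g0: "lin_ext scale \<tau> g = 0" using p0 gr(1) by (simp add: lin_ext_add)
      have "g \<in> {g. Poly_Mapping.keys g \<subseteq> Pi\<^sub>E I B}"
      proof (rule subsetD[OF free.span_minimal gr(2)])
        show "free.subspace {g. Poly_Mapping.keys g \<subseteq> Pi\<^sub>E I B}" by (rule subspace_keys_subset)
      qed (auto simp: free_gen_def)
      then have "(\<Sum>v\<in>Pi\<^sub>E I B. scale (Poly_Mapping.lookup g v) (\<tau> v)) = 0"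
        using g0 lin_ext_superset[OF finB, of g] by simp
      then have "Poly_Mapping.lookup g v = 0" if "v \<in> Pi\<^sub>E I B" for v
        using indep_familyD[OF ind _ that] by blast
      then have "g = 0" using \<open>g \<in> {g. Poly_Mapping.keys g \<subseteq> Pi\<^sub>E I B}\<close>
        by (intro poly_mapping_eqI) (metis (mono_tags) in_keys_iff lookup_zero mem_Collect_eq subsetD)
      then show "p \<in> free.span ?R" using gr by simp
    next
      assume "p \<in> free.span ?R"
      then show "lin_ext scale \<tau> p = 0" by (rule lin_ext_vanishes_on_span[OF _ kill])
    qed
  qed
qed

end

text \<open>
  A bilinear map extends linearly to the free space and vanishes on the bilinear relations; these
  span the kernel of the map onto the tensor product.
\<close>

lemma tensor_product_universal:
  assumes T: "is_tensor_product s1 s2 sT tens" and s: "lin_space sX"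
    and \<beta>: "\<And>x x' y. \<beta> (x + x') y = \<beta> x y + \<beta> x' y" "\<And>x y y'. \<beta> x (y + y') = \<beta> x y + \<beta> x y'"
      "\<And>c x y. \<beta> (s1 c x) y = sX c (\<beta> x y)" "\<And>c x y. \<beta> x (s2 c y) = sX c (\<beta> x y)"
  obtains F where "\<And>z w. F (z + w) = F z + F w" "\<And>c z. F (sT c z) = sX c (F z)" "\<And>x y. F (tens x y) = \<beta> x y"
proof -
  let ?t = "\<lambda>(x, y). tens x y" and ?b = "\<lambda>(x, y). \<beta> x y"
  interpret X: lin_space sX by (rule s)
  have p: "vector_space sT" "range (lin_ext sT ?t) = UNIV"
    "\<And>p. lin_ext sT ?t p = 0 \<longleftrightarrow> p \<in> free.span (bilinear_relations s1 s2)"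
    using T unfolding is_tensor_product_def presented_by_def by auto
  interpret T: lin_space sT unfolding lin_space_def by (rule p(1))
  have kill: "lin_ext sX ?b r = 0" if "r \<in> bilinear_relations s1 s2" for r
    using that unfolding bilinear_relations_def by (auto simp: X.lin_ext_diff X.lin_ext_scale \<beta>)
  have eq: "lin_ext sX ?b p = lin_ext sX ?b q" if "lin_ext sT ?t p = lin_ext sT ?t q" for p q
  proof -
    have "p - q \<in> free.span (bilinear_relations s1 s2)" using that p(3)[of "p - q"] by (simp add: T.lin_ext_diff)
    then have "lin_ext sX ?b (p - q) = 0" by (rule X.lin_ext_vanishes_on_span[OF _ kill])
    then show ?thesis by (simp add: X.lin_ext_diff)
  qed
  define F where "F z = lin_ext sX ?b (SOME p. lin_ext sT ?t p = z)" for z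
  have F: "F (lin_ext sT ?t p) = lin_ext sX ?b p" for p
    unfolding F_def by (rule eq) (rule someI[of _ p], simp)
  have surj: "\<exists>p. z = lin_ext sT ?t p" for z using p(2) by blast
  show ?thesis
  proof (rule that[of F])
    fix z w c
    obtain p where p: "z = lin_ext sT ?t p" using surj by blast
    obtain q where q: "w = lin_ext sT ?t q" using surj by blast
    show "F (z + w) = F z + F w" unfolding p q T.lin_ext_add[symmetric] F X.lin_ext_add ..
    show "F (sT c z) = sX c (F z)" unfolding p T.lin_ext_scale[symmetric] F X.lin_ext_scale ..
  next
    fix x y
    show "F (tens x y) = \<beta> x y" using F[of "free_gen (x, y)"] by simp
  qed
qed

lemma tensor_product_bilinear:
  assumes T: "is_tensor_product s1 s2 sT tens"
  shows "tens (x + x') y = tens x y + tens x' y" "tens x (y + y') = tens x y + tens x y'"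
    "tens (s1 c x) y = sT c (tens x y)" "tens x (s2 c y) = sT c (tens x y)"
proof -
  let ?t = "\<lambda>(x, y). tens x y"
  have p: "vector_space sT" "\<And>p. lin_ext sT ?t p = 0 \<longleftrightarrow> p \<in> free.span (bilinear_relations s1 s2)"
    using T unfolding is_tensor_product_def presented_by_def by auto
  interpret T: lin_space sT unfolding lin_space_def by (rule p(1))
  have *: "lin_ext sT ?t r = 0" if "r \<in> bilinear_relations s1 s2" for r
    using p(2) free.span_base[OF that] by blast
  have "free_gen (x + x', y) - free_gen (x, y) - free_gen (x', y) \<in> bilinear_relations s1 s2"
    "free_gen (x, y + y') - free_gen (x, y) - free_gen (x, y') \<in> bilinear_relations s1 s2"
    "free_gen (s1 c x, y) - free_scale c (free_gen (x, y)) \<in> bilinear_relations s1 s2"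
    "free_gen (x, s2 c y) - free_scale c (free_gen (x, y)) \<in> bilinear_relations s1 s2"
    unfolding bilinear_relations_def by blast+
  from this[THEN *] show "tens (x + x') y = tens x y + tens x' y" "tens x (y + y') = tens x y + tens x y'"
    "tens (s1 c x) y = sT c (tens x y)" "tens x (s2 c y) = sT c (tens x y)"
    by (simp_all add: T.lin_ext_diff T.lin_ext_scale diff_eq_eq add.commute)
qed

lemma tensor_product_induct:
  assumes T: "is_tensor_product s1 s2 sT tens"
    and P: "P 0" "\<And>x y. P (tens x y)" "\<And>z w. P z \<Longrightarrow> P w \<Longrightarrow> P (z + w)"
  shows "P z"
proof -
  let ?t = "\<lambda>(x, y). tens x y"
  have "range (lin_ext sT ?t) = UNIV"
    using T unfolding is_tensor_product_def presented_by_def by auto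
  then obtain p where p: "z = lin_ext sT ?t p" by blast
  have "P (\<Sum>(x, y)\<in>K. tens (s1 (Poly_Mapping.lookup p (x, y)) x) y)" if "finite K" for K
    using that by (induction K rule: finite_induct) (auto intro: P)
  from this[OF finite_keys[of p]] show ?thesis
    unfolding p lin_ext_def by (simp add: case_prod_unfold tensor_product_bilinear(3)[OF T])
qed

section \<open>Coordinates on the current algebra\<close>

lemma linear_add_scale:
  assumes "Vector_Spaces.linear s1 s2 f"
  shows "f (x + y) = f x + f y" "f (s1 c x) = s2 c (f x)"
proof -
  have h: "module_hom s1 s2 f" unfolding module_hom_iff_linear by (rule assms)
  show "f (x + y) = f x + f y" by (rule module_hom.add[OF h])
  show "f (s1 c x) = s2 c (f x)" by (rule module_hom.scale[OF h])
qed

locale current_algebra =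
  fixes sg :: "'k::{alg_closed_field, field_char_0} \<Rightarrow> 'g::ab_group_add \<Rightarrow> 'g"
    and br :: "'g \<Rightarrow> 'g \<Rightarrow> 'g"
    and sS :: "'k \<Rightarrow> 's::{comm_ring, comm_monoid_mult} \<Rightarrow> 's"
    and sT :: "'k \<Rightarrow> 't::ab_group_add \<Rightarrow> 't"
    and tens :: "'g \<Rightarrow> 's \<Rightarrow> 't"
    and brT :: "'t \<Rightarrow> 't \<Rightarrow> 't"
  assumes g_simple: "simple_lie_algebra sg br"
    and g_fin_dim: "fin_dim sg UNIV"
    and S_algebra: "comm_algebra sS"
    and T_tensor: "is_tensor_product sg sS sT tens"
    and T_lie: "lie_algebra sT brT"
    and T_bracket: "\<And>x r y s. brT (tens x r) (tens y s) = tens (br x y) (r * s)"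
begin

lemma g_lie: "lie_algebra sg br"
  using g_simple unfolding simple_lie_algebra_def by blast

sublocale g: ac_lin_space sg
  unfolding ac_lin_space_def lin_space_def using g_lie unfolding lie_algebra_def by blast

sublocale S: lin_space sS
  unfolding lin_space_def using S_algebra unfolding comm_algebra_def by blast

sublocale T: lin_space sT
  unfolding lin_space_def using T_lie unfolding lie_algebra_def by blast

lemma br_add_right: "br x (y + z) = br x y + br x z"
  and br_scale_right: "br x (sg c y) = sg c (br x y)"
  by (rule linear_add_scale[OF lie_algebra.bracket_linear_right[OF g_lie, of x]])+

lemma br_add_left: "br (x + y) z = br x z + br y z"
  and br_scale_left: "br (sg c x) z = sg c (br x z)"
  by (rule linear_add_scale[OF lie_algebra.bracket_linear_left[OF g_lie, of z]])+

lemma brT_add_right: "brT x (y + z) = brT x y + brT x z"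
  by (rule linear_add_scale[OF lie_algebra.bracket_linear_right[OF T_lie, of x]])+

lemma brT_add_left: "brT (x + y) z = brT x z + brT y z"
  by (rule linear_add_scale[OF lie_algebra.bracket_linear_left[OF T_lie, of z]])+

lemma br_zero [simp]: "br 0 z = 0" "br z 0 = 0"
  using br_add_left[of 0 0 z] br_add_right[of z 0 0] by auto

lemma brT_zero [simp]: "brT 0 z = 0" "brT z 0 = 0"
  using brT_add_left[of 0 0 z] brT_add_right[of z 0 0] by auto

lemma brT_sum_left: "brT (\<Sum>i\<in>I. z i) w = (\<Sum>i\<in>I. brT (z i) w)"
  by (induction I rule: infinite_finite_induct) (auto simp: brT_add_left)

lemma brT_sum_right: "brT w (\<Sum>i\<in>I. z i) = (\<Sum>i\<in>I. brT w (z i))"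
  by (induction I rule: infinite_finite_induct) (auto simp: brT_add_right)

lemma brT_antisym: "brT x y = - brT y x"
proof -
  have "brT (x + y) (x + y) = 0" "brT x x = 0" "brT y y = 0" using lie_algebra.bracket_self[OF T_lie] by auto
  then have "brT x y + brT y x = 0" by (simp add: brT_add_left brT_add_right add.commute)
  then show ?thesis by (simp add: eq_neg_iff_add_eq_0)
qed

lemmas tens_add_left = tensor_product_bilinear(1)[OF T_tensor]
  and tens_add_right = tensor_product_bilinear(2)[OF T_tensor]
  and tens_scale_left = tensor_product_bilinear(3)[OF T_tensor]
  and tens_scale_right = tensor_product_bilinear(4)[OF T_tensor]
  and tens_induct = tensor_product_induct[OF T_tensor]

lemma tens_zero_left [simp]: "tens 0 s = 0"
  using tens_add_left[of 0 0 s] by simp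

lemma tens_zero_right [simp]: "tens x 0 = 0"
  using tens_add_right[of x 0 0] by simp

lemma tens_sum_left: "tens (\<Sum>i\<in>I. x i) s = (\<Sum>i\<in>I. tens (x i) s)"
  by (induction I rule: infinite_finite_induct) (auto simp: tens_add_left)

lemma sS_mult: "sS c (a * b) = sS c a * b"
  using S_algebra unfolding comm_algebra_def comm_algebra_axioms_def by blast

lemma sS_eq: "sS c a = sS c 1 * a"
  using sS_mult[of c 1 a] by simp

text \<open>
  A basis of \<open>\<gg>\<close> is a basis of the \<open>S\<close>-module \<open>\<gg> \<otimes> S\<close>; elements of \<open>\<gg> \<otimes> S\<close> are handled through
  their coordinates in \<open>S\<close>.
\<close>

definition Bg :: "'g set" where
  "Bg = (SOME B. finite B \<and> g.independent B \<and> g.span B = UNIV)"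

lemma Bg: "finite Bg" "g.independent Bg" "g.span Bg = UNIV"
proof -
  have "\<exists>B. finite B \<and> g.independent B \<and> g.span B = UNIV"
    using g.fin_dim_basis[OF g_fin_dim] by blast
  from someI_ex[OF this] show "finite Bg" "g.independent Bg" "g.span Bg = UNIV"
    unfolding Bg_def by auto
qed

definition coef :: "'g \<Rightarrow> 'g \<Rightarrow> 'k" where "coef x b = g.representation Bg x b"

lemma coef_expand: "(\<Sum>b\<in>Bg. sg (coef x b) b) = x"
  unfolding coef_def using g.lincomb_representation[OF Bg(1,2)] Bg(3) by auto

lemma coef_add: "coef (x + y) b = coef x b + coef y b"
  unfolding coef_def using g.representation_add[OF Bg(2)] Bg(3) by auto

lemma coef_scale: "coef (sg c x) b = c * coef x b"
  unfolding coef_def using g.representation_scale[OF Bg(2)] Bg(3) by auto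

lemma coef_basis: "b \<in> Bg \<Longrightarrow> coef b b' = (if b' = b then 1 else 0)"
  unfolding coef_def by (simp add: g.representation_basis[OF Bg(2)])

definition coord :: "'g \<Rightarrow> 't \<Rightarrow> 's" where
  "coord b = (SOME F. (\<forall>z w. F (z + w) = F z + F w) \<and> (\<forall>c z. F (sT c z) = sS c (F z)) \<and>
     (\<forall>x s. F (tens x s) = sS (coef x b) s))"

lemma coord_add: "coord b (z + w) = coord b z + coord b w"
  and coord_scale: "coord b (sT c z) = sS c (coord b z)"
  and coord_tens: "coord b (tens x s) = sS (coef x b) s"
proof -
  obtain F where "\<And>z w. F (z + w) = F z + F w" "\<And>c z. F (sT c z) = sS c (F z)" "\<And>x s. F (tens x s) = sS (coef x b) s"
    by (rule tensor_product_universal[OF T_tensor S.lin_space_axioms, of "\<lambda>x s. sS (coef x b) s"])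
      (auto simp: coef_add coef_scale S.scale_left_distrib S.scale_right_distrib mult.commute)
  then have "\<exists>F. (\<forall>z w. F (z + w) = F z + F w) \<and> (\<forall>c z. F (sT c z) = sS c (F z)) \<and>
     (\<forall>x s. F (tens x s) = sS (coef x b) s)" by blast
  from someI_ex[OF this] show "coord b (z + w) = coord b z + coord b w"
    "coord b (sT c z) = sS c (coord b z)" "coord b (tens x s) = sS (coef x b) s"
    unfolding coord_def by blast+
qed

lemma coord_zero [simp]: "coord b 0 = 0"
  using coord_add[of b 0 0] by simp

lemma coord_minus: "coord b (- z) = - coord b z"
  using coord_add[of b z "- z"] by (simp add: eq_neg_iff_add_eq_0 add.commute)

lemma coord_diff: "coord b (z - w) = coord b z - coord b w"
  using coord_add[of b z "- w"] coord_minus by simp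

lemma coord_sum: "coord b (\<Sum>i\<in>I. z i) = (\<Sum>i\<in>I. coord b (z i))"
  by (induction I rule: infinite_finite_induct) (auto simp: coord_add)

lemma coord_expand: "(\<Sum>b\<in>Bg. tens b (coord b z)) = z"
proof (induction z rule: tens_induct)
  case (2 x s)
  have "(\<Sum>b\<in>Bg. tens b (coord b (tens x s))) = tens (\<Sum>b\<in>Bg. sg (coef x b) b) s"
    unfolding tens_sum_left by (simp add: coord_tens tens_scale_left tens_scale_right)
  then show ?case by (simp only: coef_expand)
next
  case (3 z w)
  then show ?case by (simp add: coord_add tens_add_right sum.distrib)
qed auto

lemma coord_eqI: "(\<And>b. b \<in> Bg \<Longrightarrow> coord b z = coord b w) \<Longrightarrow> z = w"
  using coord_expand[of z] coord_expand[of w] by (metis (no_types, lifting) sum.cong)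

lemma coord_lincomb:
  assumes "b \<in> Bg"
  shows "coord b (\<Sum>b\<in>Bg. tens b (f b)) = f b"
proof -
  have "coord b (\<Sum>b\<in>Bg. tens b (f b)) = (\<Sum>b'\<in>Bg. if b' = b then f b' else 0)"
    unfolding coord_sum by (rule sum.cong) (auto simp: coord_tens coef_basis)
  then show ?thesis using assms Bg(1) by simp
qed

definition smul :: "'s \<Rightarrow> 't \<Rightarrow> 't" where
  "smul s z = (\<Sum>b\<in>Bg. tens b (s * coord b z))"

lemma coord_smul: "b \<in> Bg \<Longrightarrow> coord b (smul s z) = s * coord b z"
  unfolding smul_def by (rule coord_lincomb)

lemma smul_tens: "smul s (tens x t) = tens x (s * t)"
  by (rule coord_eqI) (simp add: coord_smul coord_tens, metis mult.left_commute sS_eq)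

lemma smul_add_right: "smul s (z + w) = smul s z + smul s w"
  by (rule coord_eqI) (simp add: coord_smul coord_add distrib_left)

lemma smul_add_left: "smul (s + t) z = smul s z + smul t z"
  by (rule coord_eqI) (simp add: coord_smul coord_add distrib_right)

lemma smul_smul: "smul s (smul t z) = smul (s * t) z"
  by (rule coord_eqI) (simp add: coord_smul mult.assoc)

lemma smul_one [simp]: "smul 1 z = z"
  by (rule coord_eqI) (simp add: coord_smul)

lemma smul_zero [simp]: "smul s 0 = 0" "smul 0 z = 0"
  by (rule coord_eqI, simp add: coord_smul)+

lemma smul_scale: "smul s (sT c z) = sT c (smul s z)"
  by (rule coord_eqI) (simp add: coord_smul coord_scale, metis mult.left_commute sS_eq)

lemma smul_scale_left: "smul (sS c s) z = sT c (smul s z)"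
  by (rule coord_eqI) (simp add: coord_smul coord_scale, metis mult.assoc sS_eq)

lemma smul_diff_right: "smul s (z - w) = smul s z - smul s w"
  by (rule coord_eqI) (simp add: coord_smul coord_diff right_diff_distrib)

lemma smul_diff_left: "smul (s - t) z = smul s z - smul t z"
  by (rule coord_eqI) (simp add: coord_smul coord_diff left_diff_distrib)

lemma smul_sum_right: "smul s (\<Sum>i\<in>I. z i) = (\<Sum>i\<in>I. smul s (z i))"
  by (induction I rule: infinite_finite_induct) (auto simp: smul_add_right)

lemma smul_sum_left: "smul (\<Sum>i\<in>I. s i) z = (\<Sum>i\<in>I. smul (s i) z)"
  by (induction I rule: infinite_finite_induct) (auto simp: smul_add_left)

lemma smul_expand: "z = (\<Sum>b\<in>Bg. smul (coord b z) (tens b 1))"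
  by (simp add: smul_tens coord_expand)

lemma brT_smul_left: "brT (smul s z) w = smul s (brT z w)"
proof (induction z rule: tens_induct)
  case (2 x t)
  show ?case
  proof (induction w rule: tens_induct)
    case (2 y r)
    show ?case by (simp add: smul_tens T_bracket mult.assoc)
  qed (auto simp: brT_add_right smul_add_right)
qed (auto simp: brT_add_left smul_add_right)

lemma smul_minus_right: "smul s (- z) = - smul s z"
  by (rule coord_eqI) (simp add: coord_smul coord_minus)

lemma brT_smul_right: "brT z (smul s w) = smul s (brT z w)"
  using brT_smul_left[of s w z] brT_antisym[of z "smul s w"] brT_antisym[of z w] by (simp add: smul_minus_right)

lemma nonzero_bracket: obtains x y where "br x y \<noteq> 0"
  using g_simple unfolding simple_lie_algebra_def by blast

lemma nonzero_coef: 
  assumes "x \<noteq> 0" obtains b where "b \<in> Bg" "coef x b \<noteq> 0"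
  using coef_expand[of x] assms by (metis (no_types, lifting) g.scale_zero_left sum.neutral)

lemma tens_inj_right:
  assumes "x \<noteq> 0" "tens x s = tens x t"
  shows "s = t"
proof -
  obtain b where "b \<in> Bg" "coef x b \<noteq> 0" by (rule nonzero_coef[OF assms(1)])
  moreover have "sS (coef x b) s = sS (coef x b) t"
    using assms(2) by (metis coord_tens)
  ultimately show ?thesis by auto
qed

lemma smul_inj:
  assumes "\<And>z. smul s z = smul t z"
  shows "s = t"
proof -
  obtain x y where "br x y \<noteq> 0" by (rule nonzero_bracket)
  then show ?thesis using assms[of "tens (br x y) 1"] tens_inj_right[of "br x y" s t] by (simp add: smul_tens)
qed

subsection \<open>The centroid\<close>

lemma adjoint_irreducible: "g.irreducible_on UNIV (range br)"
  unfolding g.irreducible_on_def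
proof (intro conjI allI impI)
  show "g.subspace UNIV" by simp
  obtain x y where "br x y \<noteq> 0" by (rule nonzero_bracket)
  then show "UNIV \<noteq> {0::'g}" by auto
  fix U assume "g.subspace U \<and> U \<subseteq> UNIV \<and> (\<forall>f\<in>range br. \<forall>u\<in>U. f u \<in> U)"
  then have "lie_ideal sg br U" unfolding lie_ideal_def by auto
  then show "U = {0} \<or> U = UNIV" using g_simple unfolding simple_lie_algebra_def by blast
qed

lemma S_eq_by_representation:
  assumes "S.independent C" "S.span C = UNIV" "\<And>c. S.representation C s c = S.representation C t c"
  shows "s = t"
proof -
  have "s = (\<Sum>b | S.representation C s b \<noteq> 0. sS (S.representation C s b) b)"
    using S.sum_nonzero_representation_eq[OF assms(1), of s] assms(2) by simp
  moreover have "t = (\<Sum>b | S.representation C t b \<noteq> 0. sS (S.representation C t b) b)"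
    using S.sum_nonzero_representation_eq[OF assms(1), of t] assms(2) by simp
  ultimately show ?thesis using assms(3) by simp
qed

text \<open>
  Composed with \<open>s \<mapsto> x \<otimes> s\<close> and a coefficient functional on \<open>S\<close>, such a map becomes an endomorphism
  of the adjoint module of the simple algebra \<open>\<gg>\<close>, hence a scalar by Schur's lemma.
\<close>

lemma centroid:
  assumes add: "\<And>z w. \<psi> (z + w) = \<psi> z + \<psi> w" and sc: "\<And>c z. \<psi> (sT c z) = sT c (\<psi> z)"
    and comm: "\<And>z w. \<psi> (brT z w) = brT z (\<psi> w)"
  obtains s where "\<And>z. \<psi> z = smul s z"
proof -
  obtain C where C: "S.independent C" "S.span C = UNIV"
    by (rule S.basis_exists[of UNIV]) auto
  define pr where "pr c z = (\<Sum>b\<in>Bg. sg (S.representation C (coord b z) c) b)" for c z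
  have rep_add: "S.representation C (s + t) c = S.representation C s c + S.representation C t c" for s t c
    using S.representation_add[OF C(1)] C(2) by auto
  have rep_scale: "S.representation C (sS r s) c = r * S.representation C s c" for r s c
    using S.representation_scale[OF C(1)] C(2) by auto
  have pr_add: "pr c (z + w) = pr c z + pr c w" for c z w
    unfolding pr_def by (simp add: coord_add rep_add g.scale_left_distrib sum.distrib)
  have pr_scale: "pr c (sT r z) = sg r (pr c z)" for c r z
    unfolding pr_def by (simp add: coord_scale rep_scale g.scale_sum_right)
  have pr_tens: "pr c (tens x s) = sg (S.representation C s c) x" for c x s
  proof -
    have "pr c (tens x s) = sg (S.representation C s c) (\<Sum>b\<in>Bg. sg (coef x b) b)"
      unfolding pr_def g.scale_sum_right by (simp add: coord_tens rep_scale mult.commute)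
    then show ?thesis by (simp only: coef_expand)
  qed
  have pr_br: "pr c (brT (tens y 1) z) = br y (pr c z)" for c y z
  proof (induction z rule: tens_induct)
    case 1
    have "pr c 0 = 0" using pr_add[of c 0 0] by simp
    then show ?case by simp
  next
    case (2 x s)
    show ?case by (simp add: T_bracket pr_tens br_scale_right)
  qed (simp add: brT_add_right pr_add br_add_right)
  \<comment> \<open>\<open>pr c\<close> applies the coefficient of the basis vector \<open>c\<close> of \<open>S\<close> to the second tensor factor\<close>
  have "\<exists>r. \<forall>x. pr c (\<psi> (tens x s)) = sg r x" for c s
  proof -
    have e1: "g.endo_on UNIV p" if "p \<in> range br" for p
      using that unfolding g.endo_on_def by (auto simp: br_add_right br_scale_right)
    have e2: "g.endo_on UNIV (\<lambda>x. pr c (\<psi> (tens x s)))"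
      unfolding g.endo_on_def by (auto simp: tens_add_left tens_scale_left add sc pr_add pr_scale)
    have e3: "pr c (\<psi> (tens (p x) s)) = p (pr c (\<psi> (tens x s)))" if p: "p \<in> range br" for p x
    proof -
      obtain y where "p = br y" using p by blast
      moreover have "tens (br y x) s = brT (tens y 1) (tens x s)" by (simp add: T_bracket)
      ultimately show ?thesis by (simp add: comm pr_br)
    qed
    show ?thesis
      using g.schur[OF adjoint_irreducible g_fin_dim e1 e2] e3 by (metis UNIV_I)
  qed
  then obtain r where r: "\<And>c s x. pr c (\<psi> (tens x s)) = sg (r c s) x" by metis
  have co: "S.representation C (coord b (\<psi> (tens x s))) c = r c s * coef x b" if "b \<in> Bg" for b x s c
  proof -
    have "coef (pr c (\<psi> (tens x s))) b = (\<Sum>b'\<in>Bg. S.representation C (coord b' (\<psi> (tens x s))) c * coef b' b)"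
    proof -
      have "coef (\<Sum>b'\<in>B. sg (f b') b') b = (\<Sum>b'\<in>B. f b' * coef b' b)" if "finite B" for B f
        using that
      proof (induction B rule: finite_induct)
        case empty
        show ?case using coef_scale[of 0 0 b] by simp
      qed (simp add: coef_add coef_scale)
      from this[OF Bg(1)] show ?thesis unfolding pr_def .
    qed
    also have "\<dots> = (\<Sum>b'\<in>Bg. if b' = b then S.representation C (coord b' (\<psi> (tens x s))) c else 0)"
      by (rule sum.cong) (auto simp: coef_basis)
    also have "\<dots> = S.representation C (coord b (\<psi> (tens x s))) c" using that Bg(1) by simp
    finally show ?thesis by (simp add: r coef_scale)
  qed
  obtain b0 where b0: "b0 \<in> Bg"
  proof -
    obtain x y where "br x y \<noteq> 0" by (rule nonzero_bracket)
    then show ?thesis using nonzero_coef that by blast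
  qed
  define u where "u s = coord b0 (\<psi> (tens b0 s))" for s
  have u: "S.representation C (u s) c = r c s" for s c
    unfolding u_def using co[OF b0] by (simp add: coef_basis[OF b0])
  have \<psi>u: "\<psi> (tens x s) = tens x (u s)" for x s
  proof (rule coord_eqI)
    fix b assume b: "b \<in> Bg"
    show "coord b (\<psi> (tens x s)) = coord b (tens x (u s))"
      by (rule S_eq_by_representation[OF C]) (simp add: co[OF b] coord_tens rep_scale u mult.commute)
  qed
  have us: "u s = s * u 1" for s
  proof -
    obtain x y where xy: "br x y \<noteq> 0" by (rule nonzero_bracket)
    have "tens (br x y) (u s) = \<psi> (brT (tens x s) (tens y 1))" by (simp add: T_bracket \<psi>u)
    also have "\<dots> = tens (br x y) (s * u 1)" by (subst comm) (simp add: \<psi>u T_bracket)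
    finally show ?thesis by (rule tens_inj_right[OF xy])
  qed
  have "\<psi> z = smul (u 1) z" for z
  proof (induction z rule: tens_induct)
    case 1
    show ?case using add[of 0 0] by simp
  next
    case (2 x s)
    show ?case using \<psi>u[of x s] us[of s] by (simp add: smul_tens mult.commute)
  qed (simp add: add smul_add_right)
  then show ?thesis using that by blast
qed

subsection \<open>Ideals and evaluation\<close>

lemma ring_ideal_scale: "ring_ideal J \<Longrightarrow> a \<in> J \<Longrightarrow> sS c a \<in> J"
  unfolding ring_ideal_def using sS_eq by metis

lemma ring_ideal_minus: "ring_ideal J \<Longrightarrow> a \<in> J \<Longrightarrow> - a \<in> (J :: 's set)"
  using ring_ideal_scale[of J a "-1"] by simp

lemma ring_ideal_diff: "ring_ideal J \<Longrightarrow> a \<in> J \<Longrightarrow> b \<in> J \<Longrightarrow> a - b \<in> (J :: 's set)"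
  using ring_ideal_minus[of J b] unfolding ring_ideal_def by (metis add_uminus_conv_diff)

lemma ring_ideal_zero: "ring_ideal J \<Longrightarrow> 0 \<in> (J :: 's set)"
  and ring_ideal_add: "ring_ideal J \<Longrightarrow> a \<in> J \<Longrightarrow> b \<in> J \<Longrightarrow> a + b \<in> (J :: 's set)"
  and ring_ideal_mult: "ring_ideal J \<Longrightarrow> a \<in> J \<Longrightarrow> r * a \<in> (J :: 's set)"
  unfolding ring_ideal_def by auto

lemma ring_ideal_mult_right: "ring_ideal J \<Longrightarrow> a \<in> J \<Longrightarrow> a * r \<in> (J :: 's set)"
  using ring_ideal_mult[of J a r] by (simp add: mult.commute)

lemma ring_ideal_sum: "ring_ideal J \<Longrightarrow> (\<And>i. i \<in> I \<Longrightarrow> a i \<in> J) \<Longrightarrow> (\<Sum>i\<in>I. a i) \<in> (J :: 's set)"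
  by (induction I rule: infinite_finite_induct) (auto simp: ring_ideal_zero ring_ideal_add)

lemma ring_ideal_subspace: "ring_ideal J \<Longrightarrow> S.subspace J"
  unfolding S.subspace_def using ring_ideal_zero ring_ideal_add ring_ideal_scale by blast

text \<open>The subspace \<open>\<gg> \<otimes> J\<close> for an ideal \<open>J\<close>, in coordinates.\<close>

definition gtens :: "'s set \<Rightarrow> 't set" where "gtens J = {z. \<forall>b\<in>Bg. coord b z \<in> J}"

lemma gtens_subspace: "ring_ideal J \<Longrightarrow> T.subspace (gtens J)"
  unfolding T.subspace_def gtens_def
  by (auto simp: coord_add coord_scale ring_ideal_zero ring_ideal_add ring_ideal_scale)

lemma tens_in_gtens: "ring_ideal J \<Longrightarrow> s \<in> J \<Longrightarrow> tens x s \<in> gtens J"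
  unfolding gtens_def by (auto simp: coord_tens ring_ideal_scale)

lemma smul_in_gtens: "ring_ideal J \<Longrightarrow> s \<in> J \<Longrightarrow> smul s z \<in> gtens J"
  unfolding gtens_def by (auto simp: coord_smul ring_ideal_mult_right)

lemma tensor_ideal_eq_gtens:
  assumes "ring_ideal J"
  shows "tensor_ideal sT tens J = gtens J"
proof
  show "tensor_ideal sT tens J \<subseteq> gtens J"
    unfolding tensor_ideal_def
    by (rule T.span_minimal[OF _ gtens_subspace[OF assms]]) (auto intro: tens_in_gtens[OF assms])
  show "gtens J \<subseteq> tensor_ideal sT tens J"
  proof
    fix z assume z: "z \<in> gtens J"
    have "(\<Sum>b\<in>Bg. tens b (coord b z)) \<in> tensor_ideal sT tens J"
      unfolding tensor_ideal_def
      by (intro T.span_sum T.span_base) (use z in \<open>auto simp: gtens_def\<close>)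
    then show "z \<in> tensor_ideal sT tens J" by (simp add: coord_expand)
  qed
qed

lemma gtens_inj:
  assumes "ring_ideal J" "ring_ideal J'" "gtens J \<subseteq> gtens J'"
  shows "J \<subseteq> J'"
proof
  fix s assume s: "s \<in> J"
  obtain b where b: "b \<in> Bg" "coef b b \<noteq> 0"
  proof -
    obtain x y where "br x y \<noteq> 0" by (rule nonzero_bracket)
    then show ?thesis using nonzero_coef that coef_basis by (metis one_neq_zero)
  qed
  have "tens b s \<in> gtens J'" using tens_in_gtens[OF assms(1) s] assms(3) by blast
  then have "coord b (tens b s) \<in> J'" using b unfolding gtens_def by blast
  then show "s \<in> J'" by (simp add: coord_tens coef_basis[OF b(1)])
qed

text \<open>
  The points of the spectrum at which residues in the ground field are defined, characterized so
  that maximality becomes a consequence.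
\<close>

definition rational_point :: "'s set \<Rightarrow> bool" where
  "rational_point M \<longleftrightarrow> ring_ideal M \<and> 1 \<notin> M \<and> (\<forall>s. \<exists>c. s - sS c 1 \<in> M)"

lemma rational_pointD:
  assumes "rational_point M" shows "ring_ideal M" "1 \<notin> M"
  using assms unfolding rational_point_def by auto

lemma rational_point_unique:
  assumes "rational_point M" "s - sS c 1 \<in> M" "s - sS d 1 \<in> M"
  shows "c = d"
proof (rule ccontr)
  assume "c \<noteq> d"
  have "(s - sS d 1) - (s - sS c 1) \<in> M" using assms ring_ideal_diff rational_pointD(1) by blast
  then have "sS (c - d) 1 \<in> M" by (simp add: S.scale_left_diff_distrib)
  then have "sS (inverse (c - d)) (sS (c - d) 1) \<in> M" using assms ring_ideal_scale rational_pointD(1) by blast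
  then have "1 \<in> M" using \<open>c \<noteq> d\<close> by simp
  then show False using assms rational_pointD(2) by blast
qed

lemma residue_eqI: "rational_point M \<Longrightarrow> s - sS c 1 \<in> M \<Longrightarrow> residue sS s M = c"
  unfolding residue_def using rational_point_unique by (intro the_equality) blast+

lemma residue_mem: "rational_point M \<Longrightarrow> s - sS (residue sS s M) 1 \<in> M"
  using residue_eqI unfolding rational_point_def by metis

lemma rational_point_Max_spec:
  assumes "rational_point M"
  shows "M \<in> Max_spec"
proof -
  have "J = M \<or> J = UNIV" if J: "ring_ideal J" "M \<subseteq> J" for J
  proof (rule disjCI)
    assume "J \<noteq> UNIV"
    show "J = M"
    proof (rule ccontr)
      assume "J \<noteq> M"
      then obtain s where s: "s \<in> J" "s \<notin> M" using J by blast
      let ?c = "residue sS s M"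
      have m: "s - sS ?c 1 \<in> M" by (rule residue_mem[OF assms])
      then have "s - (s - sS ?c 1) \<in> J" using J s ring_ideal_diff by blast
      then have cJ: "sS ?c 1 \<in> J" by simp
      have "?c \<noteq> 0" using m s(2) by auto
      then have "1 \<in> J" using ring_ideal_scale[OF J(1) cJ, of "inverse ?c"] by simp
      then have "x \<in> J" for x using ring_ideal_mult[OF J(1), of 1 x] by simp
      then show False using \<open>J \<noteq> UNIV\<close> by blast
    qed
  qed
  then show ?thesis using rational_pointD[OF assms] unfolding Max_spec_def by blast
qed

lemma residue_add: "rational_point M \<Longrightarrow> residue sS (s + t) M = residue sS s M + residue sS t M"
  using ring_ideal_add[OF rational_pointD(1)[of M] residue_mem[of M s] residue_mem[of M t]]
  by (intro residue_eqI) (auto simp: algebra_simps S.scale_left_distrib)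

lemma residue_scale: "rational_point M \<Longrightarrow> residue sS (sS c s) M = c * residue sS s M"
  using ring_ideal_scale[OF rational_pointD(1)[of M] residue_mem[of M s], of c]
  by (intro residue_eqI) (auto simp: S.scale_right_diff_distrib)

lemma residue_mult:
  assumes M: "rational_point M"
  shows "residue sS (s * t) M = residue sS s M * residue sS t M"
proof (rule residue_eqI[OF M])
  let ?c = "residue sS s M" and ?d = "residue sS t M"
  have "t * (s - sS ?c 1) + sS ?c (t - sS ?d 1) \<in> M"
    using M ring_ideal_add ring_ideal_mult ring_ideal_scale residue_mem rational_pointD(1) by meson
  moreover have "t * (s - sS ?c 1) + sS ?c (t - sS ?d 1) = s * t - sS (?c * ?d) 1"
    using sS_eq[of ?c t] by (simp add: algebra_simps S.scale_right_diff_distrib)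
  ultimately show "s * t - sS (?c * ?d) 1 \<in> M" by simp
qed

lemma residue_eq_0: "rational_point M \<Longrightarrow> residue sS s M = 0 \<longleftrightarrow> s \<in> M"
  using residue_mem[of M s] residue_eqI[of M s 0] by auto

lemma residue_one: "rational_point M \<Longrightarrow> residue sS 1 M = 1"
  by (rule residue_eqI) (auto simp: ring_ideal_zero rational_pointD)

definition ev :: "'s set \<Rightarrow> 't \<Rightarrow> 'g" where
  "ev M z = (\<Sum>b\<in>Bg. sg (residue sS (coord b z) M) b)"

context
  fixes M assumes M: "rational_point M"
begin

lemma ev_add: "ev M (z + w) = ev M z + ev M w"
  unfolding ev_def by (simp add: coord_add residue_add[OF M] g.scale_left_distrib sum.distrib)

lemma ev_scale: "ev M (sT c z) = sg c (ev M z)"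
  unfolding ev_def by (simp add: coord_scale residue_scale[OF M] g.scale_sum_right)

lemma ev_zero [simp]: "ev M 0 = 0"
  using ev_add[of 0 0] by simp

lemma ev_diff: "ev M (z - w) = ev M z - ev M w"
  using ev_add[of "z - w" w] by (simp add: algebra_simps)

lemma ev_sum: "ev M (\<Sum>i\<in>I. z i) = (\<Sum>i\<in>I. ev M (z i))"
  by (induction I rule: infinite_finite_induct) (auto simp: ev_add)

lemma ev_tens: "ev M (tens x s) = sg (residue sS s M) x"
proof -
  have "ev M (tens x s) = sg (residue sS s M) (\<Sum>b\<in>Bg. sg (coef x b) b)"
    unfolding ev_def g.scale_sum_right by (simp add: coord_tens residue_scale[OF M] mult.commute)
  then show ?thesis by (simp only: coef_expand)
qed

lemma ev_brT: "ev M (brT z w) = br (ev M z) (ev M w)"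
proof (induction z rule: tens_induct)
  case (2 x t)
  show ?case
  proof (induction w rule: tens_induct)
    case (2 y r)
    show ?case
      by (simp add: T_bracket ev_tens residue_mult[OF M] br_scale_left br_scale_right)
  qed (auto simp: brT_add_right ev_add br_add_right)
qed (auto simp: brT_add_left ev_add br_add_left)

lemma ev_eq_0: "ev M z = 0 \<longleftrightarrow> z \<in> gtens M"
proof
  assume "ev M z = 0"
  then have "residue sS (coord b z) M = 0" if "b \<in> Bg" for b
    using g.independentD[OF Bg(2,1), of "\<lambda>b. residue sS (coord b z) M"] that unfolding ev_def by simp
  then show "z \<in> gtens M" unfolding gtens_def using residue_eq_0[OF M] by auto
next
  assume "z \<in> gtens M"
  then have "residue sS (coord b z) M = 0" if "b \<in> Bg" for b
    using that residue_eq_0[OF M] unfolding gtens_def by auto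
  then show "ev M z = 0" unfolding ev_def by simp
qed

lemma eval_at_eq_ev: "eval_at sg sS tens z M = ev M z"
  unfolding eval_at_def
proof (rule the_equality)
  obtain f where f: "bij_betw f {..<card Bg} Bg"
    using ex_bij_betw_nat_finite[OF Bg(1)] by (auto simp: atLeast0LessThan)
  have "z = (\<Sum>i<card Bg. tens (f i) (coord (f i) z))"
    using sum.reindex_bij_betw[OF f, of "\<lambda>b. tens b (coord b z)"] by (simp add: coord_expand)
  moreover have "ev M z = (\<Sum>i<card Bg. sg (residue sS (coord (f i) z) M) (f i))"
    unfolding ev_def using sum.reindex_bij_betw[OF f, of "\<lambda>b. sg (residue sS (coord b z) M) b"] by simp
  ultimately show "\<exists>(n::nat) x s. z = (\<Sum>i<n. tens (x i) (s i)) \<and> ev M z = (\<Sum>i<n. sg (residue sS (s i) M) (x i))"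
    by (intro exI[of _ "card Bg"] exI[of _ f] exI[of _ "\<lambda>i. coord (f i) z"]) simp
  fix y assume "\<exists>(n::nat) x s. z = (\<Sum>i<n. tens (x i) (s i)) \<and> y = (\<Sum>i<n. sg (residue sS (s i) M) (x i))"
  then show "y = ev M z" by (auto simp: ev_sum ev_tens)
qed

end

end

section \<open>The group action\<close>

text \<open>Stated for rings in which \<open>0 = 1\<close> is possible, since \<open>S\<close> may be the zero ring.\<close>

lemma prod_add_expand:
  fixes f g :: "'i \<Rightarrow> 's::{comm_ring, comm_monoid_mult}"
  assumes "finite F"
  shows "(\<Prod>i\<in>F. f i + g i) = (\<Sum>T\<in>Pow F. (\<Prod>i\<in>F - T. f i) * (\<Prod>i\<in>T. g i))"
  using assms
proof (induction F rule: finite_induct)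
  case (insert x F)
  have inj: "inj_on (insert x) (Pow F)" using insert.hyps by (auto simp: inj_on_def)
  have disj: "Pow F \<inter> insert x ` Pow F = {}" using insert.hyps by auto
  have "(\<Sum>T\<in>Pow (insert x F). (\<Prod>i\<in>insert x F - T. f i) * (\<Prod>i\<in>T. g i)) =
     (\<Sum>T\<in>Pow F. (\<Prod>i\<in>insert x F - T. f i) * (\<Prod>i\<in>T. g i)) +
     (\<Sum>T\<in>Pow F. (\<Prod>i\<in>insert x F - insert x T. f i) * (\<Prod>i\<in>insert x T. g i))"
    unfolding Pow_insert by (subst sum.union_disjoint) (use insert.hyps disj in \<open>auto simp: sum.reindex[OF inj]\<close>)
  also have "(\<Sum>T\<in>Pow F. (\<Prod>i\<in>insert x F - T. f i) * (\<Prod>i\<in>T. g i)) =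
     (\<Sum>T\<in>Pow F. f x * ((\<Prod>i\<in>F - T. f i) * (\<Prod>i\<in>T. g i)))"
  proof (rule sum.cong)
    fix T assume T: "T \<in> Pow F"
    then have "insert x F - T = insert x (F - T)" using insert.hyps by auto
    then show "(\<Prod>i\<in>insert x F - T. f i) * (\<Prod>i\<in>T. g i) = f x * ((\<Prod>i\<in>F - T. f i) * (\<Prod>i\<in>T. g i))"
      using insert.hyps by (simp add: mult.assoc)
  qed simp
  also have "(\<Sum>T\<in>Pow F. (\<Prod>i\<in>insert x F - insert x T. f i) * (\<Prod>i\<in>insert x T. g i)) =
     (\<Sum>T\<in>Pow F. g x * ((\<Prod>i\<in>F - T. f i) * (\<Prod>i\<in>T. g i)))"
  proof (rule sum.cong)
    fix T assume T: "T \<in> Pow F"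
    then have "insert x F - insert x T = F - T" "x \<notin> T" "finite T" using insert.hyps finite_subset by auto
    then show "(\<Prod>i\<in>insert x F - insert x T. f i) * (\<Prod>i\<in>insert x T. g i) = g x * ((\<Prod>i\<in>F - T. f i) * (\<Prod>i\<in>T. g i))"
      by (simp add: mult.left_commute)
  qed simp
  finally show ?case using insert.IH insert.hyps
    by (simp add: distrib_right sum_distrib_left sum.distrib)
qed auto

locale twisted_algebra = current_algebra sg br sS sT tens brT
  for sg :: "'k::{alg_closed_field, field_char_0} \<Rightarrow> 'g::ab_group_add \<Rightarrow> 'g"
    and br :: "'g \<Rightarrow> 'g \<Rightarrow> 'g"
    and sS :: "'k \<Rightarrow> 's::{comm_ring, comm_monoid_mult} \<Rightarrow> 's"
    and sT :: "'k \<Rightarrow> 't::ab_group_add \<Rightarrow> 't"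
    and tens :: "'g \<Rightarrow> 's \<Rightarrow> 't"
    and brT :: "'t \<Rightarrow> 't \<Rightarrow> 't" +
  fixes \<Gamma> :: "('c, 'd) monoid_scheme"
    and act :: "'c \<Rightarrow> 't \<Rightarrow> 't"
  assumes \<Gamma>_finite: "finite (carrier \<Gamma>)"
    and \<Gamma>_action: "group_action \<Gamma> (UNIV :: 't set) act"
    and \<Gamma>_linear: "\<And>\<gamma>. \<gamma> \<in> carrier \<Gamma> \<Longrightarrow> Vector_Spaces.linear sT sT (act \<gamma>)"
    and \<Gamma>_bracket: "\<And>\<gamma> z w. \<gamma> \<in> carrier \<Gamma> \<Longrightarrow> act \<gamma> (brT z w) = brT (act \<gamma> z) (act \<gamma> w)"
begin

abbreviation G :: "'c set" where "G \<equiv> carrier \<Gamma>"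

sublocale grp: group \<Gamma>
  using \<Gamma>_action unfolding group_action_def group_hom_def by blast

lemma act_one: "act \<one>\<^bsub>\<Gamma>\<^esub> z = z"
  using group_action.id_eq_one[OF \<Gamma>_action] by (metis UNIV_I restrict_apply')

lemma act_mult: "\<gamma> \<in> G \<Longrightarrow> \<delta> \<in> G \<Longrightarrow> act (\<gamma> \<otimes>\<^bsub>\<Gamma>\<^esub> \<delta>) z = act \<gamma> (act \<delta> z)"
  using group_action.composition_rule[OF \<Gamma>_action] by simp

lemma act_inv: "\<gamma> \<in> G \<Longrightarrow> act \<gamma> (act (inv\<^bsub>\<Gamma>\<^esub> \<gamma>) z) = z" "\<gamma> \<in> G \<Longrightarrow> act (inv\<^bsub>\<Gamma>\<^esub> \<gamma>) (act \<gamma> z) = z"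
  by (simp_all flip: act_mult add: act_one)

lemma act_add: "\<gamma> \<in> G \<Longrightarrow> act \<gamma> (z + w) = act \<gamma> z + act \<gamma> w"
  and act_scale: "\<gamma> \<in> G \<Longrightarrow> act \<gamma> (sT c z) = sT c (act \<gamma> z)"
  by (rule linear_add_scale[OF \<Gamma>_linear]; assumption)+

lemma act_zero: "\<gamma> \<in> G \<Longrightarrow> act \<gamma> 0 = 0"
  using act_add[of \<gamma> 0 0] by simp

lemma act_diff: "\<gamma> \<in> G \<Longrightarrow> act \<gamma> (z - w) = act \<gamma> z - act \<gamma> w"
  using act_add[of \<gamma> "z - w" w] by (simp add: algebra_simps)

lemma act_sum: "\<gamma> \<in> G \<Longrightarrow> act \<gamma> (\<Sum>i\<in>I. z i) = (\<Sum>i\<in>I. act \<gamma> (z i))"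
  by (induction I rule: infinite_finite_induct) (auto simp: act_add act_zero)

text \<open>
  The action of \<open>\<Gamma>\<close> on \<open>S\<close>.  Conjugation of \<open>smul s\<close> by \<open>act \<gamma>\<close> commutes with all brackets, hence
  is again multiplication by an element of \<open>S\<close>; so \<open>\<Gamma>\<close> acts on \<open>\<gg> \<otimes> S\<close> semilinearly.
\<close>

definition gS :: "'c \<Rightarrow> 's \<Rightarrow> 's" where
  "gS \<gamma> s = (SOME s'. \<forall>z. act \<gamma> (smul s z) = smul s' (act \<gamma> z))"

lemma act_smul:
  assumes \<gamma>: "\<gamma> \<in> G"
  shows "act \<gamma> (smul s z) = smul (gS \<gamma> s) (act \<gamma> z)"
proof -
  let ?i = "inv\<^bsub>\<Gamma>\<^esub> \<gamma>"
  have i: "?i \<in> G" using \<gamma> by simp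
  obtain s' where s': "\<And>z. act \<gamma> (smul s (act ?i z)) = smul s' z"
  proof (rule centroid[of "\<lambda>z. act \<gamma> (smul s (act ?i z))"])
    show "act \<gamma> (smul s (act ?i (z + w))) = act \<gamma> (smul s (act ?i z)) + act \<gamma> (smul s (act ?i w))" for z w
      using \<gamma> i by (simp add: act_add smul_add_right)
    show "act \<gamma> (smul s (act ?i (sT c z))) = sT c (act \<gamma> (smul s (act ?i z)))" for c z
      using \<gamma> i by (simp add: act_scale smul_scale)
    show "act \<gamma> (smul s (act ?i (brT z w))) = brT z (act \<gamma> (smul s (act ?i w)))" for z w
      using \<gamma> i by (simp add: \<Gamma>_bracket flip: brT_smul_right) (simp add: act_inv)
  qed blast
  have "\<forall>z. act \<gamma> (smul s z) = smul s' (act \<gamma> z)" using s'[of "act \<gamma> _"] act_inv(2)[OF \<gamma>] by simp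
  from someI[of "\<lambda>s'. \<forall>z. act \<gamma> (smul s z) = smul s' (act \<gamma> z)", OF this]
  show ?thesis unfolding gS_def by blast
qed

lemma gS_eqI:
  assumes \<gamma>: "\<gamma> \<in> G" and s': "\<And>z. act \<gamma> (smul s z) = smul s' (act \<gamma> z)"
  shows "gS \<gamma> s = s'"
proof (rule smul_inj)
  fix z
  have "smul (gS \<gamma> s) (act \<gamma> (act (inv\<^bsub>\<Gamma>\<^esub> \<gamma>) z)) = smul s' (act \<gamma> (act (inv\<^bsub>\<Gamma>\<^esub> \<gamma>) z))"
    using s' act_smul[OF \<gamma>] by metis
  then show "smul (gS \<gamma> s) z = smul s' z" by (simp add: act_inv[OF \<gamma>])
qed

lemma gS_add: "\<gamma> \<in> G \<Longrightarrow> gS \<gamma> (s + t) = gS \<gamma> s + gS \<gamma> t"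
  by (rule gS_eqI) (simp_all add: smul_add_left act_add act_smul)

lemma gS_mult: "\<gamma> \<in> G \<Longrightarrow> gS \<gamma> (s * t) = gS \<gamma> s * gS \<gamma> t"
  by (rule gS_eqI) (simp_all flip: smul_smul add: act_smul)

lemma gS_one: "\<gamma> \<in> G \<Longrightarrow> gS \<gamma> 1 = 1"
  by (rule gS_eqI) simp_all

lemma gS_scale: "\<gamma> \<in> G \<Longrightarrow> gS \<gamma> (sS c s) = sS c (gS \<gamma> s)"
  by (rule gS_eqI) (simp_all add: smul_scale_left act_scale act_smul)

lemma gS_const: "\<gamma> \<in> G \<Longrightarrow> gS \<gamma> (sS c 1) = sS c 1"
  by (simp add: gS_scale gS_one)

lemma gS_comp: "\<gamma> \<in> G \<Longrightarrow> \<delta> \<in> G \<Longrightarrow> gS (\<gamma> \<otimes>\<^bsub>\<Gamma>\<^esub> \<delta>) s = gS \<gamma> (gS \<delta> s)"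
proof (rule gS_eqI[OF grp.m_closed])
  assume \<gamma>: "\<gamma> \<in> G" and \<delta>: "\<delta> \<in> G"
  show "act (\<gamma> \<otimes>\<^bsub>\<Gamma>\<^esub> \<delta>) (smul s z) = smul (gS \<gamma> (gS \<delta> s)) (act (\<gamma> \<otimes>\<^bsub>\<Gamma>\<^esub> \<delta>) z)" for z
    unfolding act_mult[OF \<gamma> \<delta>] act_smul[OF \<gamma>] act_smul[OF \<delta>] ..
qed

lemma gS_id: "gS \<one>\<^bsub>\<Gamma>\<^esub> s = s"
  by (rule gS_eqI) (simp_all add: act_one)

lemma gS_inv: "\<gamma> \<in> G \<Longrightarrow> gS \<gamma> (gS (inv\<^bsub>\<Gamma>\<^esub> \<gamma>) s) = s" "\<gamma> \<in> G \<Longrightarrow> gS (inv\<^bsub>\<Gamma>\<^esub> \<gamma>) (gS \<gamma> s) = s"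
  by (simp_all flip: gS_comp add: gS_id)

lemma gS_zero: "\<gamma> \<in> G \<Longrightarrow> gS \<gamma> 0 = 0"
  using gS_add[of \<gamma> 0 0] by simp

lemma gS_minus: "\<gamma> \<in> G \<Longrightarrow> gS \<gamma> (- s) = - gS \<gamma> s"
  using gS_add[of \<gamma> s "- s"] gS_zero[of \<gamma>] by (simp add: eq_neg_iff_add_eq_0 add.commute)

lemma gS_diff: "\<gamma> \<in> G \<Longrightarrow> gS \<gamma> (s - t) = gS \<gamma> s - gS \<gamma> t"
  using gS_add[of \<gamma> s "- t"] gS_minus[of \<gamma> t] by simp

lemma gS_sum: "\<gamma> \<in> G \<Longrightarrow> gS \<gamma> (\<Sum>i\<in>I. s i) = (\<Sum>i\<in>I. gS \<gamma> (s i))"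
  by (induction I rule: infinite_finite_induct) (auto simp: gS_add gS_zero)

lemma gS_prod: "\<gamma> \<in> G \<Longrightarrow> gS \<gamma> (\<Prod>i\<in>I. s i) = (\<Prod>i\<in>I. gS \<gamma> (s i))"
  by (induction I rule: infinite_finite_induct) (auto simp: gS_mult gS_one)

lemma gS_image_inv: "\<gamma> \<in> G \<Longrightarrow> gS \<gamma> ` gS (inv\<^bsub>\<Gamma>\<^esub> \<gamma>) ` J = J" "\<gamma> \<in> G \<Longrightarrow> gS (inv\<^bsub>\<Gamma>\<^esub> \<gamma>) ` gS \<gamma> ` J = J"
  by (auto simp: image_image gS_inv)

lemma bij_mult_left: "\<delta> \<in> G \<Longrightarrow> bij_betw (\<lambda>\<gamma>. \<delta> \<otimes>\<^bsub>\<Gamma>\<^esub> \<gamma>) G G"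
  by (rule bij_betw_byWitness[where f' = "\<lambda>\<gamma>. inv\<^bsub>\<Gamma>\<^esub> \<delta> \<otimes>\<^bsub>\<Gamma>\<^esub> \<gamma>"])
    (auto simp flip: grp.m_assoc)

lemma sum_mult_left: "\<delta> \<in> G \<Longrightarrow> (\<Sum>\<gamma>\<in>G. f (\<delta> \<otimes>\<^bsub>\<Gamma>\<^esub> \<gamma>)) = (\<Sum>\<gamma>\<in>G. f \<gamma>)"
  by (rule sum.reindex_bij_betw[OF bij_mult_left])

lemma card_G: "card G \<noteq> 0"
  using \<Gamma>_finite grp.one_closed by auto

subsection \<open>Ideals and the action on the spectrum\<close>

lemma gS_ideal:
  assumes \<gamma>: "\<gamma> \<in> G" and J: "ring_ideal J"
  shows "ring_ideal (gS \<gamma> ` J)"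
  unfolding ring_ideal_def
proof (intro conjI ballI allI)
  show "0 \<in> gS \<gamma> ` J" using gS_zero[OF \<gamma>] ring_ideal_zero[OF J] by (metis imageI)
  show "a + b \<in> gS \<gamma> ` J" if "a \<in> gS \<gamma> ` J" "b \<in> gS \<gamma> ` J" for a b
    using that ring_ideal_add[OF J] by (auto simp flip: gS_add[OF \<gamma>])
  fix r a assume "a \<in> gS \<gamma> ` J"
  then obtain a' where a': "a = gS \<gamma> a'" "a' \<in> J" by blast
  have "r * a = gS \<gamma> (gS (inv\<^bsub>\<Gamma>\<^esub> \<gamma>) r * a')" using a' \<gamma> by (simp add: gS_mult gS_inv)
  then show "r * a \<in> gS \<gamma> ` J" using ring_ideal_mult[OF J a'(2)] by blast
qed

lemma act_gtens:
  assumes \<gamma>: "\<gamma> \<in> G" and J: "ring_ideal J" and z: "z \<in> gtens J"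
  shows "act \<gamma> z \<in> gtens (gS \<gamma> ` J)"
proof -
  have J': "ring_ideal (gS \<gamma> ` J)" by (rule gS_ideal[OF \<gamma> J])
  have "act \<gamma> z = (\<Sum>b\<in>Bg. smul (gS \<gamma> (coord b z)) (act \<gamma> (tens b 1)))"
    by (subst smul_expand[of z]) (simp only: act_sum[OF \<gamma>] act_smul[OF \<gamma>])
  also have "\<dots> \<in> gtens (gS \<gamma> ` J)"
    by (intro T.subspace_sum[OF gtens_subspace[OF J']] smul_in_gtens[OF J']) (use z in \<open>auto simp: gtens_def\<close>)
  finally show ?thesis .
qed

lemma act_gtens_image:
  assumes \<gamma>: "\<gamma> \<in> G" and J: "ring_ideal J"
  shows "act \<gamma> ` gtens J = gtens (gS \<gamma> ` J)"
proof
  show "act \<gamma> ` gtens J \<subseteq> gtens (gS \<gamma> ` J)" using act_gtens[OF assms] by blast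
  show "gtens (gS \<gamma> ` J) \<subseteq> act \<gamma> ` gtens J"
  proof
    fix w assume w: "w \<in> gtens (gS \<gamma> ` J)"
    have "act (inv\<^bsub>\<Gamma>\<^esub> \<gamma>) w \<in> gtens J"
      using act_gtens[OF _ gS_ideal[OF assms] w, of "inv\<^bsub>\<Gamma>\<^esub> \<gamma>"] \<gamma> by (simp add: gS_image_inv)
    then show "w \<in> act \<gamma> ` gtens J" using act_inv(1)[OF \<gamma>, of w] by (metis imageI)
  qed
qed

lemma gS_rational_point:
  assumes \<gamma>: "\<gamma> \<in> G" and M: "rational_point M"
  shows "rational_point (gS \<gamma> ` M)"
  unfolding rational_point_def
proof (intro conjI allI)
  show "ring_ideal (gS \<gamma> ` M)" by (rule gS_ideal[OF \<gamma> rational_pointD(1)[OF M]])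
  show "1 \<notin> gS \<gamma> ` M"
  proof
    assume "1 \<in> gS \<gamma> ` M"
    then obtain m where "m \<in> M" "gS \<gamma> m = 1" by auto
    then have "m = 1" using gS_inv(2)[OF \<gamma>, of m] gS_one[of "inv\<^bsub>\<Gamma>\<^esub> \<gamma>"] \<gamma> by simp
    then show False using \<open>m \<in> M\<close> rational_pointD(2)[OF M] by simp
  qed
  fix s
  have "gS \<gamma> (gS (inv\<^bsub>\<Gamma>\<^esub> \<gamma>) s - sS (residue sS (gS (inv\<^bsub>\<Gamma>\<^esub> \<gamma>) s) M) 1) \<in> gS \<gamma> ` M"
    by (rule imageI[OF residue_mem[OF M]])
  then show "\<exists>c. s - sS c 1 \<in> gS \<gamma> ` M" using \<gamma> by (auto simp: gS_diff gS_inv gS_const)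
qed

text \<open>The action on the spectrum is the one induced by the action on \<open>S\<close>, because an ideal \<open>J\<close> is determined by \<open>\<gg> \<otimes> J\<close>.\<close>

lemma max_act_eq:
  assumes \<gamma>: "\<gamma> \<in> G" and M: "rational_point M"
  shows "max_act sT tens act \<gamma> M = gS \<gamma> ` M"
  unfolding max_act_def
proof (rule the_equality)
  have M': "ring_ideal M" "ring_ideal (gS \<gamma> ` M)"
    using rational_pointD(1) M gS_rational_point[OF assms] by blast+
  show "gS \<gamma> ` M \<in> Max_spec \<and> act \<gamma> ` tensor_ideal sT tens M = tensor_ideal sT tens (gS \<gamma> ` M)"
    using rational_point_Max_spec[OF gS_rational_point[OF assms]] act_gtens_image[OF \<gamma> M'(1)]
    by (simp add: tensor_ideal_eq_gtens M')
  fix N assume N: "N \<in> Max_spec \<and> act \<gamma> ` tensor_ideal sT tens M = tensor_ideal sT tens N"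
  then have iN: "ring_ideal N" unfolding Max_spec_def by blast
  then have "gtens N = gtens (gS \<gamma> ` M)" using N act_gtens_image[OF \<gamma> M'(1)] by (simp add: tensor_ideal_eq_gtens M')
  then show "N = gS \<gamma> ` M" using gtens_inj[OF iN M'(2)] gtens_inj[OF M'(2) iN] by auto
qed

lemma stabilizer_eq:
  "rational_point M \<Longrightarrow> stabilizer \<Gamma> (max_act sT tens act) M = {\<gamma> \<in> G. gS \<gamma> ` M = M}"
  unfolding stabilizer_def using max_act_eq by auto

lemma fixed_at_eq:
  assumes M: "rational_point M"
  shows "fixed_at sg sS sT tens \<Gamma> act M = {x. \<forall>\<gamma>\<in>G. gS \<gamma> ` M = M \<longrightarrow> ev M (act \<gamma> (tens x 1)) = x}"
  unfolding fixed_at_def stabilizer_eq[OF M] eval_at_eq_ev[OF M] by auto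

subsection \<open>Invariants\<close>

definition L :: "'t set" where "L = fixed_subalgebra \<Gamma> act"

lemma L_iff: "z \<in> L \<longleftrightarrow> (\<forall>\<gamma>\<in>G. act \<gamma> z = z)"
  unfolding L_def fixed_subalgebra_def by simp

lemma L_add: "z \<in> L \<Longrightarrow> w \<in> L \<Longrightarrow> z + w \<in> L"
  and L_scale: "z \<in> L \<Longrightarrow> sT c z \<in> L"
  and L_zero: "0 \<in> L"
  and L_brT: "z \<in> L \<Longrightarrow> w \<in> L \<Longrightarrow> brT z w \<in> L"
  unfolding L_iff by (auto simp: act_add act_scale act_zero \<Gamma>_bracket)

lemma L_subspace: "T.subspace L"
  unfolding T.subspace_def using L_add L_scale L_zero by blast

lemma L_sum: "(\<And>i. i \<in> I \<Longrightarrow> z i \<in> L) \<Longrightarrow> (\<Sum>i\<in>I. z i) \<in> L"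
  by (rule T.subspace_sum[OF L_subspace])

definition A :: "'s set" where "A = {a. \<forall>\<gamma>\<in>G. gS \<gamma> a = a}"

lemma A_add: "a \<in> A \<Longrightarrow> b \<in> A \<Longrightarrow> a + b \<in> A"
  and A_diff: "a \<in> A \<Longrightarrow> b \<in> A \<Longrightarrow> a - b \<in> A"
  and A_mult: "a \<in> A \<Longrightarrow> b \<in> A \<Longrightarrow> a * b \<in> A"
  and A_scale: "a \<in> A \<Longrightarrow> sS c a \<in> A"
  and A_one: "1 \<in> A"
  and A_zero: "0 \<in> A"
  unfolding A_def by (auto simp: gS_add gS_diff gS_mult gS_scale gS_one gS_zero)

lemma A_subspace: "S.subspace A"
  unfolding S.subspace_def using A_add A_scale A_zero by blast

lemma A_sum: "(\<And>i. i \<in> I \<Longrightarrow> a i \<in> A) \<Longrightarrow> (\<Sum>i\<in>I. a i) \<in> A"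
  by (rule S.subspace_sum[OF A_subspace])

lemma smul_L: "a \<in> A \<Longrightarrow> z \<in> L \<Longrightarrow> smul a z \<in> L"
  unfolding L_iff A_def by (auto simp: act_smul)

text \<open>
  Summation over the group maps \<open>\<gg> \<otimes> S\<close> to the invariants and is multiplication by the order of
  \<open>\<Gamma>\<close> on them; in characteristic zero every invariant arises this way.
\<close>

definition trT :: "'t \<Rightarrow> 't" where "trT z = (\<Sum>\<gamma>\<in>G. act \<gamma> z)"

lemma trT_L: "trT z \<in> L"
  unfolding L_iff
proof
  fix \<delta> assume \<delta>: "\<delta> \<in> G"
  have "act \<delta> (trT z) = (\<Sum>\<gamma>\<in>G. act (\<delta> \<otimes>\<^bsub>\<Gamma>\<^esub> \<gamma>) z)"
    unfolding trT_def act_sum[OF \<delta>] by (rule sum.cong) (simp_all add: act_mult \<delta>)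
  then show "act \<delta> (trT z) = trT z" unfolding trT_def using sum_mult_left[OF \<delta>] by simp
qed

lemma trT_fixed: "z \<in> L \<Longrightarrow> trT z = sT (of_nat (card G)) z"
proof -
  assume z: "z \<in> L"
  have "(\<Sum>\<gamma>\<in>F. act \<gamma> z) = sT (of_nat (card F)) z" if "finite F" "F \<subseteq> G" for F
    using that z by (induction F rule: finite_induct) (auto simp: L_iff T.scale_left_distrib add.commute)
  then show ?thesis unfolding trT_def using \<Gamma>_finite by simp
qed

lemma trT_add: "trT (z + w) = trT z + trT w"
  unfolding trT_def by (simp add: act_add sum.distrib)

lemma trT_sum: "trT (\<Sum>i\<in>I. z i) = (\<Sum>i\<in>I. trT (z i))"
  unfolding trT_def by (subst sum.swap) (simp add: act_sum)

lemma trT_act: "\<delta> \<in> G \<Longrightarrow> trT (act \<delta> z) = trT z"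
proof -
  assume \<delta>: "\<delta> \<in> G"
  have bij: "bij_betw (\<lambda>\<gamma>. \<gamma> \<otimes>\<^bsub>\<Gamma>\<^esub> \<delta>) G G"
    by (rule bij_betw_byWitness[where f' = "\<lambda>\<gamma>. \<gamma> \<otimes>\<^bsub>\<Gamma>\<^esub> inv\<^bsub>\<Gamma>\<^esub> \<delta>"]) (auto simp: \<delta> grp.m_assoc)
  have "trT (act \<delta> z) = (\<Sum>\<gamma>\<in>G. act (\<gamma> \<otimes>\<^bsub>\<Gamma>\<^esub> \<delta>) z)"
    unfolding trT_def by (rule sum.cong) (simp_all add: act_mult \<delta>)
  also have "\<dots> = trT z" unfolding trT_def by (rule sum.reindex_bij_betw[OF bij])
  finally show ?thesis .
qed

lemma trT_smul: "a \<in> A \<Longrightarrow> trT (smul a z) = smul a (trT z)"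
  unfolding trT_def smul_sum_right by (rule sum.cong) (auto simp: act_smul A_def)

definition trS :: "'s \<Rightarrow> 's" where "trS s = (\<Sum>\<gamma>\<in>G. gS \<gamma> s)"

lemma trS_mult: "a \<in> A \<Longrightarrow> trS (a * s) = a * trS s"
  unfolding trS_def sum_distrib_left by (rule sum.cong) (auto simp: gS_mult A_def)

lemma trS_fixed: "a \<in> A \<Longrightarrow> trS a = sS (of_nat (card G)) a"
proof -
  assume a: "a \<in> A"
  have "(\<Sum>\<gamma>\<in>F. gS \<gamma> a) = sS (of_nat (card F)) a" if "finite F" "F \<subseteq> G" for F
    using that a by (induction F rule: finite_induct) (auto simp: A_def S.scale_left_distrib add.commute)
  then show ?thesis unfolding trS_def using \<Gamma>_finite by simp
qed

text \<open>
  The elementary symmetric functions of the conjugates \<open>-\<gamma> s\<close>: expanding \<open>\<Prod>\<^sub>\<gamma> (s - \<gamma> s) = 0\<close>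
  shows that \<open>s\<close> is integral over \<open>A\<close>.
\<close>

definition esym :: "'s \<Rightarrow> nat \<Rightarrow> 's" where
  "esym s j = (\<Sum>T | T \<subseteq> G \<and> card T = j. \<Prod>\<gamma>\<in>T. - gS \<gamma> s)"

lemma esym_A: "esym s j \<in> A"
  unfolding A_def mem_Collect_eq
proof
  fix \<delta> assume \<delta>: "\<delta> \<in> G"
  let ?m = "\<lambda>\<gamma>. \<delta> \<otimes>\<^bsub>\<Gamma>\<^esub> \<gamma>"
  let ?P = "{T. T \<subseteq> G \<and> card T = j}"
  have bij: "bij_betw ?m G G" by (rule bij_mult_left[OF \<delta>])
  have inj: "inj_on ?m T" if "T \<subseteq> G" for T using bij that bij_betw_imp_inj_on inj_on_subset by blast
  have bijP: "bij_betw (image ?m) ?P ?P"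
  proof (rule bij_betw_byWitness[where f' = "image (\<lambda>\<gamma>. inv\<^bsub>\<Gamma>\<^esub> \<delta> \<otimes>\<^bsub>\<Gamma>\<^esub> \<gamma>)"])
    have 1: "(\<lambda>\<gamma>. inv\<^bsub>\<Gamma>\<^esub> \<delta> \<otimes>\<^bsub>\<Gamma>\<^esub> \<gamma>) ` ?m ` T = T" if "T \<subseteq> G" for T
    proof -
      have "inv\<^bsub>\<Gamma>\<^esub> \<delta> \<otimes>\<^bsub>\<Gamma>\<^esub> (\<delta> \<otimes>\<^bsub>\<Gamma>\<^esub> \<gamma>) = \<gamma>" if "\<gamma> \<in> T" for \<gamma>
        using that \<open>T \<subseteq> G\<close> \<delta> by (auto simp flip: grp.m_assoc)
      then show ?thesis by (simp add: image_image)
    qed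
    have 2: "?m ` (\<lambda>\<gamma>. inv\<^bsub>\<Gamma>\<^esub> \<delta> \<otimes>\<^bsub>\<Gamma>\<^esub> \<gamma>) ` T = T" if "T \<subseteq> G" for T
    proof -
      have "\<delta> \<otimes>\<^bsub>\<Gamma>\<^esub> (inv\<^bsub>\<Gamma>\<^esub> \<delta> \<otimes>\<^bsub>\<Gamma>\<^esub> \<gamma>) = \<gamma>" if "\<gamma> \<in> T" for \<gamma>
        using that \<open>T \<subseteq> G\<close> \<delta> by (auto simp flip: grp.m_assoc)
      then show ?thesis by (simp add: image_image)
    qed
    show "\<forall>T\<in>?P. (\<lambda>\<gamma>. inv\<^bsub>\<Gamma>\<^esub> \<delta> \<otimes>\<^bsub>\<Gamma>\<^esub> \<gamma>) ` ?m ` T = T" using 1 by blast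
    show "\<forall>T\<in>?P. ?m ` (\<lambda>\<gamma>. inv\<^bsub>\<Gamma>\<^esub> \<delta> \<otimes>\<^bsub>\<Gamma>\<^esub> \<gamma>) ` T = T" using 2 by blast
    show "image ?m ` ?P \<subseteq> ?P" using \<delta> card_image[OF inj] by auto
    have inj': "inj_on (\<lambda>\<gamma>. inv\<^bsub>\<Gamma>\<^esub> \<delta> \<otimes>\<^bsub>\<Gamma>\<^esub> \<gamma>) T" if "T \<subseteq> G" for T
      using bij_mult_left[of "inv\<^bsub>\<Gamma>\<^esub> \<delta>"] \<delta> that bij_betw_imp_inj_on inj_on_subset grp.inv_closed by metis
    show "image (\<lambda>\<gamma>. inv\<^bsub>\<Gamma>\<^esub> \<delta> \<otimes>\<^bsub>\<Gamma>\<^esub> \<gamma>) ` ?P \<subseteq> ?P" using \<delta> card_image[OF inj'] by auto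
  qed
  have "gS \<delta> (esym s j) = (\<Sum>T\<in>?P. \<Prod>\<gamma>\<in>T. - gS (?m \<gamma>) s)"
    unfolding esym_def gS_sum[OF \<delta>] gS_prod[OF \<delta>]
    by (intro sum.cong prod.cong) (auto simp: gS_minus[OF \<delta>] gS_comp \<delta> subset_iff)
  also have "\<dots> = (\<Sum>T\<in>?P. \<Prod>\<gamma>\<in>?m ` T. - gS \<gamma> s)"
    by (intro sum.cong refl) (simp add: prod.reindex[OF inj])
  also have "\<dots> = esym s j" unfolding esym_def by (rule sum.reindex_bij_betw[OF bijP])
  finally show "gS \<delta> (esym s j) = esym s j" .
qed

lemma integral_relation: "(\<Sum>j\<le>card G. s ^ (card G - j) * esym s j) = 0"
proof -
  have "0 = (\<Prod>\<gamma>\<in>G. s + - gS \<gamma> s)"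
    using prod.remove[OF \<Gamma>_finite grp.one_closed, of "\<lambda>\<gamma>. s + - gS \<gamma> s"] by (simp add: gS_id)
  also have "\<dots> = (\<Sum>T\<in>Pow G. (\<Prod>i\<in>G - T. s) * (\<Prod>\<gamma>\<in>T. - gS \<gamma> s))"
    by (rule prod_add_expand[OF \<Gamma>_finite])
  also have "\<dots> = (\<Sum>T\<in>Pow G. s ^ (card G - card T) * (\<Prod>\<gamma>\<in>T. - gS \<gamma> s))"
  proof (rule sum.cong)
    fix T assume "T \<in> Pow G"
    then have "card (G - T) = card G - card T" using \<Gamma>_finite by (intro card_Diff_subset) (auto intro: finite_subset)
    moreover have "(\<Prod>i\<in>F. s) = s ^ card F" if "finite F" for F :: "'c set"
      using that by (induction F rule: finite_induct) auto
    ultimately show "(\<Prod>i\<in>G - T. s) * (\<Prod>\<gamma>\<in>T. - gS \<gamma> s) = s ^ (card G - card T) * (\<Prod>\<gamma>\<in>T. - gS \<gamma> s)"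
      using \<Gamma>_finite by simp
  qed simp
  also have "\<dots> = (\<Sum>j\<le>card G. \<Sum>T\<in>{T \<in> Pow G. card T = j}. s ^ (card G - card T) * (\<Prod>\<gamma>\<in>T. - gS \<gamma> s))"
    by (rule sum.group[symmetric]) (use \<Gamma>_finite card_mono in auto)
  also have "\<dots> = (\<Sum>j\<le>card G. s ^ (card G - j) * esym s j)"
    unfolding esym_def sum_distrib_left by (intro sum.cong) auto
  finally show ?thesis by simp
qed

lemma esym_0: "esym s 0 = 1"
proof -
  have "{T. T \<subseteq> G \<and> card T = 0} = {{}}"
  proof (intro equalityI subsetI)
    fix T assume "T \<in> {T. T \<subseteq> G \<and> card T = 0}"
    then have "finite T" "card T = 0" using \<Gamma>_finite finite_subset by auto
    then show "T \<in> {{}}" by simp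
  qed auto
  then show ?thesis unfolding esym_def by simp
qed

lemma esym_in_ideal:
  assumes N: "ring_ideal N" "\<And>\<gamma>. \<gamma> \<in> G \<Longrightarrow> gS \<gamma> s \<in> N" and j: "j \<noteq> 0"
  shows "esym s j \<in> N"
  unfolding esym_def
proof (rule ring_ideal_sum[OF N(1)])
  fix T assume T: "T \<in> {T. T \<subseteq> G \<and> card T = j}"
  then obtain \<gamma> where \<gamma>: "\<gamma> \<in> T" "finite T" using j by (metis (mono_tags, lifting) card.empty card.infinite ex_in_conv mem_Collect_eq)
  have "- gS \<gamma> s * (\<Prod>\<gamma>\<in>T - {\<gamma>}. - gS \<gamma> s) \<in> N"
    using ring_ideal_mult_right[OF N(1) ring_ideal_minus[OF N(1) N(2)]] \<gamma> T by auto
  then show "(\<Prod>\<gamma>\<in>T. - gS \<gamma> s) \<in> N" using prod.remove[OF \<gamma>(2,1), of "\<lambda>\<gamma>. - gS \<gamma> s"] by simp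
qed

subsection \<open>Evaluation of invariants\<close>

text \<open>
  An invariant \<open>z\<close> is congruent to \<open>z(M) \<otimes> 1\<close> modulo \<open>\<gg> \<otimes> M\<close>, a subspace which the stabilizer of \<open>M\<close>
  preserves.
\<close>

lemma ev_L_fixed_at:
  assumes M: "rational_point M" and z: "z \<in> L"
  shows "ev M z \<in> fixed_at sg sS sT tens \<Gamma> act M"
  unfolding fixed_at_eq[OF M] mem_Collect_eq
proof (intro ballI impI)
  fix \<gamma> assume \<gamma>: "\<gamma> \<in> G" and st: "gS \<gamma> ` M = M"
  let ?x = "ev M z"
  have "z - tens ?x 1 \<in> gtens M"
    by (simp add: ev_eq_0[OF M, symmetric] ev_diff[OF M] ev_tens[OF M] residue_one[OF M])
  then have "act \<gamma> (z - tens ?x 1) \<in> gtens M"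
    using act_gtens[OF \<gamma> rational_pointD(1)[OF M]] st by metis
  then have "z - act \<gamma> (tens ?x 1) \<in> gtens M" using z \<gamma> by (simp add: act_diff L_iff)
  then show "ev M (act \<gamma> (tens ?x 1)) = ?x" by (simp add: ev_eq_0[OF M, symmetric] ev_diff[OF M])
qed

text \<open>
  By the Chinese remainder theorem there is \<open>s\<close> with residue 1 at \<open>M\<close> and 0 at the other points of
  the orbit.  The sum of the conjugates of \<open>x \<otimes> s\<close> is invariant, and its value at \<open>M\<close> is \<open>x\<close> times
  the order of the stabilizer.
\<close>

lemma ev_surjective:
  assumes M: "rational_point M" and x: "x \<in> fixed_at sg sS sT tens \<Gamma> act M"
  obtains z where "z \<in> L" "ev M z = x"
proof -
  let ?H = "{\<gamma> \<in> G. gS \<gamma> ` M = M}" and ?O = "{\<gamma> \<in> G. gS \<gamma> ` M \<noteq> M}"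
  note iM = rational_pointD(1)[OF M]
  have ex: "\<exists>t. t \<in> gS \<gamma> ` M \<and> residue sS t M = 1" if \<gamma>: "\<gamma> \<in> ?O" for \<gamma>
  proof -
    have r: "rational_point (gS \<gamma> ` M)" using gS_rational_point M \<gamma> by blast
    have "\<not> gS \<gamma> ` M \<subseteq> M"
    proof
      assume "gS \<gamma> ` M \<subseteq> M"
      then have "M = gS \<gamma> ` M \<or> M = UNIV" using rational_point_Max_spec[OF r] iM unfolding Max_spec_def by blast
      then show False using \<gamma> rational_pointD(2)[OF M] by auto
    qed
    then obtain t where t: "t \<in> gS \<gamma> ` M" "t \<notin> M" by blast
    then have "residue sS t M \<noteq> 0" using residue_eq_0[OF M] by blast
    moreover have "sS (inverse (residue sS t M)) t \<in> gS \<gamma> ` M" by (rule ring_ideal_scale[OF rational_pointD(1)[OF r] t(1)])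
    ultimately show ?thesis using residue_scale[OF M, of "inverse (residue sS t M)" t] by (intro exI[of _ "sS (inverse (residue sS t M)) t"]) simp
  qed
  define t where "t \<gamma> = (SOME t. t \<in> gS \<gamma> ` M \<and> residue sS t M = 1)" for \<gamma>
  have t: "t \<gamma> \<in> gS \<gamma> ` M" "residue sS (t \<gamma>) M = 1" if "\<gamma> \<in> ?O" for \<gamma>
    using someI_ex[OF ex[OF that]] unfolding t_def by blast+
  define s where "s = (\<Prod>\<gamma>\<in>?O. t \<gamma>)"
  have finO: "finite ?O" using \<Gamma>_finite by simp
  have s1: "residue sS s M = 1"
  proof -
    have "residue sS (\<Prod>\<gamma>\<in>F. t \<gamma>) M = 1" if "finite F" "F \<subseteq> ?O" for F
      using that by (induction F rule: finite_induct) (auto simp: residue_one[OF M] residue_mult[OF M] t(2))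
    then show ?thesis unfolding s_def using finO by blast
  qed
  have sO: "s \<in> gS \<gamma> ` M" if "\<gamma> \<in> ?O" for \<gamma>
  proof -
    have "ring_ideal (gS \<gamma> ` M)" using gS_ideal iM that by blast
    from ring_ideal_mult_right[OF this t(1)[OF that], of "\<Prod>\<gamma>\<in>?O - {\<gamma>}. t \<gamma>"]
    show ?thesis unfolding s_def using prod.remove[OF finO that, of t] by simp
  qed
  have out: "ev M (act \<gamma> (tens x s)) = 0" if \<gamma>: "\<gamma> \<in> G" "gS \<gamma> ` M \<noteq> M" for \<gamma>
  proof -
    have i: "inv\<^bsub>\<Gamma>\<^esub> \<gamma> \<in> G" using \<gamma> by simp
    have "gS (inv\<^bsub>\<Gamma>\<^esub> \<gamma>) ` M \<noteq> M" using gS_image_inv(1)[OF \<gamma>(1), of M] \<gamma>(2) by auto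
    then have "s \<in> gS (inv\<^bsub>\<Gamma>\<^esub> \<gamma>) ` M" using sO i by blast
    then have "tens x s \<in> gtens (gS (inv\<^bsub>\<Gamma>\<^esub> \<gamma>) ` M)" by (rule tens_in_gtens[OF gS_ideal[OF i iM]])
    from act_gtens[OF \<gamma>(1) gS_ideal[OF i iM] this] show ?thesis
      by (simp add: ev_eq_0[OF M] gS_image_inv \<gamma>)
  qed
  have inn: "ev M (act \<gamma> (tens x s)) = x" if \<gamma>: "\<gamma> \<in> G" "gS \<gamma> ` M = M" for \<gamma>
  proof -
    have "tens x s - tens x 1 \<in> gtens M"
      by (simp add: ev_eq_0[OF M, symmetric] ev_diff[OF M] ev_tens[OF M] residue_one[OF M] s1)
    then have "act \<gamma> (tens x s - tens x 1) \<in> gtens M"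
      using act_gtens[OF \<gamma>(1) iM] \<gamma>(2) by metis
    then have "ev M (act \<gamma> (tens x s)) = ev M (act \<gamma> (tens x 1))"
      using \<gamma> by (simp add: act_diff ev_eq_0[OF M, symmetric] ev_diff[OF M])
    then show ?thesis using x \<gamma> unfolding fixed_at_eq[OF M] by simp
  qed
  have "ev M (trT (tens x s)) = (\<Sum>\<gamma>\<in>?H. x)"
    unfolding trT_def ev_sum[OF M]
    by (rule sum.mono_neutral_cong_right) (use \<Gamma>_finite out inn in auto)
  also have "\<dots> = sg (of_nat (card ?H)) x"
  proof -
    have "(\<Sum>\<gamma>\<in>F. x) = sg (of_nat (card F)) x" if "finite F" for F :: "'c set"
      using that by (induction F rule: finite_induct) (auto simp: g.scale_left_distrib)
    then show ?thesis using \<Gamma>_finite by simp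
  qed
  finally have e: "ev M (trT (tens x s)) = sg (of_nat (card ?H)) x" .
  have "\<one>\<^bsub>\<Gamma>\<^esub> \<in> ?H" by (simp add: gS_id)
  then have "?H \<noteq> {}" by blast
  then have "card ?H \<noteq> 0" using \<Gamma>_finite by simp
  then have "ev M (sT (inverse (of_nat (card ?H))) (trT (tens x s))) = x"
    using e by (simp add: ev_scale[OF M])
  then show ?thesis using that L_scale[OF trT_L] by blast
qed

end

section \<open>Irreducible modules without scalars\<close>

text \<open>
  A simple \<open>L\<close>-module, realized on a subspace \<open>X\<close>, such that no element of \<open>L\<close> acts as a nonzero scalar.
  By Schur's lemma the elements of \<open>L\<close> that commute with the action then act as zero, and so do the
  elements of abelian ideals.
\<close>

locale twisted_module = twisted_algebra sg br sS sT tens brT \<Gamma> act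
  for sg :: "'k::{alg_closed_field, field_char_0} \<Rightarrow> 'g::ab_group_add \<Rightarrow> 'g"
    and br :: "'g \<Rightarrow> 'g \<Rightarrow> 'g"
    and sS :: "'k \<Rightarrow> 's::{comm_ring, comm_monoid_mult} \<Rightarrow> 's"
    and sT :: "'k \<Rightarrow> 't::ab_group_add \<Rightarrow> 't"
    and tens :: "'g \<Rightarrow> 's \<Rightarrow> 't"
    and brT :: "'t \<Rightarrow> 't \<Rightarrow> 't"
    and \<Gamma> :: "('c, 'd) monoid_scheme"
    and act :: "'c \<Rightarrow> 't \<Rightarrow> 't" +
  fixes sV :: "'k \<Rightarrow> 'v::ab_group_add \<Rightarrow> 'v" and X :: "'v set" and \<phi> :: "'t \<Rightarrow> 'v \<Rightarrow> 'v"
  assumes simple: "simple_lie_module sT brT L sV X \<phi>"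
    and X_fin_dim: "fin_dim sV X"
    and scalar_zero: "\<And>z c. z \<in> L \<Longrightarrow> (\<And>v. v \<in> X \<Longrightarrow> \<phi> z v = sV c v) \<Longrightarrow> c = 0"
begin

sublocale V: ac_lin_space sV
  unfolding ac_lin_space_def lin_space_def
  using simple unfolding simple_lie_module_def lie_module_def by blast

lemma X_subspace: "V.subspace X"
  using simple unfolding simple_lie_module_def lie_module_def by blast

lemma \<phi>_endo: "z \<in> L \<Longrightarrow> V.endo_on X (\<phi> z)"
  using simple unfolding simple_lie_module_def lie_module_def V.endo_on_def by blast

lemma \<phi>_add: "z \<in> L \<Longrightarrow> w \<in> L \<Longrightarrow> v \<in> X \<Longrightarrow> \<phi> (z + w) v = \<phi> z v + \<phi> w v"
  and \<phi>_scale: "z \<in> L \<Longrightarrow> v \<in> X \<Longrightarrow> \<phi> (sT c z) v = sV c (\<phi> z v)"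
  and \<phi>_brT: "z \<in> L \<Longrightarrow> w \<in> L \<Longrightarrow> v \<in> X \<Longrightarrow> \<phi> (brT z w) v = \<phi> z (\<phi> w v) - \<phi> w (\<phi> z v)"
  using simple unfolding simple_lie_module_def lie_module_def by blast+

lemma \<phi>_zero: "v \<in> X \<Longrightarrow> \<phi> 0 v = 0"
  using \<phi>_add[OF L_zero L_zero, of v] by simp

lemma \<phi>_diff: "z \<in> L \<Longrightarrow> w \<in> L \<Longrightarrow> v \<in> X \<Longrightarrow> \<phi> (z - w) v = \<phi> z v - \<phi> w v"
  using \<phi>_add[of "z - w" w v] T.subspace_diff[OF L_subspace, of z w] by (simp add: algebra_simps)

lemma \<phi>_sum: "(\<And>i. i \<in> I \<Longrightarrow> z i \<in> L) \<Longrightarrow> v \<in> X \<Longrightarrow> \<phi> (\<Sum>i\<in>I. z i) v = (\<Sum>i\<in>I. \<phi> (z i) v)"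
  by (induction I rule: infinite_finite_induct) (auto simp: \<phi>_zero \<phi>_add L_sum)

lemma irr: "V.irreducible_on X (\<phi> ` L)"
  using simple unfolding simple_lie_module_def lie_module_def V.irreducible_on_def by simp

definition null :: "'t \<Rightarrow> bool" where "null z \<longleftrightarrow> (\<forall>v\<in>X. \<phi> z v = 0)"

lemma null_zero: "null 0"
  unfolding null_def using \<phi>_zero by blast

lemma null_add: "z \<in> L \<Longrightarrow> w \<in> L \<Longrightarrow> null z \<Longrightarrow> null w \<Longrightarrow> null (z + w)"
  unfolding null_def using \<phi>_add by simp

lemma null_scale: "z \<in> L \<Longrightarrow> null z \<Longrightarrow> null (sT c z)"
  unfolding null_def using \<phi>_scale by simp

lemma null_sum: "(\<And>i. i \<in> I \<Longrightarrow> z i \<in> L) \<Longrightarrow> (\<And>i. i \<in> I \<Longrightarrow> null (z i)) \<Longrightarrow> null (\<Sum>i\<in>I. z i)"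
  unfolding null_def
proof
  fix v assume z: "\<And>i. i \<in> I \<Longrightarrow> z i \<in> L" "\<And>i. i \<in> I \<Longrightarrow> \<forall>v\<in>X. \<phi> (z i) v = 0" and v: "v \<in> X"
  show "\<phi> (\<Sum>i\<in>I. z i) v = 0" by (subst \<phi>_sum[OF z(1) v]) (use z(2) v in auto)
qed

lemma null_brT: "z \<in> L \<Longrightarrow> w \<in> L \<Longrightarrow> null z \<Longrightarrow> null (brT z w)"
  unfolding null_def using \<phi>_brT[of z w] V.endo_on_in[OF \<phi>_endo[of w]] V.endo_on_zero[OF \<phi>_endo[of w] X_subspace] by simp

lemma null_if_central:
  assumes z: "z \<in> L" and c: "\<And>w. w \<in> L \<Longrightarrow> null (brT z w)"
  shows "null z"
proof -
  have e: "V.endo_on X p" if "p \<in> \<phi> ` L" for p using that \<phi>_endo by blast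
  have co: "\<phi> z (p v) = p (\<phi> z v)" if p: "p \<in> \<phi> ` L" and v: "v \<in> X" for p v
  proof -
    obtain w where w: "w \<in> L" "p = \<phi> w" using p by blast
    have "\<phi> (brT z w) v = 0" using c[OF w(1)] v unfolding null_def by blast
    then show ?thesis using \<phi>_brT[OF z w(1) v] w(2) by simp
  qed
  obtain a where a: "\<And>v. v \<in> X \<Longrightarrow> \<phi> z v = sV a v"
  proof (rule V.schur[OF irr X_fin_dim e \<phi>_endo[OF z]])
    show "\<phi> z (p v) = p (\<phi> z v)" if "p \<in> \<phi> ` L" "v \<in> X" for p v by (rule co[OF that])
  qed (assumption, rule that, assumption)
  have "a = 0" by (rule scalar_zero[OF z a])
  then show ?thesis using a unfolding null_def by simp
qed

lemma null_if_abelian_ideal: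
  assumes I: "I \<subseteq> L" "\<And>z w. z \<in> I \<Longrightarrow> w \<in> L \<Longrightarrow> brT z w \<in> I"
    and ab: "\<And>z w. z \<in> I \<Longrightarrow> w \<in> I \<Longrightarrow> null (brT z w)" and z: "z \<in> I"
  shows "null z"
proof -
  have zL: "z \<in> L" using I z by blast
  have ex: "\<exists>c. \<forall>v\<in>X. \<phi> z v = sV c v"
  proof (rule V.abelian_ideal_acts_by_scalars[OF X_fin_dim irr])
    show "V.endo_on X p" if "p \<in> \<phi> ` L" for p using that \<phi>_endo by blast
    show "V.endo_on X p" if "p \<in> \<phi> ` I" for p using that \<phi>_endo I by blast
    show "\<phi> z \<in> \<phi> ` I" using z by blast
    show "a (b v) = b (a v)" if "a \<in> \<phi> ` I" "b \<in> \<phi> ` I" and v: "v \<in> X" for a b v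
    proof -
      obtain x y where xy: "x \<in> I" "y \<in> I" "a = \<phi> x" "b = \<phi> y" using \<open>a \<in> \<phi> ` I\<close> \<open>b \<in> \<phi> ` I\<close> by blast
      have L: "x \<in> L" "y \<in> L" using xy I(1) by blast+
      have "\<phi> (brT x y) v = 0" using ab[OF xy(1,2)] v unfolding null_def by blast
      then show ?thesis using \<phi>_brT[OF L v] xy by simp
    qed
    show "\<exists>a'\<in>\<phi> ` I. \<forall>v\<in>X. a (y v) = y (a v) + a' v" if "a \<in> \<phi> ` I" "y \<in> \<phi> ` L" for a y
    proof -
      obtain x w where xw: "x \<in> I" "w \<in> L" "a = \<phi> x" "y = \<phi> w" using \<open>a \<in> \<phi> ` I\<close> \<open>y \<in> \<phi> ` L\<close> by blast
      have xL: "x \<in> L" using xw I(1) by blast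
      have "\<forall>v\<in>X. a (y v) = y (a v) + \<phi> (brT x w) v" using \<phi>_brT[OF xL xw(2)] xw(3,4) by simp
      then show ?thesis using I(2)[OF xw(1,2)] by blast
    qed
  qed blast
  then obtain c where c: "\<And>v. v \<in> X \<Longrightarrow> \<phi> z v = sV c v" by blast
  have "c = 0" by (rule scalar_zero[OF zL c])
  then show ?thesis using c unfolding null_def by simp
qed

subsection \<open>The annihilator in \<open>S\<close>\<close>

text \<open>
  The largest \<open>\<Gamma>\<close>-stable ideal \<open>J\<close> of \<open>S\<close> for which the invariants of \<open>\<gg> \<otimes> J\<close> act as zero;
  averaging shows that this is the set below.
\<close>

definition J0 :: "'s set" where "J0 = {s. \<forall>z. null (trT (smul s z))}"

lemma J0_ideal: "ring_ideal J0"
  unfolding ring_ideal_def J0_def mem_Collect_eq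
proof (intro conjI ballI allI)
  show "null (trT (smul 0 z))" for z using null_zero by (simp add: trT_def act_zero)
  show "null (trT (smul (a + b) z))"
    if "a \<in> {s. \<forall>z. null (trT (smul s z))}" "b \<in> {s. \<forall>z. null (trT (smul s z))}" for a b z
    using that null_add[OF trT_L trT_L] by (simp add: smul_add_left trT_add)
  show "null (trT (smul (r * a) z))" if "a \<in> {s. \<forall>z. null (trT (smul s z))}" for r a z
    using that by (simp add: mult.commute[of r] flip: smul_smul)
qed

lemma J0_stable: "s \<in> J0 \<Longrightarrow> \<gamma> \<in> G \<Longrightarrow> gS \<gamma> s \<in> J0"
  unfolding J0_def mem_Collect_eq
proof
  fix z assume s: "\<forall>z. null (trT (smul s z))" and \<gamma>: "\<gamma> \<in> G"
  have "smul (gS \<gamma> s) z = act \<gamma> (smul s (act (inv\<^bsub>\<Gamma>\<^esub> \<gamma>) z))" by (simp add: act_smul act_inv \<gamma>)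
  then show "null (trT (smul (gS \<gamma> s) z))" using s \<gamma> by (simp add: trT_act)
qed

lemma null_gtens_J0:
  assumes z: "z \<in> L" "z \<in> gtens J0"
  shows "null z"
proof -
  have "trT z = (\<Sum>b\<in>Bg. trT (smul (coord b z) (tens b 1)))"
    by (subst smul_expand[of z]) (simp only: trT_sum)
  moreover have "null (\<Sum>b\<in>Bg. trT (smul (coord b z) (tens b 1)))"
    by (rule null_sum[OF trT_L]) (use z(2) in \<open>auto simp: gtens_def J0_def\<close>)
  ultimately have "null (sT (of_nat (card G)) z)" using trT_fixed[OF z(1)] by simp
  then have "null (sT (inverse (of_nat (card G))) (sT (of_nat (card G)) z))"
    by (rule null_scale[OF L_scale[OF z(1)]])
  then show ?thesis using card_G by simp
qed

lemma gtens_stable: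
  assumes J: "ring_ideal J" "\<And>\<gamma> s. \<gamma> \<in> G \<Longrightarrow> s \<in> J \<Longrightarrow> gS \<gamma> s \<in> J" and "z \<in> gtens J" "\<gamma> \<in> G"
  shows "act \<gamma> z \<in> gtens J"
proof -
  have "gS \<gamma> ` J \<subseteq> J" using assms by blast
  then show ?thesis using act_gtens[OF assms(4) J(1) assms(3)] unfolding gtens_def by blast
qed

lemma J0_largest:
  assumes J: "ring_ideal J" "\<And>\<gamma> s. \<gamma> \<in> G \<Longrightarrow> s \<in> J \<Longrightarrow> gS \<gamma> s \<in> J"
    and null: "\<And>z. z \<in> L \<Longrightarrow> z \<in> gtens J \<Longrightarrow> null z"
  shows "J \<subseteq> J0"
proof
  fix s assume s: "s \<in> J"
  have "trT (smul s z) \<in> gtens J" for z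
    unfolding trT_def
    by (intro T.subspace_sum[OF gtens_subspace[OF J(1)]] gtens_stable[OF J] smul_in_gtens[OF J(1) s])
  then show "s \<in> J0" unfolding J0_def using null[OF trT_L] by blast
qed

text \<open>A \<open>\<Gamma>\<close>-stable ideal that is square-zero modulo \<open>J0\<close> gives an abelian ideal of the image of \<open>L\<close>.\<close>

lemma J0_square:
  assumes J: "ring_ideal J" "\<And>\<gamma> s. \<gamma> \<in> G \<Longrightarrow> s \<in> J \<Longrightarrow> gS \<gamma> s \<in> J"
    and sq: "\<And>a b. a \<in> J \<Longrightarrow> b \<in> J \<Longrightarrow> a * b \<in> J0"
  shows "J \<subseteq> J0"
proof (rule J0_largest[OF J])
  fix z assume z: "z \<in> L" "z \<in> gtens J"
  have exp: "brT z w = (\<Sum>b\<in>Bg. smul (coord b z) (brT (tens b 1) w))" for z w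
    by (subst smul_expand[of z]) (simp only: brT_sum_left brT_smul_left)
  have exp2: "brT w z = (\<Sum>b\<in>Bg. smul (coord b z) (brT w (tens b 1)))" for z w
    by (subst smul_expand[of z]) (simp only: brT_sum_right brT_smul_right)
  have id: "brT z w \<in> gtens J" if "z \<in> gtens J" for z w
    unfolding exp[of z w]
    by (intro T.subspace_sum[OF gtens_subspace[OF J(1)]] smul_in_gtens[OF J(1)]) (use that in \<open>auto simp: gtens_def\<close>)
  have id2: "brT z w \<in> gtens J0" if z: "z \<in> gtens J" and w: "w \<in> gtens J" for z w
  proof -
    have exp3: "brT (tens b 1) w = (\<Sum>x\<in>Bg. smul (coord x w) (brT (tens b 1) (tens x 1)))" for b
      by (rule exp2)
    show ?thesis
      unfolding exp[of z w] exp3 smul_sum_right smul_smul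
      by (intro T.subspace_sum[OF gtens_subspace[OF J0_ideal]] smul_in_gtens[OF J0_ideal] sq)
        (use z w in \<open>auto simp: gtens_def\<close>)
  qed
  show "null z"
  proof (rule null_if_abelian_ideal[of "L \<inter> gtens J"])
    show "brT z w \<in> L \<inter> gtens J" if "z \<in> L \<inter> gtens J" "w \<in> L" for z w using that id L_brT by blast
    show "null (brT z w)" if "z \<in> L \<inter> gtens J" "w \<in> L \<inter> gtens J" for z w
      using that id2 L_brT null_gtens_J0 by blast
  qed (use z in auto)
qed

text \<open>
  Hence \<open>J0\<close> is a radical ideal.  Let \<open>s\<^sup>2 \<in> J0\<close> and let \<open>t\<close> be a longest product of conjugates of
  \<open>s\<close> outside of \<open>J0\<close>.  The products of any two conjugates of \<open>t\<close> lie in \<open>J0\<close>, so that \<open>t\<close>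
  lies in a \<open>\<Gamma>\<close>-stable ideal \<open>C \<inter> D\<close> as in the previous lemma.
\<close>

lemma J0_semiprime:
  assumes s: "s * s \<in> J0"
  shows "s \<in> J0"
proof (rule ccontr)
  assume ns: "s \<notin> J0"
  define Q where "Q T \<longleftrightarrow> T \<subseteq> G \<and> (\<Prod>\<gamma>\<in>T. gS \<gamma> s) \<notin> J0" for T
  have "Q {\<one>\<^bsub>\<Gamma>\<^esub>}" unfolding Q_def using ns by (simp add: gS_id)
  moreover have bound: "\<forall>T. Q T \<longrightarrow> card T < Suc (card G)" unfolding Q_def using card_mono[OF \<Gamma>_finite] by (auto simp: le_imp_less_Suc)
  ultimately obtain T where T: "Q T" "\<And>T'. Q T' \<Longrightarrow> card T' \<le> card T"
    using ex_has_greatest_nat[of Q "{\<one>\<^bsub>\<Gamma>\<^esub>}" card] by blast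
  have TG: "T \<subseteq> G" "finite T" using T(1) \<Gamma>_finite finite_subset unfolding Q_def by blast+
  have Tne: "T \<noteq> {}"
  proof
    assume "T = {}"
    then have "card {\<one>\<^bsub>\<Gamma>\<^esub>} \<le> 0" using T(2)[OF \<open>Q {\<one>\<^bsub>\<Gamma>\<^esub>}\<close>] by simp
    then show False by simp
  qed
  define t where "t = (\<Prod>\<gamma>\<in>T. gS \<gamma> s)"
  have tn: "t \<notin> J0" using T(1) unfolding Q_def t_def by blast
  have st: "gS \<gamma> s * t \<in> J0" if \<gamma>: "\<gamma> \<in> G" for \<gamma>
  proof (cases "\<gamma> \<in> T")
    case True
    have "gS \<gamma> s * t = gS \<gamma> (s * s) * (\<Prod>\<gamma>\<in>T - {\<gamma>}. gS \<gamma> s)"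
      unfolding t_def using prod.remove[OF TG(2) True, of "\<lambda>\<gamma>. gS \<gamma> s"] by (simp add: gS_mult[OF \<gamma>] mult.assoc)
    then show ?thesis using ring_ideal_mult_right[OF J0_ideal J0_stable[OF s \<gamma>]] by simp
  next
    case False
    show ?thesis
    proof (rule ccontr)
      assume "gS \<gamma> s * t \<notin> J0"
      then have "Q (insert \<gamma> T)" unfolding Q_def t_def using False TG \<gamma> by simp
      then show False using T(2)[of "insert \<gamma> T"] False TG by simp
    qed
  qed
  have tt: "t * gS \<delta> t \<in> J0" if \<delta>: "\<delta> \<in> G" for \<delta>
  proof -
    obtain \<gamma> where \<gamma>: "\<gamma> \<in> T" using Tne by blast
    then have \<gamma>G: "\<gamma> \<in> G" using TG by blast
    have "gS \<delta> t = gS \<delta> (gS \<gamma> s) * gS \<delta> (\<Prod>\<gamma>\<in>T - {\<gamma>}. gS \<gamma> s)"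
      unfolding t_def using prod.remove[OF TG(2) \<gamma>, of "\<lambda>\<gamma>. gS \<gamma> s"] by (simp add: gS_mult[OF \<delta>])
    then have "t * gS \<delta> t = (gS (\<delta> \<otimes>\<^bsub>\<Gamma>\<^esub> \<gamma>) s * t) * gS \<delta> (\<Prod>\<gamma>\<in>T - {\<gamma>}. gS \<gamma> s)"
      using \<delta> \<gamma>G by (simp add: gS_comp mult_ac)
    then show ?thesis using ring_ideal_mult_right[OF J0_ideal st] \<delta> \<gamma>G by simp
  qed
  \<comment> \<open>\<open>C\<close> annihilates the conjugates of \<open>t\<close> modulo \<open>J0\<close>, and \<open>D\<close> annihilates \<open>C\<close>; so \<open>C \<inter> D\<close> has square zero\<close>
  define C where "C = {u. \<forall>\<delta>\<in>G. u * gS \<delta> t \<in> J0}"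
  define D where "D = {v. \<forall>u\<in>C. v * u \<in> J0}"
  have iC: "ring_ideal C" unfolding C_def ring_ideal_def
    by (auto simp: distrib_right mult.assoc intro: ring_ideal_zero ring_ideal_add ring_ideal_mult J0_ideal)
  have iD: "ring_ideal D" unfolding D_def ring_ideal_def
    by (auto simp: distrib_right mult.assoc intro: ring_ideal_zero ring_ideal_add ring_ideal_mult J0_ideal)
  have sC: "gS \<gamma> u \<in> C" if u: "u \<in> C" and \<gamma>: "\<gamma> \<in> G" for \<gamma> u
    unfolding C_def mem_Collect_eq
  proof
    fix \<delta> assume \<delta>: "\<delta> \<in> G"
    have "u * gS (inv\<^bsub>\<Gamma>\<^esub> \<gamma> \<otimes>\<^bsub>\<Gamma>\<^esub> \<delta>) t \<in> J0" using u \<gamma> \<delta> unfolding C_def by simp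
    from J0_stable[OF this \<gamma>] show "gS \<gamma> u * gS \<delta> t \<in> J0"
      using \<gamma> \<delta> by (simp add: gS_mult gS_comp gS_inv)
  qed
  have sD: "gS \<gamma> v \<in> D" if v: "v \<in> D" and \<gamma>: "\<gamma> \<in> G" for \<gamma> v
    unfolding D_def mem_Collect_eq
  proof
    fix u assume u: "u \<in> C"
    have "v * gS (inv\<^bsub>\<Gamma>\<^esub> \<gamma>) u \<in> J0" using v sC[OF u] \<gamma> unfolding D_def by simp
    from J0_stable[OF this \<gamma>] show "gS \<gamma> v * u \<in> J0" using \<gamma> by (simp add: gS_mult gS_inv)
  qed
  have "C \<inter> D \<subseteq> J0"
  proof (rule J0_square)
    show "ring_ideal (C \<inter> D)" using iC iD unfolding ring_ideal_def by blast
    show "gS \<gamma> x \<in> C \<inter> D" if "\<gamma> \<in> G" "x \<in> C \<inter> D" for \<gamma> x using that sC sD by blast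
    show "a * b \<in> J0" if "a \<in> C \<inter> D" "b \<in> C \<inter> D" for a b using that unfolding D_def by blast
  qed
  moreover have "t \<in> C" unfolding C_def using tt by blast
  moreover have "t \<in> D"
  proof -
    have "u * gS \<one>\<^bsub>\<Gamma>\<^esub> t \<in> J0" if "u \<in> C" for u using that unfolding C_def by blast
    then show ?thesis unfolding D_def by (simp add: gS_id mult.commute)
  qed
  ultimately show False using tn by blast
qed

lemma J0_radical: "s ^ Suc n \<in> J0 \<Longrightarrow> s \<in> J0"
proof (induction n rule: less_induct)
  case (less n)
  show ?case
  proof (cases n)
    case 0
    then show ?thesis using less.prems by simp
  next
    case (Suc m)
    have "s ^ Suc m * s ^ Suc m = s ^ m * s ^ Suc n" unfolding Suc by (simp add: mult_ac)
    then have "s ^ Suc m \<in> J0"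
      using J0_semiprime[of "s ^ Suc m"] ring_ideal_mult[OF J0_ideal less.prems, of "s ^ m"] by metis
    then show ?thesis using less.IH[of m] Suc by simp
  qed
qed

lemma A_J0_iff: "a \<in> A \<Longrightarrow> a \<in> J0 \<longleftrightarrow> (\<forall>z\<in>L. null (smul a z))"
proof
  assume a: "a \<in> A" "a \<in> J0"
  show "\<forall>z\<in>L. null (smul a z)" using null_gtens_J0 smul_L[OF a(1)] smul_in_gtens[OF J0_ideal a(2)] by blast
next
  assume a: "a \<in> A" "\<forall>z\<in>L. null (smul a z)"
  then show "a \<in> J0" unfolding J0_def using trT_L by (simp add: trT_smul)
qed

text \<open>
  The kernel of the representation is an \<open>A\<close>-submodule, because the factor \<open>a\<close> can be moved to the
  other entry of a bracket.
\<close>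

lemma null_smul:
  assumes z: "z \<in> L" "null z" and a: "a \<in> A"
  shows "null (smul a z)"
proof (rule null_if_central[OF smul_L[OF a z(1)]])
  fix w assume w: "w \<in> L"
  have "null (brT z (smul a w))" by (rule null_brT[OF z(1) smul_L[OF a w] z(2)])
  then show "null (brT (smul a z) w)" by (simp add: brT_smul_left brT_smul_right)
qed

text \<open>
  An element of \<open>A\<close> acts on the finite-dimensional image of \<open>L\<close>, and it belongs to \<open>J0\<close> if it acts
  as zero.  So \<open>A / (A \<inter> J0)\<close> is finite-dimensional, which is stated here as a bound on the length
  of families that are independent modulo \<open>J0\<close>.
\<close>

lemma A_mod_J0_finite:
  obtains n :: nat where "\<forall>f. (\<forall>i\<le>n. f i \<in> A) \<longrightarrow> (\<exists>c. (\<exists>i\<le>n. c i \<noteq> 0) \<and> (\<Sum>i\<le>n. sS (c i) (f i)) \<in> J0)"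
proof -
  interpret TV: lin_space_pair sT sV by unfold_locales
  interpret SV: lin_space_pair sS sV by unfold_locales
  obtain B where B: "finite B" "V.independent B" "V.span B = X" by (rule V.fin_dim_basis[OF X_fin_dim])
  have BX: "B \<subseteq> X" using V.span_superset[of B] B(3) by simp
  have nullB: "null z" if z: "z \<in> L" "\<And>v. v \<in> B \<Longrightarrow> \<phi> z v = 0" for z
    unfolding null_def
  proof
    fix v assume v: "v \<in> X"
    have "v \<in> {v \<in> X. \<phi> z v = 0}"
    proof (rule subsetD[OF V.span_minimal])
      show "v \<in> V.span B" using v B by simp
      show "B \<subseteq> {v \<in> X. \<phi> z v = 0}" using BX z by auto
      show "V.subspace {v \<in> X. \<phi> z v = 0}"
        unfolding V.subspace_def using X_subspace V.endo_on_zero[OF \<phi>_endo[OF z(1)] X_subspace]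
        by (auto simp: V.subspace_0 V.subspace_add V.subspace_scale V.endo_on_add[OF \<phi>_endo[OF z(1)]]
            V.endo_on_scale[OF \<phi>_endo[OF z(1)]])
    qed
    then show "\<phi> z v = 0" by simp
  qed
  \<comment> \<open>\<open>F\<close> spans \<open>L\<close> modulo the kernel of the representation; \<open>E\<close> below spans \<open>A\<close> modulo the annihilator of \<open>F\<close>\<close>
  obtain F where F: "finite F" "F \<subseteq> L" "\<And>z. z \<in> L \<Longrightarrow> \<exists>u\<in>T.span F. \<forall>v\<in>B. \<phi> (z - u) v = 0"
  proof (rule TV.common_kernel_finite_codim[OF L_subspace X_fin_dim B(1)])
    show "\<phi> z v \<in> X" if "v \<in> B" "z \<in> L" for v z using that BX V.endo_on_in[OF \<phi>_endo] by blast
    show "\<phi> (x + y) v = \<phi> x v + \<phi> y v" if "v \<in> B" "x \<in> L" "y \<in> L" for v x y using that BX \<phi>_add by blast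
    show "\<phi> (sT c x) v = sV c (\<phi> x v)" if "v \<in> B" "x \<in> L" for v c x using that BX \<phi>_scale by blast
  qed blast
  have FL: "T.span F \<subseteq> L" by (rule T.span_minimal[OF F(2) L_subspace])
  obtain E where E: "finite E" "E \<subseteq> A" "\<And>a. a \<in> A \<Longrightarrow> \<exists>u\<in>S.span E. \<forall>p\<in>F \<times> B. \<phi> (smul (a - u) (fst p)) (snd p) = 0"
  proof (rule SV.common_kernel_finite_codim[OF A_subspace X_fin_dim, of "F \<times> B" "\<lambda>p a. \<phi> (smul a (fst p)) (snd p)"])
    show "finite (F \<times> B)" using F B by simp
    fix p x assume p: "p \<in> F \<times> B" and x: "x \<in> A"
    have fL: "fst p \<in> L" and sX: "snd p \<in> X" using p F(2) BX by auto
    have "smul x (fst p) \<in> L" by (rule smul_L[OF x fL])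
    then show "\<phi> (smul x (fst p)) (snd p) \<in> X" using V.endo_on_in[OF \<phi>_endo] sX by blast
    show "\<phi> (smul (sS c x) (fst p)) (snd p) = sV c (\<phi> (smul x (fst p)) (snd p))" for c
      using smul_L[OF x fL] sX by (simp add: smul_scale_left \<phi>_scale)
    fix y assume y: "y \<in> A"
    show "\<phi> (smul (x + y) (fst p)) (snd p) = \<phi> (smul x (fst p)) (snd p) + \<phi> (smul y (fst p)) (snd p)"
      using smul_L[OF x fL] smul_L[OF y fL] sX by (simp add: smul_add_left \<phi>_add)
  qed blast
  have EA: "S.span E \<subseteq> A" by (rule S.span_minimal[OF E(2) A_subspace])
  have inJ0: "a \<in> J0" if a: "a \<in> A" and k: "\<forall>p\<in>F \<times> B. \<phi> (smul a (fst p)) (snd p) = 0" for a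
    unfolding A_J0_iff[OF a]
  proof
    fix z assume z: "z \<in> L"
    have nF: "null (smul a \<zeta>)" if "\<zeta> \<in> F" for \<zeta>
      by (rule nullB) (use smul_L[OF a] that F(2) k in auto)
    have nspan: "null (smul a u)" if "u \<in> T.span F" for u
    proof -
      have "u \<in> {u \<in> L. null (smul a u)}"
      proof (rule subsetD[OF T.span_minimal that])
        show "F \<subseteq> {u \<in> L. null (smul a u)}" using nF F(2) by auto
        show "T.subspace {u \<in> L. null (smul a u)}"
          unfolding T.subspace_def
          by (auto simp: L_zero L_add L_scale null_zero smul_add_right smul_scale null_add null_scale smul_L[OF a])
      qed
      then show ?thesis by simp
    qed
    obtain u where u: "u \<in> T.span F" "\<forall>v\<in>B. \<phi> (z - u) v = 0" using F(3)[OF z] by blast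
    have uL: "u \<in> L" using u FL by blast
    have zu: "z - u \<in> L" by (rule T.subspace_diff[OF L_subspace z uL])
    have "null (smul a (z - u))" by (rule null_smul[OF zu nullB[OF zu] a]) (use u in auto)
    then have "null (smul a u + smul a (z - u))"
      by (intro null_add smul_L[OF a] uL zu nspan[OF u(1)])
    then show "null (smul a z)" by (simp flip: smul_add_right)
  qed
  show ?thesis
  proof (rule that[of "card E"], intro allI impI)
    fix f assume "\<forall>i\<le>card E. f i \<in> A"
    then have f: "\<And>i. i \<le> card E \<Longrightarrow> f i \<in> A" by blast
    define u where "u i = (SOME u. u \<in> S.span E \<and> (\<forall>p\<in>F \<times> B. \<phi> (smul (f i - u) (fst p)) (snd p) = 0))" for i
    have u: "u i \<in> S.span E" "f i - u i \<in> J0" if "i \<le> card E" for i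
    proof -
      have "\<exists>u. u \<in> S.span E \<and> (\<forall>p\<in>F \<times> B. \<phi> (smul (f i - u) (fst p)) (snd p) = 0)" using E(3)[OF f[OF that]] by blast
      from someI_ex[OF this] have *: "u i \<in> S.span E" "\<forall>p\<in>F \<times> B. \<phi> (smul (f i - u i) (fst p)) (snd p) = 0"
        unfolding u_def by blast+
      show "u i \<in> S.span E" by (rule *(1))
      show "f i - u i \<in> J0" by (rule inJ0[OF A_diff[OF f[OF that] subsetD[OF EA *(1)]] *(2)])
    qed
    obtain c where c: "\<exists>i\<le>card E. c i \<noteq> 0" "(\<Sum>i\<le>card E. sS (c i) (u i)) = 0"
      using S.nontrivial_relation[OF E(1), of u] u(1) by blast
    have "(\<Sum>i\<le>card E. sS (c i) (f i - u i)) \<in> J0"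
      by (intro ring_ideal_sum[OF J0_ideal] ring_ideal_scale[OF J0_ideal] u(2)) simp
    then have "(\<Sum>i\<le>card E. sS (c i) (f i)) \<in> J0"
      using c(2) by (simp add: S.scale_right_diff_distrib sum_subtractf)
    then show "\<exists>c. (\<exists>i\<le>card E. c i \<noteq> 0) \<and> (\<Sum>i\<le>card E. sS (c i) (f i)) \<in> J0" using c(1) by blast
  qed
qed

end

context twisted_module
begin

subsection \<open>Idempotents modulo \<open>J0\<close>\<close>

definition eqv :: "'s \<Rightarrow> 's \<Rightarrow> bool" (infix "\<approx>" 50) where "a \<approx> b \<longleftrightarrow> a - b \<in> J0"

lemma eqv_refl: "a \<approx> a"
  unfolding eqv_def using ring_ideal_zero[OF J0_ideal] by simp

lemma eqv_sym: "a \<approx> b \<Longrightarrow> b \<approx> a"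
  unfolding eqv_def using ring_ideal_minus[OF J0_ideal, of "a - b"] by simp

lemma eqv_trans [trans]: "a \<approx> b \<Longrightarrow> b \<approx> c \<Longrightarrow> a \<approx> c"
  unfolding eqv_def using ring_ideal_add[OF J0_ideal, of "a - b" "b - c"] by simp

lemma eqv_diff: "a \<approx> b \<Longrightarrow> c \<approx> d \<Longrightarrow> a - c \<approx> b - d"
  unfolding eqv_def using ring_ideal_diff[OF J0_ideal, of "a - b" "c - d"] by (simp add: algebra_simps)

lemma eqv_mult_left: "a \<approx> b \<Longrightarrow> c * a \<approx> c * b"
  unfolding eqv_def using ring_ideal_mult[OF J0_ideal, of "a - b" c] by (simp add: algebra_simps)

lemma eqv_mult_right: "a \<approx> b \<Longrightarrow> a * c \<approx> b * c"
  using eqv_mult_left[of a b c] by (simp add: mult.commute)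

lemma eqv_scale: "a \<approx> b \<Longrightarrow> sS c a \<approx> sS c b"
  unfolding eqv_def using ring_ideal_scale[OF J0_ideal, of "a - b" c] by (simp add: S.scale_right_diff_distrib)

lemma eqv_sum: "(\<And>i. i \<in> I \<Longrightarrow> a i \<approx> b i) \<Longrightarrow> (\<Sum>i\<in>I. a i) \<approx> (\<Sum>i\<in>I. b i)"
  unfolding eqv_def sum_subtractf[symmetric] by (rule ring_ideal_sum[OF J0_ideal])

lemma eqv_0: "a \<approx> 0 \<longleftrightarrow> a \<in> J0"
  unfolding eqv_def by simp

lemma eqv_J0: "a \<approx> b \<Longrightarrow> a \<in> J0 \<longleftrightarrow> b \<in> J0"
  using eqv_trans eqv_sym eqv_0 by blast

lemma sS_mult_right: "a * sS c b = sS c (a * b)"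
  by (metis mult.commute sS_mult)

text \<open>
  Orthogonal idempotents of \<open>A\<close> modulo \<open>J0\<close> with sum 1.  They are independent modulo \<open>J0\<close>, so their number is bounded.
\<close>

definition orthogonal_system :: "'s set \<Rightarrow> bool" where
  "orthogonal_system E \<longleftrightarrow> finite E \<and> E \<subseteq> A \<and> E \<inter> J0 = {} \<and> (\<forall>e\<in>E. e * e \<approx> e) \<and>
     (\<forall>e\<in>E. \<forall>f\<in>E. e \<noteq> f \<longrightarrow> e * f \<in> J0) \<and> \<Sum>E \<approx> 1"

lemma orthogonal_system_bound:
  obtains n where "\<forall>E. orthogonal_system E \<longrightarrow> card E \<le> n"
proof -
  obtain n :: nat where n: "\<forall>f. (\<forall>i\<le>n. f i \<in> A) \<longrightarrow> (\<exists>c. (\<exists>i\<le>n. c i \<noteq> 0) \<and> (\<Sum>i\<le>n. sS (c i) (f i)) \<in> J0)"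
    by (rule A_mod_J0_finite)
  have "card E \<le> n" if E: "orthogonal_system E" for E
  proof (rule ccontr)
    assume "\<not> card E \<le> n"
    then have "card {..n} \<le> card E" by simp
    moreover have finE: "finite E" using E unfolding orthogonal_system_def by simp
    ultimately obtain f where f: "inj_on f {..n}" "f ` {..n} \<subseteq> E"
      using card_le_inj[of "{..n}" E] by auto
    then have "\<forall>i\<le>n. f i \<in> A" using E unfolding orthogonal_system_def by blast
    then obtain c where c: "\<exists>i\<le>n. c i \<noteq> 0" "(\<Sum>i\<le>n. sS (c i) (f i)) \<in> J0" using n by blast
    then obtain j where j: "j \<le> n" "c j \<noteq> 0" by blast
    have fj: "f j \<in> E" using f j by auto
    have "f j * (\<Sum>i\<le>n. sS (c i) (f i)) \<in> J0" by (rule ring_ideal_mult[OF J0_ideal c(2)])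
    moreover have "f j * (\<Sum>i\<le>n. sS (c i) (f i)) \<approx> (\<Sum>i\<le>n. if i = j then sS (c j) (f j) else 0)"
      unfolding sum_distrib_left
    proof (rule eqv_sum)
      fix i assume i: "i \<in> {..n}"
      show "f j * sS (c i) (f i) \<approx> (if i = j then sS (c j) (f j) else 0)"
      proof (cases "i = j")
        case True
        then show ?thesis using E fj eqv_scale unfolding orthogonal_system_def by (simp add: sS_mult_right)
      next
        case False
        then have "f j \<noteq> f i" "f i \<in> E" using f i j unfolding inj_on_def by auto
        then have "f j * f i \<in> J0" using E fj unfolding orthogonal_system_def by blast
        then show ?thesis using False ring_ideal_scale[OF J0_ideal] by (simp add: sS_mult_right eqv_0)
      qed
    qed
    ultimately have "(\<Sum>i\<le>n. if i = j then sS (c j) (f j) else 0) \<in> J0" using eqv_J0 by blast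
    then have "sS (c j) (f j) \<in> J0" using j by simp
    then have "sS (inverse (c j)) (sS (c j) (f j)) \<in> J0" by (rule ring_ideal_scale[OF J0_ideal])
    then have "f j \<in> J0" using j by simp
    then show False using E fj unfolding orthogonal_system_def by blast
  qed
  then show ?thesis using that by blast
qed

lemma orthogonal_system_exists: "\<exists>E. orthogonal_system E"
proof (cases "1 \<in> J0")
  case True
  then have "orthogonal_system {}" unfolding orthogonal_system_def using eqv_0 eqv_sym by auto
  then show ?thesis by blast
next
  case False
  then have "orthogonal_system {1}" unfolding orthogonal_system_def using A_one eqv_refl by auto
  then show ?thesis by blast
qed

text \<open>
  In a largest orthogonal system every \<open>a \<in> A\<close> acts on each idempotent \<open>e\<close> as a scalar.  An
  eigenvector \<open>w = q(a) e\<close> of \<open>a\<close> with eigenvalue \<open>c\<close> satisfies \<open>w\<^sup>2 = q(c) w\<close> modulo \<open>J0\<close>, and \<open>q(c) \<noteq> 0\<close>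
  because \<open>J0\<close> is radical.  Thus \<open>w / q(c)\<close> is an idempotent below \<open>e\<close>, hence congruent to \<open>e\<close>.
\<close>

lemma maximal_system_scalar:
  assumes E: "orthogonal_system E" and max: "\<And>E'. orthogonal_system E' \<Longrightarrow> card E' \<le> card E"
    and e: "e \<in> E" and a: "a \<in> A"
  shows "\<exists>c. a * e \<approx> sS c e"
proof -
  have eA: "e \<in> A" and eJ: "e \<notin> J0" and ee: "e * e \<approx> e" using E e unfolding orthogonal_system_def by auto
  have fp: "((*) a ^^ i) e = a ^ i * e" for i by (induction i) (auto simp: mult.assoc)
  have aA: "a ^ i * e \<in> A" for i using a eA by (induction i) (auto simp: mult.assoc A_mult)
  obtain n :: nat where n: "\<forall>f. (\<forall>i\<le>n. f i \<in> A) \<longrightarrow> (\<exists>c. (\<exists>i\<le>n. c i \<noteq> 0) \<and> (\<Sum>i\<le>n. sS (c i) (f i)) \<in> J0)"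
    by (rule A_mod_J0_finite)
  obtain r where r: "\<exists>i\<le>n. r i \<noteq> 0" "(\<Sum>i\<le>n. sS (r i) (a ^ i * e)) \<in> J0"
    using n[THEN spec, of "\<lambda>i. a ^ i * e"] aA by blast
  have end_a: "S.endo_on A ((*) a)"
    unfolding S.endo_on_def using A_mult[OF a] by (simp add: distrib_left sS_mult_right)
  obtain c q where w: "S.poly_op ((*) a) q e \<notin> J0"
    "a * S.poly_op ((*) a) q e - sS c (S.poly_op ((*) a) q e) \<in> J0"
    by (rule eigenvector_mod[OF S.lin_space_axioms end_a A_subspace eA eJ ring_ideal_subspace[OF J0_ideal] r(1)])
      (use r(2) in \<open>simp add: fp\<close>)
  define w where "w = S.poly_op ((*) a) q e"
  have wJ: "w \<notin> J0" and aw: "a * w \<approx> sS c w" using w unfolding w_def eqv_def by auto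
  have wA: "w \<in> A" unfolding w_def by (rule S.poly_op_in[OF end_a A_subspace eA])
  have w_exp: "w = (\<Sum>i\<le>degree q. sS (coeff q i) (a ^ i * e))" unfolding w_def S.poly_op_def fp ..
  have we: "w * e \<approx> w"
  proof -
    have "w * e = (\<Sum>i\<le>degree q. sS (coeff q i) (a ^ i * (e * e)))"
      unfolding w_exp sum_distrib_right by (simp add: sS_mult[symmetric] mult.assoc)
    also have "\<dots> \<approx> w" unfolding w_exp by (intro eqv_sum eqv_scale eqv_mult_left ee)
    finally show ?thesis .
  qed
  have aiw: "a ^ i * w \<approx> sS (c ^ i) w" for i
  proof (induction i)
    case (Suc i)
    have "a ^ Suc i * w = a * (a ^ i * w)" by (simp add: mult.assoc)
    also have "\<dots> \<approx> a * sS (c ^ i) w" by (rule eqv_mult_left[OF Suc])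
    also have "a * sS (c ^ i) w = sS (c ^ i) (a * w)" by (rule sS_mult_right)
    also have "\<dots> \<approx> sS (c ^ i) (sS c w)" by (rule eqv_scale[OF aw])
    finally show ?case by (simp add: mult.commute)
  qed (simp add: eqv_refl)
  define d where "d = poly q c"
  have ww: "w * w \<approx> sS d w"
  proof -
    have "w * w = (\<Sum>i\<le>degree q. sS (coeff q i) (a ^ i * (w * e)))"
    proof -
      have "w * w = (\<Sum>i\<le>degree q. sS (coeff q i) (a ^ i * e)) * w" by (simp only: w_exp[symmetric])
      also have "\<dots> = (\<Sum>i\<le>degree q. sS (coeff q i) (a ^ i * (w * e)))"
        unfolding sum_distrib_right by (rule sum.cong) (simp_all add: sS_mult[symmetric] sS_mult_right mult_ac)
      finally show ?thesis .
    qed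
    also have "\<dots> \<approx> (\<Sum>i\<le>degree q. sS (coeff q i) (a ^ i * w))"
      by (intro eqv_sum eqv_scale eqv_mult_left we)
    also have "\<dots> \<approx> (\<Sum>i\<le>degree q. sS (coeff q i) (sS (c ^ i) w))"
      by (intro eqv_sum eqv_scale aiw)
    also have "\<dots> = sS d w" unfolding d_def poly_altdef by (simp add: S.scale_sum_left)
    finally show ?thesis .
  qed
  have d0: "d \<noteq> 0"
  proof
    assume "d = 0"
    then have "w * w \<in> J0" using ww eqv_0 by simp
    then show False using J0_semiprime wJ by blast
  qed
  define f where "f = sS (inverse d) w"
  have fA: "f \<in> A" unfolding f_def by (rule A_scale[OF wA])
  have wf: "w = sS d f" unfolding f_def using d0 by simp
  have fJ: "f \<notin> J0" using wJ ring_ideal_scale[OF J0_ideal, of f d] wf by auto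
  have fe: "f * e \<approx> f" using eqv_scale[OF we, of "inverse d"] unfolding f_def by (simp add: sS_mult)
  have ff: "f * f \<approx> f"
  proof -
    have "f * f = sS (inverse d * inverse d) (w * w)" unfolding f_def by (simp add: sS_mult[symmetric] sS_mult_right)
    also have "\<dots> \<approx> sS (inverse d * inverse d) (sS d w)" by (rule eqv_scale[OF ww])
    also have "\<dots> = f" unfolding f_def using d0 by simp
    finally show ?thesis .
  qed
  have af: "a * f \<approx> sS c f"
  proof -
    have "a * f = sS (inverse d) (a * w)" unfolding f_def by (rule sS_mult_right)
    also have "\<dots> \<approx> sS (inverse d) (sS c w)" by (rule eqv_scale[OF aw])
    also have "\<dots> = sS c f" unfolding f_def by (simp add: mult.commute)
    finally show ?thesis .
  qed
  \<comment> \<open>otherwise replacing \<open>e\<close> by \<open>f\<close> and \<open>e - f\<close> gives a larger orthogonal system\<close>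
  have "e - f \<in> J0"
  proof (rule ccontr)
    assume efJ: "e - f \<notin> J0"
    let ?h = "e - f"
    have hA: "?h \<in> A" by (rule A_diff[OF eA fA])
    have fh: "f * ?h \<in> J0" using eqv_diff[OF fe ff] eqv_0 by (simp add: algebra_simps)
    have he: "?h * e \<approx> ?h" using eqv_diff[OF ee fe] by (simp add: algebra_simps)
    have hh: "?h * ?h \<approx> ?h"
    proof -
      have "?h * ?h = ?h * e - f * ?h" by (simp add: algebra_simps)
      also have "\<dots> \<approx> ?h - 0" by (rule eqv_diff[OF he]) (use fh eqv_0 in simp)
      finally show ?thesis by simp
    qed
    have orth: "x * g \<in> J0" if "x = f \<or> x = ?h" "g \<in> E" "g \<noteq> e" for x g
    proof -
      have "e * g \<in> J0" using E e that(2,3) unfolding orthogonal_system_def by metis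
      then have 1: "x * (e * g) \<in> J0" by (rule ring_ideal_mult[OF J0_ideal])
      have "x * e \<approx> x" using that fe he by blast
      then have "x * e * g \<approx> x * g" by (rule eqv_mult_right)
      then show ?thesis using 1 eqv_J0 by (simp add: mult.assoc)
    qed
    have fne: "f \<noteq> ?h"
    proof
      assume "f = ?h"
      then have "f * f \<in> J0" using fh by simp
      then show False using J0_semiprime fJ by blast
    qed
    have new: "x \<notin> E - {e}" if "x = f \<or> x = ?h" for x
      using orth[OF that, of x] J0_semiprime[of x] that fJ efJ by blast
    then have new: "f \<notin> E - {e}" "?h \<notin> E - {e}" by blast+
    let ?E = "insert f (insert ?h (E - {e}))"
    have finE: "finite E" using E unfolding orthogonal_system_def by blast
    have "orthogonal_system ?E"
      unfolding orthogonal_system_def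
    proof (intro conjI ballI impI)
      show "finite ?E" using finE by simp
      show "?E \<subseteq> A" using E fA hA unfolding orthogonal_system_def by auto
      show "?E \<inter> J0 = {}" using E fJ efJ unfolding orthogonal_system_def by auto
      show "x * x \<approx> x" if "x \<in> ?E" for x using that ff hh E unfolding orthogonal_system_def by auto
      show "x * y \<in> J0" if xy: "x \<in> ?E" "y \<in> ?E" "x \<noteq> y" for x y
      proof -
        have hf: "?h * f \<in> J0" using fh by (simp add: mult.commute)
        have orth': "g * x \<in> J0" if "x = f \<or> x = ?h" "g \<in> E" "g \<noteq> e" for x g
          using orth[OF that] by (simp add: mult.commute)
        have EE: "g * g' \<in> J0" if "g \<in> E" "g' \<in> E" "g \<noteq> g'" for g g'
          using E that unfolding orthogonal_system_def by blast
        have "x = f \<or> x = ?h \<or> x \<in> E - {e}" "y = f \<or> y = ?h \<or> y \<in> E - {e}"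
          using xy(1,2) by (simp_all only: insert_iff)
        then consider "x = f" "y = ?h" | "x = ?h" "y = f" | "x = f \<or> x = ?h" "y \<in> E - {e}"
          | "x \<in> E - {e}" "y = f \<or> y = ?h" | "x \<in> E - {e}" "y \<in> E - {e}" using xy(3) by metis
        then show ?thesis by cases (use fh hf orth orth' EE xy in auto)
      qed
      have "\<Sum>?E = f + (?h + \<Sum>(E - {e}))" using new fne finE by (subst sum.insert, simp, force)+ simp
      also have "\<dots> = \<Sum>E" using sum.remove[OF finE e, of "\<lambda>x. x"] by simp
      finally show "\<Sum>?E \<approx> 1" using E unfolding orthogonal_system_def by simp
    qed
    moreover have "card ?E = Suc (card E)"
    proof -
      have "card ?E = Suc (Suc (card (E - {e})))" using new fne finE by simp
      then show ?thesis using card_Suc_Diff1[OF finE e] by simp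
    qed
    ultimately show False using max[of ?E] by simp
  qed
  then have ef: "e \<approx> f" unfolding eqv_def .
  have "a * e \<approx> a * f" by (rule eqv_mult_left[OF ef])
  also have "\<dots> \<approx> sS c f" by (rule af)
  also have "\<dots> \<approx> sS c e" by (rule eqv_scale[OF eqv_sym[OF ef]])
  finally show ?thesis by blast
qed

subsection \<open>Points of the spectrum\<close>

text \<open>
  A point of the spectrum of \<open>S\<close> above the character by which \<open>A\<close> acts on \<open>e\<close>.  The kernel of the
  character generates a proper ideal of \<open>S\<close>, by averaging over \<open>\<Gamma>\<close>; a maximal ideal \<open>M\<close> containing
  it is prime.  Modulo \<open>M\<close> every \<open>s \<in> S\<close> is a root of a monic polynomial over the algebraically
  closed ground field, since \<open>S\<close> is integral over \<open>A\<close>; so \<open>s\<close> is congruent to a scalar.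
\<close>

lemma exists_point:
  assumes sc: "\<And>a. a \<in> A \<Longrightarrow> \<exists>c. a * e \<approx> sS c e" and e: "e \<notin> J0" "e \<in> A"
  obtains M where "rational_point M" "\<And>a. a \<in> A \<Longrightarrow> a \<in> M \<longleftrightarrow> a * e \<in> J0"
proof -
  \<comment> \<open>a proper ideal that contains the kernel of the character and is defined without choosing generators\<close>
  define I where "I = {s. \<forall>t. trS (t * s) * e \<in> J0}"
  have trS_add: "trS (s + t) = trS s + trS t" for s t
    unfolding trS_def by (simp add: gS_add sum.distrib)
  have trS0: "trS 0 = 0" unfolding trS_def by (simp add: gS_zero)
  have iI: "ring_ideal I"
    unfolding ring_ideal_def I_def mem_Collect_eq
    by (auto simp: trS0 distrib_left distrib_right trS_add ring_ideal_zero[OF J0_ideal] ring_ideal_add[OF J0_ideal]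
        simp flip: mult.assoc)
  have mI: "a \<in> I" if a: "a \<in> A" "a * e \<in> J0" for a
    unfolding I_def mem_Collect_eq
  proof
    fix t
    have "trS (t * a) * e = trS t * (a * e)" using trS_mult[OF a(1), of t] by (simp add: mult_ac)
    then show "trS (t * a) * e \<in> J0" using ring_ideal_mult[OF J0_ideal a(2)] by simp
  qed
  have oneI: "1 \<notin> I"
  proof
    assume "1 \<in> I"
    then have "trS (1 * 1) * e \<in> J0" unfolding I_def by blast
    then have "sS (of_nat (card G)) e \<in> J0" using trS_fixed[OF A_one] sS_mult[of _ 1 e] by simp
    then have "sS (inverse (of_nat (card G))) (sS (of_nat (card G)) e) \<in> J0" by (rule ring_ideal_scale[OF J0_ideal])
    then show False using e card_G by simp
  qed
  define \<F> where "\<F> = {K. ring_ideal K \<and> I \<subseteq> K \<and> 1 \<notin> K}"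
  have "\<exists>M\<in>\<F>. \<forall>K\<in>\<F>. M \<subseteq> K \<longrightarrow> K = M"
  proof (rule subset_Zorn_nonempty)
    show "\<F> \<noteq> {}" unfolding \<F>_def using iI oneI by blast
    fix C assume C: "C \<noteq> {}" "subset.chain \<F> C"
    then have CF: "C \<subseteq> \<F>" and ch: "\<And>K K'. K \<in> C \<Longrightarrow> K' \<in> C \<Longrightarrow> K \<subseteq> K' \<or> K' \<subseteq> K"
      unfolding subset_chain_def by blast+
    have "ring_ideal (\<Union>C)"
      unfolding ring_ideal_def
    proof (intro conjI ballI allI)
      show "0 \<in> \<Union>C" using C(1) CF ring_ideal_zero unfolding \<F>_def by blast
      show "r * a \<in> \<Union>C" if "a \<in> \<Union>C" for r a using that CF ring_ideal_mult unfolding \<F>_def by blast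
      fix a b assume "a \<in> \<Union>C" "b \<in> \<Union>C"
      then obtain K K' where K: "K \<in> C" "K' \<in> C" "a \<in> K" "b \<in> K'" by blast
      show "a + b \<in> \<Union>C"
      proof (cases "K \<subseteq> K'")
        case True
        then have "a + b \<in> K'" using K CF ring_ideal_add unfolding \<F>_def by blast
        then show ?thesis using K by blast
      next
        case False
        then have "K' \<subseteq> K" using ch K by blast
        then have "a + b \<in> K" using K CF ring_ideal_add unfolding \<F>_def by blast
        then show ?thesis using K by blast
      qed
    qed
    then show "\<Union>C \<in> \<F>" using C(1) CF unfolding \<F>_def by blast
  qed
  then obtain M where M: "M \<in> \<F>" "\<And>K. K \<in> \<F> \<Longrightarrow> M \<subseteq> K \<Longrightarrow> K = M" by blast
  have iM: "ring_ideal M" and IM: "I \<subseteq> M" and oneM: "1 \<notin> M" using M(1) unfolding \<F>_def by auto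
  have prime: "t \<in> M" if st: "s * t \<in> M" and s: "s \<notin> M" for s t
  proof -
    let ?K = "{x + r * s | x r. x \<in> M}"
    have "ring_ideal ?K"
      unfolding ring_ideal_def
    proof (intro conjI ballI allI)
      have "0 = 0 + 0 * s" by simp
      then show "0 \<in> ?K" using ring_ideal_zero[OF iM] by blast
    next
      fix a b assume "a \<in> ?K" "b \<in> ?K"
      then obtain x r y q where "a = x + r * s" "x \<in> M" "b = y + q * s" "y \<in> M" by blast
      then have "a + b = (x + y) + (r + q) * s" "x + y \<in> M" using ring_ideal_add[OF iM] by (auto simp: algebra_simps)
      then show "a + b \<in> ?K" by blast
    next
      fix a q assume "a \<in> ?K"
      then obtain x r where "a = x + r * s" "x \<in> M" by blast
      then have "q * a = q * x + (q * r) * s" "q * x \<in> M" using ring_ideal_mult[OF iM, of x q] by (simp_all add: distrib_left mult.assoc)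
      then show "q * a \<in> ?K" by blast
    qed
    moreover have sub: "M \<subseteq> ?K"
    proof
      fix x assume "x \<in> M"
      then have "x = x + 0 * s" "x \<in> M" by auto
      then show "x \<in> ?K" by blast
    qed
    moreover have "s \<in> ?K"
    proof -
      have "s = 0 + 1 * s" by simp
      then show ?thesis using ring_ideal_zero[OF iM] by blast
    qed
    ultimately have "1 \<in> ?K" using M(2)[of ?K] s IM unfolding \<F>_def by blast
    then obtain x r where "1 = x + r * s" "x \<in> M" by blast
    then have "t = x * t + r * (s * t)" by (metis distrib_right mult.assoc mult_1)
    moreover have "x * t + r * (s * t) \<in> M"
      using ring_ideal_add[OF iM ring_ideal_mult_right[OF iM \<open>x \<in> M\<close>] ring_ideal_mult[OF iM st]] .
    ultimately show ?thesis by simp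
  qed
  have scM: "a - sS c 1 \<in> M" if a: "a \<in> A" and c: "a * e \<approx> sS c e" for a c
  proof -
    have "(a - sS c 1) * e = a * e - sS c e" using sS_mult[of c 1 e] by (simp add: left_diff_distrib)
    then have "(a - sS c 1) * e \<in> J0" using c unfolding eqv_def by simp
    then have "a - sS c 1 \<in> I" by (intro mI A_diff A_scale A_one a)
    then show ?thesis using IM by blast
  qed
  have MA: "a \<in> M \<longleftrightarrow> a * e \<in> J0" if a: "a \<in> A" for a
  proof
    assume "a * e \<in> J0"
    then show "a \<in> M" using mI a IM by blast
  next
    assume aM: "a \<in> M"
    obtain c where c: "a * e \<approx> sS c e" using sc a by blast
    have "a - (a - sS c 1) \<in> M" by (rule ring_ideal_diff[OF iM aM scM[OF a c]])
    then have cM: "sS c 1 \<in> M" by simp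
    have "c = 0"
    proof (rule ccontr)
      assume "c \<noteq> 0"
      then have "1 \<in> M" using ring_ideal_scale[OF iM cM, of "inverse c"] by simp
      then show False using oneM by blast
    qed
    then show "a * e \<in> J0" using c eqv_0 by simp
  qed
  have "\<exists>c. s - sS c 1 \<in> M" for s
  proof -
    let ?n = "card G"
    have "\<exists>c. esym s j - sS c 1 \<in> M" for j using sc[OF esym_A] scM[OF esym_A] by blast
    then obtain c where c: "\<And>j. esym s j - sS (c j) 1 \<in> M" by metis
    have c0: "c 0 \<noteq> 0" using c[of 0] oneM by (auto simp: esym_0)
    have "(\<Sum>j\<le>?n. s ^ (?n - j) * (esym s j - sS (c j) 1)) \<in> M"
      by (rule ring_ideal_sum[OF iM ring_ideal_mult[OF iM c]])
    then have "(\<Sum>j\<le>?n. s ^ (?n - j) * esym s j) - (\<Sum>j\<le>?n. s ^ (?n - j) * (esym s j - sS (c j) 1)) \<in> M"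
      using integral_relation[of s] ring_ideal_minus[OF iM] by simp
    moreover have "(\<Sum>j\<le>?n. s ^ (?n - j) * esym s j) - (\<Sum>j\<le>?n. s ^ (?n - j) * (esym s j - sS (c j) 1)) =
       (\<Sum>j\<le>?n. sS (c j) (s ^ (?n - j)))"
      unfolding sum_subtractf[symmetric] by (simp add: right_diff_distrib sS_mult_right)
    moreover have "(\<Sum>j\<le>?n. sS (c j) (s ^ (?n - j))) = (\<Sum>i\<le>?n. sS (c (?n - i)) (s ^ i))"
      by (rule sum.reindex_bij_witness[of _ "\<lambda>i. ?n - i" "\<lambda>i. ?n - i"]) auto
    ultimately have rel: "(\<Sum>i\<le>?n. sS (c (?n - i)) (s ^ i)) \<in> M" by simp
    have fp: "((*) s ^^ i) 1 = s ^ i" for i by (induction i) auto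
    have end_s: "S.endo_on UNIV ((*) s)"
      unfolding S.endo_on_def by (simp add: distrib_left sS_mult_right)
    have nz: "\<exists>i\<le>?n. c (?n - i) \<noteq> 0" using c0 by (intro exI[of _ ?n]) simp
    obtain x q where w: "S.poly_op ((*) s) q 1 \<notin> M" "s * S.poly_op ((*) s) q 1 - sS x (S.poly_op ((*) s) q 1) \<in> M"
      by (rule eigenvector_mod[OF S.lin_space_axioms end_s S.subspace_UNIV UNIV_I oneM ring_ideal_subspace[OF iM] nz])
        (use rel in \<open>simp add: fp\<close>)
    let ?w = "S.poly_op ((*) s) q 1"
    have "?w * (s - sS x 1) = s * ?w - sS x ?w" by (simp add: right_diff_distrib sS_mult_right mult.commute[of _ s])
    then have "?w * (s - sS x 1) \<in> M" using w(2) by simp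
    then show ?thesis using prime w(1) by blast
  qed
  then have "rational_point M" unfolding rational_point_def using iM oneM by blast
  then show ?thesis using that MA by blast
qed

text \<open>
  An invariant that vanishes at \<open>M\<close> vanishes on the whole orbit of \<open>M\<close>.  Hence the conjugates of its
  coordinates \<open>s\<close> lie in \<open>M\<close>, multiplication by \<open>e\<close> takes their symmetric functions into \<open>J0\<close>, and the integral
  relation gives \<open>e s\<^sup>n \<in> J0\<close> for the order \<open>n\<close> of \<open>\<Gamma>\<close>.  As \<open>J0\<close> is radical, \<open>e s \<in> J0\<close>.
\<close>

lemma null_at_point:
  assumes M: "rational_point M" and MA: "\<And>a. a \<in> A \<Longrightarrow> a \<in> M \<longleftrightarrow> a * e \<in> J0" and e: "e \<in> A"
    and z: "z \<in> L" "ev M z = 0"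
  shows "null (smul e z)"
proof (rule null_gtens_J0[OF smul_L[OF e z(1)]])
  note iM = rational_pointD(1)[OF M]
  have zM: "z \<in> gtens M" using z(2) by (simp add: ev_eq_0[OF M])
  show "smul e z \<in> gtens J0"
    unfolding gtens_def mem_Collect_eq
  proof
    fix b assume b: "b \<in> Bg"
    let ?s = "coord b z" and ?n = "card G"
    have gM: "gS \<gamma> ?s \<in> M" if \<gamma>: "\<gamma> \<in> G" for \<gamma>
    proof -
      have i: "inv\<^bsub>\<Gamma>\<^esub> \<gamma> \<in> G" using \<gamma> by simp
      have "z \<in> gtens (gS (inv\<^bsub>\<Gamma>\<^esub> \<gamma>) ` M)" using act_gtens[OF i iM zM] z(1) i unfolding L_iff by simp
      then have "?s \<in> gS (inv\<^bsub>\<Gamma>\<^esub> \<gamma>) ` M" using b unfolding gtens_def by blast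
      then show ?thesis using gS_inv(1)[OF \<gamma>] by auto
    qed
    have es: "esym ?s j * e \<in> J0" if "j \<noteq> 0" for j
      using MA[OF esym_A] esym_in_ideal[OF iM gM that] by blast
    have "0 = e * (\<Sum>j\<le>?n. ?s ^ (?n - j) * esym ?s j)" using integral_relation by simp
    also have "\<dots> = e * ?s ^ ?n + (\<Sum>j\<in>{..?n} - {0}. ?s ^ (?n - j) * (esym ?s j * e))"
      unfolding sum.remove[of "{..?n}" 0, OF finite_atMost, simplified]
      by (simp add: esym_0 distrib_left sum_distrib_left mult_ac)
    finally have "e * ?s ^ ?n = - (\<Sum>j\<in>{..?n} - {0}. ?s ^ (?n - j) * (esym ?s j * e))"
      by (simp add: eq_neg_iff_add_eq_0)
    moreover have "- (\<Sum>j\<in>{..?n} - {0}. ?s ^ (?n - j) * (esym ?s j * e)) \<in> J0"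
      by (intro ring_ideal_minus[OF J0_ideal] ring_ideal_sum[OF J0_ideal] ring_ideal_mult[OF J0_ideal] es) simp
    ultimately have esn: "e * ?s ^ ?n \<in> J0" by simp
    obtain m where m: "?n = Suc m" using card_G not0_implies_Suc by blast
    have "(e * ?s) ^ Suc m = e ^ m * (e * ?s ^ ?n)" unfolding m power_mult_distrib by (simp add: mult_ac)
    then have "(e * ?s) ^ Suc m \<in> J0" using ring_ideal_mult[OF J0_ideal esn] by simp
    then have "e * ?s \<in> J0" by (rule J0_radical)
    then show "coord b (smul e z) \<in> J0" by (simp add: coord_smul[OF b])
  qed
qed

text \<open>
  The points above different idempotents lie in different orbits: \<open>e'\<close> is an invariant element of
  \<open>S\<close> that belongs to \<open>M e\<close> but to no conjugate of \<open>M e'\<close>.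
\<close>

lemma orthogonal_points:
  obtains E M where "orthogonal_system E" "\<And>e. e \<in> E \<Longrightarrow> rational_point (M e)"
    "\<And>e e' \<gamma>. e \<in> E \<Longrightarrow> e' \<in> E \<Longrightarrow> e \<noteq> e' \<Longrightarrow> \<gamma> \<in> G \<Longrightarrow> M e \<noteq> gS \<gamma> ` M e'"
    "\<And>e z. e \<in> E \<Longrightarrow> z \<in> L \<Longrightarrow> ev (M e) z = 0 \<Longrightarrow> null (smul e z)"
proof -
  obtain n where n: "\<forall>E. orthogonal_system E \<longrightarrow> card E \<le> n" by (rule orthogonal_system_bound)
  obtain E0 where E0: "orthogonal_system E0" using orthogonal_system_exists by blast
  have "\<forall>E. orthogonal_system E \<longrightarrow> card E < Suc n" using n by (simp add: le_imp_less_Suc)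
  then obtain E where E: "orthogonal_system E" "\<And>E'. orthogonal_system E' \<Longrightarrow> card E' \<le> card E"
    using ex_has_greatest_nat[of orthogonal_system E0 card, OF E0] by blast
  have EA: "e \<in> A" "e \<notin> J0" if "e \<in> E" for e using E(1) that unfolding orthogonal_system_def by blast+
  have ex: "\<exists>M. rational_point M \<and> (\<forall>a\<in>A. a \<in> M \<longleftrightarrow> a * e \<in> J0)" if "e \<in> E" for e
    using exists_point[OF maximal_system_scalar[OF E that] EA(2,1)[OF that]] by metis
  define M where "M e = (SOME M. rational_point M \<and> (\<forall>a\<in>A. a \<in> M \<longleftrightarrow> a * e \<in> J0))" for e
  have M: "rational_point (M e)" "\<And>a. a \<in> A \<Longrightarrow> a \<in> M e \<longleftrightarrow> a * e \<in> J0" if "e \<in> E" for e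
    using someI_ex[OF ex[OF that]] unfolding M_def by blast+
  show ?thesis
  proof (rule that[OF E(1) M(1)])
    show "M e \<noteq> gS \<gamma> ` M e'" if e: "e \<in> E" "e' \<in> E" "e \<noteq> e'" and \<gamma>: "\<gamma> \<in> G" for e e' \<gamma>
    proof
      assume eq: "M e = gS \<gamma> ` M e'"
      have "e' * e \<in> J0" using E(1) e unfolding orthogonal_system_def by metis
      then have "e' \<in> M e" by (simp add: M(2)[OF e(1) EA(1)[OF e(2)]])
      then have "e' \<in> gS \<gamma> ` M e'" by (simp only: eq)
      then obtain m where m: "e' = gS \<gamma> m" "m \<in> M e'" by (rule imageE)
      have "m = gS (inv\<^bsub>\<Gamma>\<^esub> \<gamma>) e'" using m(1) gS_inv(2)[OF \<gamma>] by simp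
      also have "\<dots> = e'" using EA(1)[OF e(2)] \<gamma> unfolding A_def by simp
      finally have "e' * e' \<in> J0" using m(2) M(2)[OF e(2) EA(1)[OF e(2)]] by simp
      from J0_semiprime[OF this] show False using EA(2)[OF e(2)] by simp
    qed
    show "null (smul e z)" if "e \<in> E" "z \<in> L" "ev (M e) z = 0" for e z
      by (rule null_at_point[OF M(1)[OF that(1)] M(2)[OF that(1)] EA(1)[OF that(1)] that(2,3)])
  qed
qed

end

section \<open>Decomposition of irreducible modules\<close>

lemma simple_lie_moduleD:
  assumes "simple_lie_module sL br L s V \<rho>"
  shows "lie_module sL br L s V \<rho>" "V \<noteq> {0}"
    "\<And>U. module.subspace s U \<Longrightarrow> U \<subseteq> V \<Longrightarrow> (\<And>x u. x \<in> L \<Longrightarrow> u \<in> U \<Longrightarrow> \<rho> x u \<in> U) \<Longrightarrow> U = {0} \<or> U = V"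
  using assms unfolding simple_lie_module_def by blast+

lemma (in lin_space) lie_moduleI:
  assumes "subspace V" "\<And>x. x \<in> L \<Longrightarrow> endo_on V (\<rho> x)"
    and "\<And>x y v. x \<in> L \<Longrightarrow> y \<in> L \<Longrightarrow> v \<in> V \<Longrightarrow> \<rho> (x + y) v = \<rho> x v + \<rho> y v"
    and "\<And>c x v. x \<in> L \<Longrightarrow> v \<in> V \<Longrightarrow> \<rho> (sL c x) v = scale c (\<rho> x v)"
    and "\<And>x y v. x \<in> L \<Longrightarrow> y \<in> L \<Longrightarrow> v \<in> V \<Longrightarrow> \<rho> (br x y) v = \<rho> x (\<rho> y v) - \<rho> y (\<rho> x v)"
  shows "lie_module sL br L scale V \<rho>"
  unfolding lie_module_def using assms vector_space_axioms unfolding endo_on_def by blast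

lemma lie_module_cong:
  assumes mod: "lie_module sL br L s V \<rho>" and L: "\<And>x y. x \<in> L \<Longrightarrow> y \<in> L \<Longrightarrow> x + y \<in> L"
      "\<And>c x. x \<in> L \<Longrightarrow> sL c x \<in> L" "\<And>x y. x \<in> L \<Longrightarrow> y \<in> L \<Longrightarrow> br x y \<in> L"
    and eq: "\<And>x v. x \<in> L \<Longrightarrow> v \<in> V \<Longrightarrow> \<rho>' x v = \<rho> x v"
  shows "lie_module sL br L s V \<rho>'"
proof -
  interpret V: lin_space s using mod unfolding lie_module_def lin_space_def by blast
  have sV: "V.subspace V" and inV: "\<And>x v. x \<in> L \<Longrightarrow> v \<in> V \<Longrightarrow> \<rho> x v \<in> V" using mod unfolding lie_module_def by blast+
  show ?thesis
    using mod unfolding lie_module_def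
    by (simp add: eq L inV V.subspace_add[OF sV] V.subspace_scale[OF sV] cong: ball_cong)
qed

text \<open>
  Used for evaluation at a point \<open>M\<close> as \<open>\<epsilon>\<close>: it is onto, so that every element of \<open>\<gg>\<^sup>M\<close> acts through an
  element of \<open>L\<close>.
\<close>

lemma (in lin_space) simple_module_over_image:
  assumes mod: "lie_module sL brL L scale V \<rho>" and irr: "irreducible_on V (\<rho> ` L)"
    and L: "\<And>x y. x \<in> L \<Longrightarrow> y \<in> L \<Longrightarrow> x + y \<in> L"
      "\<And>c x. x \<in> L \<Longrightarrow> sL c x \<in> L" "\<And>x y. x \<in> L \<Longrightarrow> y \<in> L \<Longrightarrow> brL x y \<in> L"
    and \<epsilon>: "\<And>x y. \<epsilon> (x + y) = \<epsilon> x + \<epsilon> y" "\<And>c x. \<epsilon> (sL c x) = sF c (\<epsilon> x)"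
      "\<And>x y. \<epsilon> (brL x y) = brF (\<epsilon> x) (\<epsilon> y)" "\<epsilon> ` L = F"
    and \<sigma>: "\<And>x v. x \<in> L \<Longrightarrow> v \<in> V \<Longrightarrow> \<sigma> (\<epsilon> x) v = \<rho> x v"
  shows "simple_lie_module sF brF F scale V \<sigma>"
proof -
  have sV: "subspace V" using irr unfolding irreducible_on_def by blast
  have inV: "\<rho> x v \<in> V" if "x \<in> L" "v \<in> V" for x v using mod that unfolding lie_module_def by blast
  have "lie_module sF brF F scale V \<sigma>"
    using mod unfolding lie_module_def \<epsilon>(4)[symmetric] ball_simps(9)
    by (simp add: \<sigma> L inV subspace_add[OF sV] subspace_scale[OF sV] flip: \<epsilon>(1-3) cong: ball_cong)
  moreover have "U = {0} \<or> U = V" if U: "subspace U" "U \<subseteq> V" "\<forall>x\<in>F. \<forall>u\<in>U. \<sigma> x u \<in> U" for U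
  proof -
    have "\<rho> x u \<in> U" if "x \<in> L" "u \<in> U" for x u
      using U that \<sigma>[of x u] \<epsilon>(4) by (metis image_eqI subsetD)
    then show ?thesis using irr U unfolding irreducible_on_def by blast
  qed
  ultimately show ?thesis using irr unfolding simple_lie_module_def irreducible_on_def by blast
qed

lemma (in lin_space) irreducible_under_scalars_dim:
  assumes irr: "irreducible_on V P" and P: "\<And>p. p \<in> P \<Longrightarrow> \<exists>c. p = scale c"
  shows "dim V = 1"
proof -
  obtain w where w: "w \<in> V" "w \<noteq> 0" by (rule irreducible_on_nonzero[OF irr])
  have wU: "w \<in> span {w}" by (rule span_base) simp
  have "span {w} = V"
  proof (rule irreducible_onD[OF irr _ _ _ wU w(2)])
    show "span {w} \<subseteq> V" by (rule span_minimal) (use w irr irreducible_on_def in auto)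
    show "p u \<in> span {w}" if "p \<in> P" "u \<in> span {w}" for p u
      using P[OF that(1)] span_scale[OF that(2)] by auto
  qed simp
  then have "dim V = dim {w}" using dim_span by metis
  also have "\<dots> = 1" using dim_eq_card_independent[of "{w}"] w(2) by simp
  finally show ?thesis .
qed

text \<open>
  The trace divided by the dimension is a character, since commutators have trace zero.  After
  subtracting it all operators have trace zero, and a scalar of trace zero is zero in
  characteristic zero.
\<close>

lemma (in twisted_algebra) traceless_twist:
  assumes simple: "simple_lie_module sT brT L sV X \<phi>" and X: "fin_dim sV X"
  obtains \<chi> where "\<forall>z\<in>L. \<forall>w\<in>L. \<chi> (z + w) = \<chi> z + \<chi> w"
    "\<forall>c. \<forall>z\<in>L. \<chi> (sT c z) = c * \<chi> z" "\<forall>z\<in>L. \<forall>w\<in>L. \<chi> (brT z w) = 0"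
    "twisted_module sg br sS sT tens brT \<Gamma> act sV X (\<lambda>z v. \<phi> z v - sV (\<chi> z) v)"
proof -
  note mod = simple_lie_moduleD(1)[OF simple, unfolded lie_module_def]
  interpret V: ac_lin_space sV
    unfolding ac_lin_space_def lin_space_def using mod by blast
  have sX: "V.subspace X" using mod by blast
  have endo: "V.endo_on X (\<phi> z)" if "z \<in> L" for z using mod that unfolding V.endo_on_def by blast
  have add: "\<phi> (z + w) v = \<phi> z v + \<phi> w v" if "z \<in> L" "w \<in> L" "v \<in> X" for z w v using mod that by blast
  have sc: "\<phi> (sT c z) v = sV c (\<phi> z v)" if "z \<in> L" "v \<in> X" for c z v using mod that by blast
  have com: "\<phi> (brT z w) v = \<phi> z (\<phi> w v) - \<phi> w (\<phi> z v)" if "z \<in> L" "w \<in> L" "v \<in> X" for z w v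
    using mod that by blast
  obtain B where B: "finite B" "V.independent B" "V.span B = X" by (rule V.fin_dim_basis[OF X])
  have BX: "B \<subseteq> X" using V.span_superset[of B] B(3) by simp
  have endoB: "V.endo_on (V.span B) (\<phi> z)" if "z \<in> L" for z using endo[OF that] B(3) by simp
  have idB: "V.endo_on (V.span B) (\<lambda>v. v)" unfolding V.endo_on_def by simp
  have cB: "of_nat (card B) \<noteq> (0::'k)"
  proof -
    have "B \<noteq> {}" using simple_lie_moduleD(2)[OF simple] B(3) V.span_empty by auto
    then show ?thesis using B(1) by simp
  qed
  have tr_id: "V.trace B (\<lambda>v. sV c v) = c * of_nat (card B)" for c
  proof -
    have "V.trace B (\<lambda>v. v) = (\<Sum>b\<in>B. 1)"
      unfolding V.trace_def by (rule sum.cong) (simp_all add: V.representation_basis[OF B(2)])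
    then show ?thesis using V.trace_scale[OF B(1,2) idB, of c] by simp
  qed
  define \<chi> where "\<chi> z = V.trace B (\<phi> z) / of_nat (card B)" for z
  have \<chi>_add: "\<chi> (z + w) = \<chi> z + \<chi> w" if "z \<in> L" "w \<in> L" for z w
  proof -
    have "V.trace B (\<phi> (z + w)) = V.trace B (\<lambda>v. \<phi> z v + \<phi> w v)"
      by (rule V.trace_cong) (use add that BX in blast)
    then show ?thesis unfolding \<chi>_def
      using V.trace_add[OF B(1,2) endoB[OF that(1)] endoB[OF that(2)]] by (simp add: add_divide_distrib)
  qed
  have \<chi>_scale: "\<chi> (sT c z) = c * \<chi> z" if "z \<in> L" for c z
  proof -
    have "V.trace B (\<phi> (sT c z)) = V.trace B (\<lambda>v. sV c (\<phi> z v))"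
      by (rule V.trace_cong) (use sc that BX in blast)
    then show ?thesis unfolding \<chi>_def using V.trace_scale[OF B(1,2) endoB[OF that]] by simp
  qed
  have \<chi>_br: "\<chi> (brT z w) = 0" if "z \<in> L" "w \<in> L" for z w
  proof -
    have "V.trace B (\<phi> (brT z w)) = V.trace B (\<lambda>v. \<phi> z (\<phi> w v) - \<phi> w (\<phi> z v))"
      by (rule V.trace_cong) (use com that BX in blast)
    then show ?thesis unfolding \<chi>_def
      using V.trace_commutator[OF B(1,2) endoB[OF that(1)] endoB[OF that(2)]] by simp
  qed
  let ?\<psi> = "\<lambda>z v. \<phi> z v - sV (\<chi> z) v"
  have in\<phi>: "\<phi> z v \<in> X" if "z \<in> L" "v \<in> X" for z v using V.endo_on_in[OF endo] that by blast
  have endo\<psi>: "V.endo_on X (?\<psi> z)" if "z \<in> L" for z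
    unfolding V.endo_on_def
    using that by (auto simp: V.endo_on_add[OF endo] V.endo_on_scale[OF endo] in\<phi> V.subspace_diff[OF sX]
        V.subspace_scale[OF sX] V.scale_right_distrib V.scale_right_diff_distrib mult.commute)
  have simple\<psi>: "simple_lie_module sT brT L sV X ?\<psi>"
    unfolding simple_lie_module_def
  proof (intro conjI allI impI)
    show "X \<noteq> {0}" by (rule simple_lie_moduleD(2)[OF simple])
    show "lie_module sT brT L sV X ?\<psi>"
    proof (rule V.lie_moduleI[OF sX endo\<psi>])
      show "?\<psi> (x + y) v = ?\<psi> x v + ?\<psi> y v" if "x \<in> L" "y \<in> L" "v \<in> X" for x y v
        using that by (simp add: add \<chi>_add V.scale_left_distrib)
      show "?\<psi> (sT c x) v = sV c (?\<psi> x v)" if "x \<in> L" "v \<in> X" for c x v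
        using that by (simp add: sc \<chi>_scale V.scale_right_diff_distrib)
      show "?\<psi> (brT x y) v = ?\<psi> x (?\<psi> y v) - ?\<psi> y (?\<psi> x v)" if xy: "x \<in> L" "y \<in> L" and v: "v \<in> X" for x y v
      proof -
        have d: "\<phi> x' (\<phi> y' v - sV c v) = \<phi> x' (\<phi> y' v) - sV c (\<phi> x' v)" if "x' \<in> L" "y' \<in> L" for x' y' c
          using V.endo_on_diff[OF endo[OF that(1)] sX in\<phi>[OF that(2) v] V.subspace_scale[OF sX v]]
            V.endo_on_scale[OF endo[OF that(1)] v] by simp
        show ?thesis
          by (simp add: com[OF xy v] \<chi>_br[OF xy] d xy V.scale_right_diff_distrib mult.commute)
      qed
    qed
    fix U assume U: "V.subspace U \<and> U \<subseteq> X \<and> (\<forall>x\<in>L. \<forall>u\<in>U. ?\<psi> x u \<in> U)"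
    have "\<phi> x u \<in> U" if "x \<in> L" "u \<in> U" for x u
    proof -
      have "?\<psi> x u + sV (\<chi> x) u \<in> U" using U that V.subspace_add V.subspace_scale by blast
      then show ?thesis by simp
    qed
    then show "U = {0} \<or> U = X" using simple_lie_moduleD(3)[OF simple] U by blast
  qed
  have zero: "c = 0" if z: "z \<in> L" and c: "\<And>v. v \<in> X \<Longrightarrow> ?\<psi> z v = sV c v" for z c
  proof -
    have "V.trace B (\<phi> z) = V.trace B (\<lambda>v. sV (c + \<chi> z) v)"
    proof (rule V.trace_cong)
      fix b assume "b \<in> B"
      then show "\<phi> z b = sV (c + \<chi> z) b" using c[of b] BX by (simp add: V.scale_left_distrib diff_eq_eq subset_iff)
    qed
    then have "V.trace B (\<phi> z) = (c + \<chi> z) * of_nat (card B)" by (simp add: tr_id)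
    then have "(c + \<chi> z) * of_nat (card B) = \<chi> z * of_nat (card B)" unfolding \<chi>_def using cB by simp
    then show ?thesis using cB by simp
  qed
  have "twisted_module sg br sS sT tens brT \<Gamma> act sV X ?\<psi>"
    by (intro twisted_module.intro twisted_module_axioms.intro twisted_algebra_axioms simple\<psi> X zero)
  then show ?thesis using that[of \<chi>] \<chi>_add \<chi>_scale \<chi>_br by blast
qed

context twisted_module
begin

text \<open>Since \<open>e\<^sup>2 - e\<close> acts as zero, \<open>z \<mapsto> \<phi> (e z)\<close> is a representation of \<open>L\<close>.\<close>

lemma idempotent_action:
  assumes e: "e \<in> A" "e * e \<approx> e"
  shows "z \<in> L \<Longrightarrow> V.endo_on X (\<phi> (smul e z))"
    and "z \<in> L \<Longrightarrow> w \<in> L \<Longrightarrow> v \<in> X \<Longrightarrow> \<phi> (smul e (z + w)) v = \<phi> (smul e z) v + \<phi> (smul e w) v"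
    and "z \<in> L \<Longrightarrow> v \<in> X \<Longrightarrow> \<phi> (smul e (sT c z)) v = sV c (\<phi> (smul e z) v)"
    and "z \<in> L \<Longrightarrow> w \<in> L \<Longrightarrow> v \<in> X \<Longrightarrow>
      \<phi> (smul e (brT z w)) v = \<phi> (smul e z) (\<phi> (smul e w) v) - \<phi> (smul e w) (\<phi> (smul e z) v)"
proof -
  note eL = smul_L[OF e(1)]
  show "z \<in> L \<Longrightarrow> V.endo_on X (\<phi> (smul e z))" by (rule \<phi>_endo[OF eL])
  show "z \<in> L \<Longrightarrow> w \<in> L \<Longrightarrow> v \<in> X \<Longrightarrow> \<phi> (smul e (z + w)) v = \<phi> (smul e z) v + \<phi> (smul e w) v"
    by (simp add: smul_add_right \<phi>_add eL)
  show "z \<in> L \<Longrightarrow> v \<in> X \<Longrightarrow> \<phi> (smul e (sT c z)) v = sV c (\<phi> (smul e z) v)"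
    by (simp add: smul_scale \<phi>_scale eL)
  assume z: "z \<in> L" and w: "w \<in> L" and v: "v \<in> X"
  have br: "brT (smul e z) (smul e w) = smul (e * e) (brT z w)"
    by (simp add: brT_smul_left brT_smul_right smul_smul)
  have d: "smul (e * e - e) (brT z w) \<in> L"
    by (intro smul_L A_diff A_mult e L_brT z w)
  have "null (smul (e * e - e) (brT z w))"
    by (rule null_gtens_J0[OF d smul_in_gtens[OF J0_ideal]]) (use e(2) in \<open>simp add: eqv_def\<close>)
  then have "\<phi> (smul (e * e) (brT z w)) v = \<phi> (smul e (brT z w)) v"
    using \<phi>_diff[of "smul (e * e) (brT z w)" "smul e (brT z w)" v] v e z w
    by (simp add: null_def smul_diff_left smul_L A_mult L_brT)
  then show "\<phi> (smul e (brT z w)) v = \<phi> (smul e z) (\<phi> (smul e w) v) - \<phi> (smul e w) (\<phi> (smul e z) v)"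
    using \<phi>_brT[OF eL[OF z] eL[OF w] v] by (simp add: br)
qed

lemma orthogonal_commute:
  assumes e: "e \<in> A" "f \<in> A" "e * f \<in> J0" and z: "z \<in> L" "w \<in> L" and v: "v \<in> X"
  shows "\<phi> (smul e z) (\<phi> (smul f w) v) = \<phi> (smul f w) (\<phi> (smul e z) v)"
proof -
  have br: "brT (smul e z) (smul f w) = smul (e * f) (brT z w)"
    by (simp add: brT_smul_left brT_smul_right smul_smul mult.commute)
  have "null (smul (e * f) (brT z w))"
    by (rule null_gtens_J0[OF _ smul_in_gtens[OF J0_ideal e(3)]]) (intro smul_L A_mult L_brT e z)
  then show ?thesis
    using \<phi>_brT[OF smul_L[OF e(1) z(1)] smul_L[OF e(2) z(2)] v] v by (simp add: br null_def)
qed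

lemma orthogonal_sum:
  assumes E: "orthogonal_system E" and z: "z \<in> L" and v: "v \<in> X"
  shows "\<phi> z v = (\<Sum>e\<in>E. \<phi> (smul e z) v)"
proof -
  have EA: "E \<subseteq> A" and one: "\<Sum>E \<approx> 1" using E unfolding orthogonal_system_def by auto
  have sA: "\<Sum>E \<in> A" by (rule A_sum) (use EA in auto)
  have "null (smul (\<Sum>E - 1) z)"
    by (rule null_gtens_J0[OF smul_L[OF A_diff[OF sA A_one] z] smul_in_gtens[OF J0_ideal]])
      (use one in \<open>simp add: eqv_def\<close>)
  then have "\<phi> (smul (\<Sum>E) z) v = \<phi> z v"
    using \<phi>_diff[OF smul_L[OF sA z] z v] v by (simp add: null_def smul_diff_left)
  moreover have "\<phi> (smul (\<Sum>E) z) v = (\<Sum>e\<in>E. \<phi> (smul e z) v)"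
    unfolding smul_sum_left by (rule \<phi>_sum[OF smul_L[OF _ z] v]) (use EA in auto)
  ultimately show ?thesis by simp
qed

end

context twisted_algebra
begin

text \<open>
  The operators \<open>\<chi> z\<close> and \<open>\<phi> (e\<^sub>i z)\<close>, for the character \<open>\<chi>\<close> and the idempotents \<open>e\<^sub>i\<close>, give commuting
  actions of \<open>L\<close> whose sum is the given one.  They act irreducibly together, so the module is a
  tensor product of irreducible modules for the single actions.  The factor of \<open>\<chi>\<close> has dimension 1,
  and the action on the factor of \<open>e\<^sub>i\<close> factors through evaluation at the point above \<open>e\<^sub>i\<close>.
\<close>

theorem tensor_decomposition:
  fixes sV :: "'k \<Rightarrow> 'v::ab_group_add \<Rightarrow> 'v"
  assumes simple: "simple_lie_module sT brT L sV X \<phi>" and X: "fin_dim sV X"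
  obtains r :: nat and M Vs \<phi>s W \<omega> \<tau> where
    "\<forall>i\<in>{1..r}. M i \<in> Max_spec"
    "\<forall>i\<in>{1..r}. \<forall>j\<in>{1..r}. i \<noteq> j \<longrightarrow>
       orbit \<Gamma> (max_act sT tens act) (M i) \<noteq> orbit \<Gamma> (max_act sT tens act) (M j)"
    "\<forall>i\<in>{1..r}. fin_dim sV (Vs i) \<and>
       simple_lie_module sg br (fixed_at sg sS sT tens \<Gamma> act (M i)) sV (Vs i) (\<phi>s i)"
    "lie_module sT brT L sV W \<omega>" "vector_space.dim sV W = 1"
    "is_tensor_lie_module sT brT L {0..r} sV (\<lambda>i. if i = 0 then W else Vs i)
       (\<lambda>i z. if i = 0 then \<omega> z else \<phi>s i (eval_at sg sS tens z (M i))) sV X \<phi> \<tau>"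
proof -
  obtain \<chi> where \<chi>: "\<forall>z\<in>L. \<forall>w\<in>L. \<chi> (z + w) = \<chi> z + \<chi> w"
    "\<forall>c. \<forall>z\<in>L. \<chi> (sT c z) = c * \<chi> z" "\<forall>z\<in>L. \<forall>w\<in>L. \<chi> (brT z w) = 0"
    and tm: "twisted_module sg br sS sT tens brT \<Gamma> act sV X (\<lambda>z v. \<phi> z v - sV (\<chi> z) v)"
    by (rule traceless_twist[OF simple X])
  define \<psi> where "\<psi> z v = \<phi> z v - sV (\<chi> z) v" for z v
  interpret N: twisted_module sg br sS sT tens brT \<Gamma> act sV X \<psi>
    unfolding \<psi>_def by (rule tm)
  note sX = N.X_subspace
  obtain E Me where E: "N.orthogonal_system E" and Me: "\<And>e. e \<in> E \<Longrightarrow> rational_point (Me e)"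
    and dist: "\<And>e e' \<gamma>. e \<in> E \<Longrightarrow> e' \<in> E \<Longrightarrow> e \<noteq> e' \<Longrightarrow> \<gamma> \<in> G \<Longrightarrow> Me e \<noteq> gS \<gamma> ` Me e'"
    and ker: "\<And>e z. e \<in> E \<Longrightarrow> z \<in> L \<Longrightarrow> ev (Me e) z = 0 \<Longrightarrow> N.null (smul e z)"
    by (rule N.orthogonal_points) blast
  define r where "r = card E"
  have finE: "finite E" using E unfolding N.orthogonal_system_def by blast
  obtain f where f: "bij_betw f {1..r} E" using ex_bij_betw_nat_finite_1[OF finE] unfolding r_def by blast
  have fE: "f i \<in> E" if "i \<in> {1..r}" for i using bij_betwE[OF f] that by blast
  have finj: "f i \<noteq> f j" if "i \<in> {1..r}" "j \<in> {1..r}" "i \<noteq> j" for i j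
    using bij_betw_imp_inj_on[OF f] that unfolding inj_on_def by blast
  have fA: "f i \<in> A" "N.eqv (f i * f i) (f i)" if "i \<in> {1..r}" for i
    using E fE[OF that] unfolding N.orthogonal_system_def by blast+
  have ff: "f i * f j \<in> N.J0" if "i \<in> {1..r}" "j \<in> {1..r}" "i \<noteq> j" for i j
    using E fE that finj[OF that] unfolding N.orthogonal_system_def by metis
  define M where "M i = Me (f i)" for i
  have M: "rational_point (M i)" if "i \<in> {1..r}" for i unfolding M_def by (rule Me[OF fE[OF that]])
  \<comment> \<open>index 0 is the character\<close>
  define \<rho> where "\<rho> i z = (if i = 0 then sV (\<chi> z) else \<psi> (smul (f i) z))" for i :: nat and z
  let ?I = "{0..r}"
  have I: "?I = insert 0 {1..r}" by auto
  have endo: "N.V.endo_on X (\<rho> i z)" if "i \<in> ?I" "z \<in> L" for i z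
  proof (cases "i = 0")
    case True
    then show ?thesis unfolding \<rho>_def N.V.endo_on_def
      by (auto simp: N.V.subspace_scale[OF sX] N.V.scale_right_distrib mult.commute)
  next
    case False
    then show ?thesis using N.idempotent_action(1)[OF fA] that unfolding \<rho>_def by simp
  qed
  have add: "\<rho> i (z + w) v = \<rho> i z v + \<rho> i w v" if "i \<in> ?I" "z \<in> L" "w \<in> L" "v \<in> X" for i z w v
    using N.idempotent_action(2)[OF fA, of i z w v] \<chi>(1) that unfolding \<rho>_def by (auto simp: N.V.scale_left_distrib)
  have sc: "\<rho> i (sT c z) v = sV c (\<rho> i z v)" if "i \<in> ?I" "z \<in> L" "v \<in> X" for i c z v
    using N.idempotent_action(3)[OF fA, of i z v c] \<chi>(2) that unfolding \<rho>_def by auto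
  have br: "\<rho> i (brT z w) v = \<rho> i z (\<rho> i w v) - \<rho> i w (\<rho> i z v)" if "i \<in> ?I" "z \<in> L" "w \<in> L" "v \<in> X" for i z w v
    using N.idempotent_action(4)[OF fA, of i z w v] \<chi>(3) that unfolding \<rho>_def by (auto simp: mult.commute)
  have total: "\<phi> z v = (\<Sum>i\<in>?I. \<rho> i z v)" if z: "z \<in> L" and v: "v \<in> X" for z v
  proof -
    have "\<psi> z v = (\<Sum>e\<in>E. \<psi> (smul e z) v)" by (rule N.orthogonal_sum[OF E z v])
    also have "\<dots> = (\<Sum>i\<in>{1..r}. \<psi> (smul (f i) z) v)" by (rule sum.reindex_bij_betw[OF f, symmetric])
    also have "\<dots> = (\<Sum>i\<in>{1..r}. \<rho> i z v)" by (rule sum.cong) (auto simp: \<rho>_def)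
    finally have "\<phi> z v = sV (\<chi> z) v + (\<Sum>i\<in>{1..r}. \<rho> i z v)" unfolding \<psi>_def by (simp add: algebra_simps)
    moreover have "(\<Sum>i\<in>?I. \<rho> i z v) = \<rho> 0 z v + (\<Sum>i\<in>{1..r}. \<rho> i z v)"
      unfolding I by (subst sum.insert) auto
    ultimately show ?thesis by (simp add: \<rho>_def)
  qed
  have irr: "N.V.irreducible_on X (\<Union>i\<in>?I. \<rho> i ` L)"
    unfolding N.V.irreducible_on_def
  proof (intro conjI allI impI)
    show "X \<noteq> {0}" by (rule simple_lie_moduleD(2)[OF simple])
    fix U assume U: "N.V.subspace U \<and> U \<subseteq> X \<and> (\<forall>f\<in>\<Union>i\<in>?I. \<rho> i ` L. \<forall>u\<in>U. f u \<in> U)"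
    have "\<phi> z u \<in> U" if z: "z \<in> L" and u: "u \<in> U" for z u
    proof -
      have uX: "u \<in> X" using U u by blast
      have "(\<Sum>i\<in>?I. \<rho> i z u) \<in> U"
      proof (rule N.V.subspace_sum)
        show "N.V.subspace U" using U by blast
        show "\<rho> i z u \<in> U" if "i \<in> ?I" for i using U that z u by blast
      qed
      then show ?thesis using total[OF z uX] by simp
    qed
    then show "U = {0} \<or> U = X" using simple_lie_moduleD(3)[OF simple] U by blast
  qed (rule sX)
  have comm: "p (q v) = q (p v)"
    if ij: "i \<in> ?I" "j \<in> ?I" "i \<noteq> j" and pq: "p \<in> \<rho> i ` L" "q \<in> \<rho> j ` L" and v: "v \<in> X" for i j p q v
  proof -
    obtain z where z: "z \<in> L" "p = \<rho> i z" using pq by blast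
    obtain w where w: "w \<in> L" "q = \<rho> j w" using pq by blast
    consider "i = 0" | "j = 0" | "i \<in> {1..r}" "j \<in> {1..r}" using ij by force
    then show ?thesis
    proof cases
      case 1
      then show ?thesis using N.V.endo_on_scale[OF endo[OF ij(2) w(1)] v, of "\<chi> z"] z w by (simp add: \<rho>_def)
    next
      case 2
      then show ?thesis using N.V.endo_on_scale[OF endo[OF ij(1) z(1)] v, of "\<chi> w"] z w by (simp add: \<rho>_def)
    next
      case 3
      then show ?thesis
        using N.orthogonal_commute[OF fA(1)[OF 3(1)] fA(1)[OF 3(2)] ff[OF 3 ij(3)] z(1) w(1) v] z w by (simp add: \<rho>_def)
    qed
  qed
  have "\<exists>Vs \<tau> B. (\<forall>i\<in>?I. Vs i \<subseteq> X \<and> N.V.irreducible_on (Vs i) (\<rho> i ` L) \<and> (\<forall>p\<in>\<rho> i ` L. N.V.endo_on (Vs i) p) \<and>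
       finite (B i) \<and> N.V.independent (B i) \<and> N.V.span (B i) = Vs i) \<and>
     N.V.multilinear_on ?I Vs X \<tau> \<and>
     (\<forall>i\<in>?I. \<forall>p\<in>\<rho> i ` L. \<forall>v\<in>Pi\<^sub>E ?I Vs. p (\<tau> v) = \<tau> (v(i := p (v i)))) \<and>
     N.V.indep_family (Pi\<^sub>E ?I B) \<tau> \<and> N.V.span (\<tau> ` Pi\<^sub>E ?I B) = X"
  proof (rule N.V.irreducible_many_factors[OF _ X irr])
    show "N.V.endo_on X p" if "i \<in> ?I" "p \<in> \<rho> i ` L" for i p using that endo by blast
    show "p (q v) = q (p v)"
      if "i \<in> ?I" "j \<in> ?I" "i \<noteq> j" "p \<in> \<rho> i ` L" "q \<in> \<rho> j ` L" "v \<in> X" for i j p q v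
      by (rule comm[OF that])
  qed simp
  then obtain Vs \<tau> B where
    H: "\<forall>i\<in>?I. Vs i \<subseteq> X \<and> N.V.irreducible_on (Vs i) (\<rho> i ` L) \<and> (\<forall>p\<in>\<rho> i ` L. N.V.endo_on (Vs i) p) \<and>
       finite (B i) \<and> N.V.independent (B i) \<and> N.V.span (B i) = Vs i"
    and ml: "N.V.multilinear_on ?I Vs X \<tau>"
    and eq: "\<forall>i\<in>?I. \<forall>p\<in>\<rho> i ` L. \<forall>v\<in>Pi\<^sub>E ?I Vs. p (\<tau> v) = \<tau> (v(i := p (v i)))"
    and ind: "N.V.indep_family (Pi\<^sub>E ?I B) \<tau>" and sp: "N.V.span (\<tau> ` Pi\<^sub>E ?I B) = X"
    by blast
  have VX: "Vs i \<subseteq> X" and Virr: "N.V.irreducible_on (Vs i) (\<rho> i ` L)"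
    and Vendo: "\<And>z. z \<in> L \<Longrightarrow> N.V.endo_on (Vs i) (\<rho> i z)"
    and B: "finite (B i)" "N.V.independent (B i)" "N.V.span (B i) = Vs i" if "i \<in> ?I" for i
    using H that by blast+
  have Vsub: "N.V.subspace (Vs i)" "Vs i \<noteq> {0}" if "i \<in> ?I" for i
    using Virr[OF that] unfolding N.V.irreducible_on_def by blast+
  have Vmod: "lie_module sT brT L sV (Vs i) (\<rho> i)" if i: "i \<in> ?I" for i
    by (rule N.V.lie_moduleI[OF Vsub(1)[OF i] Vendo[OF i]]) (use VX[OF i] add[OF i] sc[OF i] br[OF i] in blast)+
  have ev_in: "ev (M i) z \<in> fixed_at sg sS sT tens \<Gamma> act (M i)" if "i \<in> {1..r}" "z \<in> L" for i z
    by (rule ev_L_fixed_at[OF M[OF that(1)] that(2)])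
  define \<phi>s where "\<phi>s i x = \<rho> i (SOME z. z \<in> L \<and> ev (M i) z = x)" for i x
  have \<phi>s: "\<phi>s i (ev (M i) z) v = \<rho> i z v" if i: "i \<in> {1..r}" and z: "z \<in> L" and v: "v \<in> X" for i z v
  proof -
    define z' where "z' = (SOME z'. z' \<in> L \<and> ev (M i) z' = ev (M i) z)"
    have z': "z' \<in> L" "ev (M i) z' = ev (M i) z"
      using someI[of "\<lambda>z'. z' \<in> L \<and> ev (M i) z' = ev (M i) z" z] z unfolding z'_def by blast+
    have d: "z' - z \<in> L" by (rule T.subspace_diff[OF L_subspace z'(1) z])
    have "ev (Me (f i)) (z' - z) = 0" using ev_diff[OF M[OF i]] z'(2) unfolding M_def by simp
    then have "N.null (smul (f i) (z' - z))" by (rule ker[OF fE[OF i] d])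
    then have "\<psi> (smul (f i) z') v = \<psi> (smul (f i) z) v"
      using N.\<phi>_diff[OF smul_L[OF fA(1)[OF i] z'(1)] smul_L[OF fA(1)[OF i] z] v] v
      by (simp add: N.null_def smul_diff_right)
    then show ?thesis using i unfolding \<phi>s_def z'_def[symmetric] by (simp add: \<rho>_def)
  qed
  have surj: "\<exists>z. z \<in> L \<and> x = ev (M i) z" if "i \<in> {1..r}" "x \<in> fixed_at sg sS sT tens \<Gamma> act (M i)" for i x
    using ev_surjective[OF M[OF that(1)] that(2)] by metis
  show ?thesis
  proof (rule that)
    show "\<forall>i\<in>{1..r}. M i \<in> Max_spec" using rational_point_Max_spec M by blast
    show "\<forall>i\<in>{1..r}. \<forall>j\<in>{1..r}. i \<noteq> j \<longrightarrow>
       orbit \<Gamma> (max_act sT tens act) (M i) \<noteq> orbit \<Gamma> (max_act sT tens act) (M j)"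
    proof (intro ballI impI)
      fix i j assume ij: "i \<in> {1..r}" "j \<in> {1..r}" "i \<noteq> j"
      have "max_act sT tens act \<one>\<^bsub>\<Gamma>\<^esub> (M i) = M i" using max_act_eq[OF grp.one_closed M[OF ij(1)]] by (simp add: gS_id)
      then have 1: "M i \<in> orbit \<Gamma> (max_act sT tens act) (M i)" unfolding orbit_def by (metis (mono_tags, lifting) grp.one_closed mem_Collect_eq)
      have "M i \<notin> orbit \<Gamma> (max_act sT tens act) (M j)"
      proof
        assume "M i \<in> orbit \<Gamma> (max_act sT tens act) (M j)"
        then obtain \<gamma> where "\<gamma> \<in> G" "M i = max_act sT tens act \<gamma> (M j)" unfolding orbit_def by blast
        then show False
          using dist[OF fE[OF ij(1)] fE[OF ij(2)] finj[OF ij]] max_act_eq[OF _ M[OF ij(2)]]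
          unfolding M_def by metis
      qed
      then show "orbit \<Gamma> (max_act sT tens act) (M i) \<noteq> orbit \<Gamma> (max_act sT tens act) (M j)" using 1 by blast
    qed
    show "\<forall>i\<in>{1..r}. fin_dim sV (Vs i) \<and>
       simple_lie_module sg br (fixed_at sg sS sT tens \<Gamma> act (M i)) sV (Vs i) (\<phi>s i)"
    proof (intro ballI conjI)
      fix i assume i: "i \<in> {1..r}"
      then have iI: "i \<in> ?I" by simp
      show "fin_dim sV (Vs i)" by (rule N.V.fin_dim_subspace[OF X Vsub(1)[OF iI] VX[OF iI]])
      show "simple_lie_module sg br (fixed_at sg sS sT tens \<Gamma> act (M i)) sV (Vs i) (\<phi>s i)"
      proof (rule N.V.simple_module_over_image[where \<epsilon> = "ev (M i)", OF Vmod[OF iI] Virr[OF iI]])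
        show "ev (M i) ` L = fixed_at sg sS sT tens \<Gamma> act (M i)" using ev_in[OF i] surj[OF i] by blast
        show "\<phi>s i (ev (M i) z) v = \<rho> i z v" if "z \<in> L" "v \<in> Vs i" for z v
          using \<phi>s[OF i that(1)] that(2) VX[OF iI] by blast
      qed (simp_all add: L_add L_scale L_brT ev_add[OF M[OF i]] ev_scale[OF M[OF i]] ev_brT[OF M[OF i]])
    qed
    have 0: "0 \<in> ?I" by simp
    show "lie_module sT brT L sV (Vs 0) (\<rho> 0)" by (rule Vmod[OF 0])
    show "vector_space.dim sV (Vs 0) = 1"
      by (rule N.V.irreducible_under_scalars_dim[OF Virr[OF 0]]) (auto simp: \<rho>_def)
    have fam: "(\<lambda>i. if i = 0 then Vs 0 else Vs i) = Vs" by (rule ext) simp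
    let ?\<rho> = "\<lambda>i z. if i = 0 then \<rho> 0 z else \<phi>s i (eval_at sg sS tens z (M i))"
    have \<rho>eq: "?\<rho> i z v = \<rho> i z v" if "i \<in> ?I" "z \<in> L" "v \<in> Vs i" for i z v
      using \<phi>s[of i z v] that VX[OF that(1)] eval_at_eq_ev[OF M, of i z] by (cases "i = 0") auto
    show "is_tensor_lie_module sT brT L ?I sV (\<lambda>i. if i = 0 then Vs 0 else Vs i) ?\<rho> sV X \<phi> \<tau>"
      unfolding is_tensor_lie_module_def fam
    proof (intro conjI ballI)
      fix i assume i: "i \<in> ?I"
      show "lie_module sT brT L sV (Vs i) (?\<rho> i)"
        by (rule lie_module_cong[OF Vmod[OF i] L_add L_scale L_brT \<rho>eq[OF i]])
    next
      show "presented_by sV X (Pi\<^sub>E ?I Vs) (multilinear_relations ?I sV Vs) \<tau>"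
        by (rule N.V.presented_by_multilinear[OF _ B(1,3) ml sX ind sp]) simp_all
      show "lie_module sT brT L sV X \<phi>" by (rule simple_lie_moduleD(1)[OF simple])
      fix z v assume z: "z \<in> L" and v: "v \<in> Pi\<^sub>E ?I Vs"
      have "\<tau> v \<in> X" using ml v unfolding N.V.multilinear_on_def by blast
      then have "\<phi> z (\<tau> v) = (\<Sum>i\<in>?I. \<rho> i z (\<tau> v))" by (rule total[OF z])
      also have "\<dots> = (\<Sum>i\<in>?I. \<tau> (v(i := ?\<rho> i z (v i))))"
      proof (rule sum.cong)
        fix i assume i: "i \<in> ?I"
        have "v i \<in> Vs i" using v i by (rule PiE_mem)
        then have e: "?\<rho> i z (v i) = \<rho> i z (v i)" by (rule \<rho>eq[OF i z])
        have "\<rho> i z (\<tau> v) = \<tau> (v(i := \<rho> i z (v i)))" using eq i z v by blast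
        then show "\<rho> i z (\<tau> v) = \<tau> (v(i := ?\<rho> i z (v i)))" by (simp only: e)
      qed simp
      finally show "\<phi> z (\<tau> v) = (\<Sum>i\<in>?I. \<tau> (v(i := ?\<rho> i z (v i))))" .
    qed
  qed
qed

end

text \<open>
  All modules in the conclusion of the theorem live in the space of finitely supported sequences,
  so \<open>V\<close> is copied there first, by means of the coefficients with respect to a basis.
\<close>

lemma simple_lie_module_copy:
  fixes sV :: "'k::field \<Rightarrow> 'v::ab_group_add \<Rightarrow> 'v"
  assumes simple: "simple_lie_module sL br L sV UNIV \<phi>" and V: "fin_dim sV UNIV"
  obtains X :: "(nat \<Rightarrow>\<^sub>0 'k) set" and \<theta> where
    "simple_lie_module sL br L free_scale X \<theta>" "fin_dim free_scale X"
    "lie_module_iso L sV UNIV \<phi> free_scale X \<theta>"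
proof -
  note mod = simple_lie_moduleD(1)[OF simple, unfolded lie_module_def]
  interpret V: lin_space sV unfolding lin_space_def using mod by blast
  obtain B where B: "finite B" "V.independent B" "V.span B = UNIV" by (rule V.fin_dim_basis[OF V])
  obtain b where b: "bij_betw b {0..<card B} B" using ex_bij_betw_nat_finite[OF B(1)] by blast
  define h :: "'v \<Rightarrow> nat \<Rightarrow>\<^sub>0 'k" where
    "h v = (\<Sum>i\<in>{0..<card B}. free_scale (V.representation B v (b i)) (free_gen i))" for v
  have rep_add: "V.representation B (v + w) c = V.representation B v c + V.representation B w c" for v w c
    using V.representation_add[OF B(2)] B(3) by auto
  have rep_scale: "V.representation B (sV a v) c = a * V.representation B v c" for a v c
    using V.representation_scale[OF B(2)] B(3) by auto
  have h_add: "h (v + w) = h v + h w" for v w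
    unfolding h_def by (simp add: rep_add free.scale_left_distrib sum.distrib)
  have h_scale: "h (sV c v) = free_scale c (h v)" for c v
    unfolding h_def by (simp add: rep_scale free.scale_sum_right)
  have h_diff: "h (v - w) = h v - h w" for v w using h_add[of "v - w" w] by (simp add: algebra_simps)
  have h_0: "h 0 = 0" using h_scale[of 0 0] by simp
  have h_lookup: "Poly_Mapping.lookup (h v) i = V.representation B v (b i)" if "i < card B" for v i
    using that unfolding h_def
    by (simp add: lookup_sum free_gen_def lookup_single when_def if_distrib cong: if_cong)
  have h_inj: "inj h"
  proof (rule injI)
    fix v w assume hvw: "h v = h w"
    have rep: "V.representation B v c = V.representation B w c" if c: "c \<in> B" for c
    proof -
      obtain i where "i \<in> {0..<card B}" "c = b i" using c bij_betw_imp_surj_on[OF b] by blast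
      then show ?thesis using h_lookup[of i v] h_lookup[of i w] hvw by simp
    qed
    have "v = (\<Sum>c\<in>B. sV (V.representation B v c) c)" using V.lincomb_representation[OF B(1,2), of v] B(3) by simp
    also have "\<dots> = (\<Sum>c\<in>B. sV (V.representation B w c) c)" by (rule sum.cong) (simp_all add: rep)
    also have "\<dots> = w" using V.lincomb_representation[OF B(1,2), of w] B(3) by simp
    finally show "v = w" .
  qed
  define X where "X = range h"
  define \<theta> where "\<theta> z x = h (\<phi> z (inv_into UNIV h x))" for z x
  have \<theta>h: "\<theta> z (h v) = h (\<phi> z v)" for z v unfolding \<theta>_def using h_inj by simp
  have sX: "free.subspace X"
    unfolding free.subspace_def X_def
    by (auto simp: h_0[symmetric] h_add[symmetric] h_scale[symmetric])
  have fX: "fin_dim free_scale X"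
    unfolding fin_dim_def
  proof (intro exI[of _ "h ` B"] conjI)
    show "finite (h ` B)" using B by simp
    have "h v \<in> free.span (h ` B)" for v
    proof -
      have hs: "h (\<Sum>c\<in>C. sV (r c) c) = (\<Sum>c\<in>C. free_scale (r c) (h c))" for C r
        by (induction C rule: infinite_finite_induct) (auto simp: h_0 h_add h_scale)
      have "h v = (\<Sum>c\<in>B. free_scale (V.representation B v c) (h c))"
        using hs[of "V.representation B v" B] V.lincomb_representation[OF B(1,2), of v] B(3) by simp
      moreover have "\<dots> \<in> free.span (h ` B)"
        by (intro free.span_sum free.span_scale free.span_base imageI)
      ultimately show ?thesis by simp
    qed
    then show "free.span (h ` B) = X" using free.span_minimal[OF _ sX, of "h ` B"] unfolding X_def by auto
  qed
  have iso: "lie_module_iso L sV UNIV \<phi> free_scale X \<theta>"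
    unfolding lie_module_iso_def
  proof (intro exI[of _ h] conjI)
    show "bij_betw h UNIV X" unfolding X_def using h_inj by (simp add: bij_betw_def)
  qed (auto simp: h_add h_scale \<theta>h)
  have "simple_lie_module sL br L free_scale X \<theta>"
    unfolding simple_lie_module_def
  proof (intro conjI allI impI)
    obtain v :: 'v where "v \<noteq> 0" using simple_lie_moduleD(2)[OF simple] by auto
    then have "h v \<noteq> 0" using h_inj h_0 by (metis injD)
    then show "X \<noteq> {0}" unfolding X_def by auto
    show "lie_module sL br L free_scale X \<theta>"
    proof (rule free.lie_moduleI[OF sX])
      fix x assume x: "x \<in> L"
      show "free.endo_on X (\<theta> x)"
        using mod x unfolding free.endo_on_def X_def
        by (auto simp: \<theta>h h_add[symmetric] h_scale[symmetric])
      fix u assume "u \<in> X"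
      then obtain v where u: "u = h v" unfolding X_def by blast
      show "\<theta> (sL c x) u = free_scale c (\<theta> x u)" for c using mod x by (simp add: u \<theta>h h_scale[symmetric])
      fix y assume y: "y \<in> L"
      show "\<theta> (x + y) u = \<theta> x u + \<theta> y u" using mod x y by (simp add: u \<theta>h h_add[symmetric])
      show "\<theta> (br x y) u = \<theta> x (\<theta> y u) - \<theta> y (\<theta> x u)" using mod x y by (simp add: u \<theta>h h_diff[symmetric])
    qed
    fix U assume U: "free.subspace U \<and> U \<subseteq> X \<and> (\<forall>x\<in>L. \<forall>u\<in>U. \<theta> x u \<in> U)"
    let ?U = "h -` U"
    have hU: "h ` ?U = U" using U unfolding X_def by auto
    have "?U = {0} \<or> ?U = UNIV"
    proof (rule simple_lie_moduleD(3)[OF simple])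
      show "V.subspace ?U" unfolding V.subspace_def using U
        by (auto simp: h_0 h_add h_scale free.subspace_0 free.subspace_add free.subspace_scale)
      show "\<phi> x u \<in> ?U" if "x \<in> L" "u \<in> ?U" for x u using U that by (auto simp: \<theta>h[symmetric])
    qed simp
    then show "U = {0} \<or> U = X"
    proof
      assume "?U = {0}"
      then show ?thesis using hU h_0 by auto
    next
      assume "?U = UNIV"
      then show ?thesis using hU unfolding X_def by auto
    qed
  qed
  then show ?thesis using that fX iso by blast
qed

theorem theorem3p1:
  fixes sg :: "'k::{alg_closed_field, field_char_0} \<Rightarrow> 'g::ab_group_add \<Rightarrow> 'g"
    and br :: "'g \<Rightarrow> 'g \<Rightarrow> 'g"
    and sS :: "'k \<Rightarrow> 's::{comm_ring, comm_monoid_mult} \<Rightarrow> 's"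
    and sT :: "'k \<Rightarrow> 't::ab_group_add \<Rightarrow> 't"
    and tens :: "'g \<Rightarrow> 's \<Rightarrow> 't"
    and brT :: "'t \<Rightarrow> 't \<Rightarrow> 't"
    and \<Gamma> :: "('c, 'd) monoid_scheme"
    and act :: "'c \<Rightarrow> 't \<Rightarrow> 't"
    and L :: "'t set"
    and sV :: "'k \<Rightarrow> 'v::ab_group_add \<Rightarrow> 'v"
    and \<phi> :: "'t \<Rightarrow> 'v \<Rightarrow> 'v"
  assumes g_simple: "simple_lie_algebra sg br"
    and g_fin_dim: "fin_dim sg UNIV"
    and S_algebra: "comm_algebra sS"
    and S_reduced: "\<And>(s::'s) (n::nat). s ^ n = 0 \<Longrightarrow> s = 0"
    and S_finite_type: "finite_type sS"
    and T_tensor: "is_tensor_product sg sS sT tens"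
    and T_lie: "lie_algebra sT brT"
    and T_bracket: "\<And>x r y s. brT (tens x r) (tens y s) = tens (br x y) (r * s)"
    and \<Gamma>_finite: "finite (carrier \<Gamma>)"
    and \<Gamma>_action: "group_action \<Gamma> (UNIV :: 't set) act"
    and \<Gamma>_linear: "\<And>\<gamma>. \<gamma> \<in> carrier \<Gamma> \<Longrightarrow> Vector_Spaces.linear sT sT (act \<gamma>)"
    and \<Gamma>_bracket: "\<And>\<gamma> z w. \<gamma> \<in> carrier \<Gamma> \<Longrightarrow> act \<gamma> (brT z w) = brT (act \<gamma> z) (act \<gamma> w)"
    and L_def: "L = fixed_subalgebra \<Gamma> act"
    and V_simple: "simple_lie_module sT brT L sV UNIV \<phi>"
    and V_fin_dim: "fin_dim sV UNIV"
  shows "\<exists>(r::nat) (M :: nat \<Rightarrow> 's set)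
           (Vs :: nat \<Rightarrow> (nat \<Rightarrow>\<^sub>0 'k) set) (\<phi>s :: nat \<Rightarrow> 'g \<Rightarrow> (nat \<Rightarrow>\<^sub>0 'k) \<Rightarrow> (nat \<Rightarrow>\<^sub>0 'k))
           (W :: (nat \<Rightarrow>\<^sub>0 'k) set) (\<omega> :: 't \<Rightarrow> (nat \<Rightarrow>\<^sub>0 'k) \<Rightarrow> (nat \<Rightarrow>\<^sub>0 'k))
           (T :: (nat \<Rightarrow>\<^sub>0 'k) set) (\<theta> :: 't \<Rightarrow> (nat \<Rightarrow>\<^sub>0 'k) \<Rightarrow> (nat \<Rightarrow>\<^sub>0 'k))
           (\<tau> :: (nat \<Rightarrow> (nat \<Rightarrow>\<^sub>0 'k)) \<Rightarrow> (nat \<Rightarrow>\<^sub>0 'k)).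
         (\<forall>i\<in>{1..r}. M i \<in> Max_spec) \<and>
         (\<forall>i\<in>{1..r}. \<forall>j\<in>{1..r}. i \<noteq> j \<longrightarrow>
            orbit \<Gamma> (max_act sT tens act) (M i) \<noteq> orbit \<Gamma> (max_act sT tens act) (M j)) \<and>
         (\<forall>i\<in>{1..r}. fin_dim free_scale (Vs i) \<and>
            simple_lie_module sg br (fixed_at sg sS sT tens \<Gamma> act (M i)) free_scale (Vs i) (\<phi>s i)) \<and>
         lie_module sT brT L free_scale W \<omega> \<and>
         vector_space.dim free_scale W = 1 \<and>
         is_tensor_lie_module sT brT L {0..r} free_scale
           (\<lambda>i. if i = 0 then W else Vs i)
           (\<lambda>i z. if i = 0 then \<omega> z else \<phi>s i (eval_at sg sS tens z (M i)))
           free_scale T \<theta> \<tau> \<and>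
         lie_module_iso L sV UNIV \<phi> free_scale T \<theta>"
proof -
  interpret TA: twisted_algebra sg br sS sT tens brT \<Gamma> act
    by (intro twisted_algebra.intro twisted_algebra_axioms.intro current_algebra.intro
        g_simple g_fin_dim S_algebra T_tensor T_lie T_bracket \<Gamma>_finite \<Gamma>_action \<Gamma>_linear \<Gamma>_bracket)
  have L: "L = TA.L" by (simp only: L_def TA.L_def)
  obtain T :: "(nat \<Rightarrow>\<^sub>0 'k) set" and \<theta> where
    T: "simple_lie_module sT brT L free_scale T \<theta>" "fin_dim free_scale T"
      "lie_module_iso L sV UNIV \<phi> free_scale T \<theta>"
    by (rule simple_lie_module_copy[OF V_simple V_fin_dim])
  show ?thesis
  proof (rule TA.tensor_decomposition[OF T(1)[unfolded L] T(2), folded L], goal_cases)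
    case (1 r M Vs \<phi>s W \<omega> \<tau>)
    with T(3) show ?case
      by (intro exI[of _ r] exI[of _ M] exI[of _ Vs] exI[of _ \<phi>s] exI[of _ W] exI[of _ \<omega>]
          exI[of _ T] exI[of _ \<theta>] exI[of _ \<tau>] conjI)
  qed
qed

end
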